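(* Suppose there is $(\beta^*,\theta^* )\in\mathbb R^q\times\Theta$ such that for all $\mathbf X$ the distribution of $\mathbf y\mid\mathbf X$ under $P$ has the elliptically contoured density $f_{\mu,\Sigma}$ with $\mu=\mathbf X\beta^*$ and $\Sigma=\mathbf V(\theta^* )$, and suppose $\mathbb E\|\mathbf X\|^2<\infty$. For $j=0,1$ let $\rho_j$ be such that for some finite $c_j>0$ it is non-decreasing on $[0,c_j]$ and constant on $[c_j,\infty)$, $\rho_j$ is continuously differentiable and $s\mapsto\rho_j'(s)/s$ is continuous; suppose moreover that $\rho_1$ is twice continuously differentiable. Suppose $\mathbf V$ is twice continuously differentiable and has the linear structure $\mathbf V(\gamma)=\sum_{j=1}^l\gamma_j\mathbf L_j$, where the $k^2\times l$ matrix $\mathbf L=[\mathrm{vec}(\mathbf L_1)\ \cdots\ \mathrm{vec}(\mathbf L_l)]$ has full rank. Fix $\mathbf s_0=(\mathbf y_0,\mathbf X_0)\in\mathbb R^k\times\mathbb R^{kq}$. Let $\zeta_0=(\beta_0,\theta_0)$ be the pair of initial functionals, satisfying $(\beta_0(P),\theta_0(P))=(\beta^*,\theta^* )$, and suppose that $\mathrm{IF}(\mathbf s_0;\zeta_0,P)$ exists. Let $\sigma(P)$ be a solution of the scale equation at $P$ and let $\xi(P)=(\beta_1(P),\gamma(P))\in\mathfrak D$ be a local minimum of $R_P(\beta,\mathbf V(\gamma))$ that satisfies $\beta_1(P)=\beta^*$ and $\mathbf V(\gamma(P))=\Sigma/|\Sigma|^{1/k}$. Let $\sigma(P_{h,\mathbf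 s_0})$ be a solution of the scale equation at $P_{h,\mathbf s_0}$ and $\xi(P_{h,\mathbf s_0})=(\beta_1(P_{h,\mathbf s_0}),\gamma(P_{h,\mathbf s_0}))\in\mathfrak D$ a local minimum of $R_{P_{h,\mathbf s_0}}(\beta,\mathbf V(\gamma))$, and suppose $(\xi(P_{h,\mathbf s_0}),\sigma(P_{h,\mathbf s_0}))\to(\xi(P),\sigma(P))$ as $h\downarrow0$ and that $\mathrm{IF}(\mathbf s_0;\sigma,P)$ exists. Put $c_\sigma=|\Sigma|^{1/(2k)}/\sigma(P)$, $\mathbf z_0=\Sigma^{-1/2}(\mathbf y_0-\mathbf X_0\beta^* )$, $u_1(s)=\rho_1'(s)/s$, $v_1(s)=\rho_1'(s)s$, $$\alpha_1=\mathbb E_{\mathbf 0,\mathbf I_k}\left[\left(1-\frac1k\right)\frac{\rho_1'(c_\sigma\|\mathbf z\|)}{c_\sigma\|\mathbf z\|}+\frac1k\rho_1''(c_\sigma\|\mathbf z\|)\right],$$ $$\gamma_1=\frac{\mathbb E_{\mathbf 0,\mathbf I_k}\left[\rho_1''(c_\sigma\|\mathbf z\|)(c_\sigma\|\mathbf z\|)^2+(k+1)\rho_1'(c_\sigma\|\mathbf z\|)c_\sigma\|\mathbf z\|\right]}{k+2}.$$ Suppose $\alpha_1\ne0$, $\gamma_1>0$, that $\mathbf X$ has full rank with probability one (so that $\mathbb E[\mathbf X^T\Sigma^{-1}\mathbf X]$ is non-singular), and that $\mathbb E_{\mathbf 0,\mathbf I_k}[\rho_0'(c_\sigma\|\mathbf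 z\|)c_\sigma\|\mathbf z\|]>0$. Let $\theta_1(P)$ and $\theta_1(P_{h,\mathbf s_0})$ be solutions of $\mathbf V(\theta)=\sigma^2(Q)\mathbf V(\gamma(Q))$ with $Q=P$ and $Q=P_{h,\mathbf s_0}$, respectively. Then $$\mathrm{IF}(\mathbf s_0;\theta_1,P)=\frac{k\,u_1(c_\sigma\|\mathbf z_0\|)}{\gamma_1}\left(\mathbf L^T(\Sigma^{-1}\otimes\Sigma^{-1})\mathbf L\right)^{-1}\mathbf L^T(\Sigma^{-1/2}\otimes\Sigma^{-1/2})\mathrm{vec}(\mathbf z_0\mathbf z_0^T)-\frac1{c_\sigma^2}\left(\frac{v_1(c_\sigma\|\mathbf z_0\|)}{\gamma_1}-\frac{2(\rho_0(c_\sigma\|\mathbf z_0\|)-b_0)}{\mathbb E_{\mathbf 0,\mathbf I_k}[\rho_0'(c_\sigma\|\mathbf z\|)c_\sigma\|\mathbf z\|]}\right)\theta^* .$$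
   Context: Fix positive integers $k,q,l$. A point $\mathbf s=(\mathbf y,\mathbf X)$, with $\mathbf y\in\mathbb R^k$ and $\mathbf X\in\mathbb R^{k\times q}$, is identified with a point of $\mathbb R^k\times\mathbb R^{kq}$; $P$ is a probability measure on this space and $\mathbb E$ is expectation under $P$. $\mathrm{PDS}(k)$ is the set of positive definite symmetric $k\times k$ matrices; $|\mathbf A|$ is the determinant; $\mathrm{vec}$ stacks the columns of a matrix; $\otimes$ is the Kronecker product. $\Theta\subset\mathbb R^l$ and $\mathbf V:\Theta\to\mathrm{PDS}(k)$ is a known injective (identifiable) map; in the linear structure $\mathbf L_1,\dots,\mathbf L_l$ are known symmetric $k\times k$ matrices. Put $\Gamma(\theta)=\mathbf V(\theta)/|\mathbf V(\theta)|^{1/k}$ and $\mathfrak D=\{(\beta,\gamma)\in\mathbb R^q\times\Theta:\mathbf V(\gamma)\in\mathrm{PDS}(k),\ |\mathbf V(\gamma)|=1\}$. $\rho_0,\rho_1:\mathbb R\to[0,\infty)$ are the loss functions and $0<b_0<\sup\rho_0$. Initial functionals $Q\mapsto(\beta_0(Q),\theta_0(Q))\in\mathbb R^q\times\Theta$ are given. The scale equation at $Q$, to be solved for $\sigma=\sigma(Q)>0$, is $$\int\rho_0\left(\frac{\sqrt{(\mathbf y-\mathbf X\beta_0(Q))^T\Gamma(\theta_0(Q))^{-1}(\mathbf y-\mathbf X\beta_0(Q))}}{\sigma}\right)dQ(\mathbf s)=b_0,$$ and $R_Q(\beta,\mathbf C)=\int\rho_1\big(\sqrt{(\mathbf y-\mathbf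 X\beta)^T\mathbf C^{-1}(\mathbf y-\mathbf X\beta)}/\sigma(Q)\big)\,dQ(\mathbf s)$. Local minima of $R_Q(\beta,\mathbf V(\gamma))$ are local minima over $(\beta,\gamma)\in\mathfrak D$. The elliptically contoured density is $f_{\mu,\Sigma}(\mathbf y)=|\Sigma|^{-1/2}m\big((\mathbf y-\mu)^T\Sigma^{-1}(\mathbf y-\mu)\big)$ for a fixed $m:[0,\infty)\to[0,\infty)$; $\mathbb E_{\mathbf 0,\mathbf I_k}$ denotes expectation for $\mathbf z$ with density $f_{\mathbf 0,\mathbf I_k}$. For $0<h<1$, $P_{h,\mathbf s}=(1-h)P+h\delta_{\mathbf s}$ with $\delta_{\mathbf s}$ the Dirac measure. The influence function of a functional $T$ is $\mathrm{IF}(\mathbf s;T,P)=\lim_{h\downarrow0}\{T(P_{h,\mathbf s})-T(P)\}/h$; the claim includes existence of the limit.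
   Formalization: The formal theorem additionally assumes that γ(P) is an interior point of Θ (automatic if Θ is open); for arbitrary Θ the claim fails, e.g. Θ={tθ*: t>0} with l=2, where θ_1(P_h) is always a multiple of θ*. "X has full rank" is read as full column rank q. *)

theory Defs
  imports "HOL-Probability.Probability"
begin

definition pds :: "real^'k^'k \<Rightarrow> bool" where
  "pds A \<longleftrightarrow> transpose A = A \<and> (\<forall>x. x \<noteq> 0 \<longrightarrow> 0 < x \<bullet> (A *v x))"

text \<open>The positive definite square root of a positive definite matrix exists and is unique.\<close>

definition matrix_sqrt :: "real^'k^'k \<Rightarrow> real^'k^'k" where
  "matrix_sqrt A = (THE B. pds B \<and> B ** B = A)"

text \<open>Entries of a \<open>k\<^sup>2\<close>-vector are indexed by pairs (column, row), the first component being
  the block index; this makes \<open>vec_mat\<close> the column stacking operator and is compatible with the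
  block structure of \<open>kronecker\<close>.\<close>

definition vec_mat :: "real^'n^'m \<Rightarrow> real^('n \<times> 'm)" where
  "vec_mat A = (\<chi> p. A $ snd p $ fst p)"

definition kronecker :: "real^'n^'m \<Rightarrow> real^'b^'a \<Rightarrow> real^('n \<times> 'b)^('m \<times> 'a)" where
  "kronecker A B = (\<chi> p r. A $ fst p $ fst r * B $ snd p $ snd r)"

lemma kronecker_vec_mat:
  "kronecker B A *v vec_mat X = vec_mat (A ** X ** transpose B)"
proof -
  have *: "(\<Sum>p\<in>UNIV. f p) = (\<Sum>i\<in>UNIV. \<Sum>j\<in>UNIV. f (i, j))"
    for f :: "'x::finite \<times> 'y::finite \<Rightarrow> real"
    by (simp add: sum.cartesian_product UNIV_Times_UNIV[symmetric] del: UNIV_Times_UNIV)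
  show ?thesis
    by (simp add: kronecker_def vec_mat_def matrix_vector_mult_def matrix_matrix_mult_def
        transpose_def vec_eq_iff * sum_distrib_left sum_distrib_right mult_ac)
qed

definition outer :: "real^'m \<Rightarrow> real^'n \<Rightarrow> real^'n^'m" where
  "outer x y = (\<chi> i j. x $ i * y $ j)"

definition vec_columns :: "('l \<Rightarrow> real^'k^'k) \<Rightarrow> real^'l^('k \<times> 'k)" where
  "vec_columns Ls = (\<chi> p j. vec_mat (Ls j) $ p)"

definition shape :: "(real^'l \<Rightarrow> real^'k^'k) \<Rightarrow> real^'l \<Rightarrow> real^'k^'k" where
  "shape V \<theta> = (1 / det (V \<theta>) powr (1 / real CARD('k))) *\<^sub>R V \<theta>"

text \<open>Derivatives are taken within \<open>S\<close>, so values of \<open>f\<close> outside \<open>S\<close> are irrelevant.\<close>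

definition C2_on :: "('a::real_normed_vector \<Rightarrow> 'b::real_normed_vector) \<Rightarrow> 'a set \<Rightarrow> bool" where
  "C2_on f S \<longleftrightarrow>
    (\<exists>(f' :: 'a \<Rightarrow> 'a \<Rightarrow>\<^sub>L 'b) (f'' :: 'a \<Rightarrow> 'a \<Rightarrow>\<^sub>L ('a \<Rightarrow>\<^sub>L 'b)).
      (\<forall>x\<in>S. (f has_derivative blinfun_apply (f' x)) (at x within S)) \<and>
      (\<forall>x\<in>S. (f' has_derivative blinfun_apply (f'' x)) (at x within S)) \<and>
      continuous_on S f'')"

definition local_min_on :: "('a::topological_space \<Rightarrow> real) \<Rightarrow> 'a set \<Rightarrow> 'a \<Rightarrow> bool" where
  "local_min_on f D x \<longleftrightarrow> x \<in> D \<and> eventually (\<lambda>p. f x \<le> f p) (at x within D)"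

text \<open>The quotient \<open>\<rho>'(s) / s\<close> is extended to \<open>s = 0\<close> by its limit. If that limit does not exist,
  the function is not continuous at \<open>0\<close>.\<close>

definition u_fun :: "(real \<Rightarrow> real) \<Rightarrow> real \<Rightarrow> real" where
  "u_fun \<rho> s = (if s = 0 then Lim (at 0) (\<lambda>t. deriv \<rho> t / t) else deriv \<rho> s / s)"

definition v_fun :: "(real \<Rightarrow> real) \<Rightarrow> real \<Rightarrow> real" where
  "v_fun \<rho> s = deriv \<rho> s * s"

definition loss_function :: "(real \<Rightarrow> real) \<Rightarrow> bool" where
  "loss_function \<rho> \<longleftrightarrow>
    (\<forall>s. 0 \<le> \<rho> s) \<and>
    (\<exists>c>0. mono_on {0..c} \<rho> \<and> (\<forall>s\<ge>c. \<rho> s = \<rho> c)) \<and>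
    \<rho> C1_differentiable_on UNIV \<and>
    continuous_on UNIV (u_fun \<rho>)"

type_synonym ('k, 'q) obs = "(real^'k) \<times> (real^'q^'k)"

definition ell_density :: "(real \<Rightarrow> real) \<Rightarrow> real^'k \<Rightarrow> real^'k^'k \<Rightarrow> real^'k \<Rightarrow> real" where
  "ell_density m \<mu> S y = det S powr (- (1 / 2)) * m ((y - \<mu>) \<bullet> (matrix_inv S *v (y - \<mu>)))"

definition ell_measure :: "(real \<Rightarrow> real) \<Rightarrow> real^'k \<Rightarrow> real^'k^'k \<Rightarrow> (real^'k) measure" where
  "ell_measure m \<mu> S = density lborel (\<lambda>y. ennreal (ell_density m \<mu> S y))"

definition std_expectation :: "(real \<Rightarrow> real) \<Rightarrow> (real^'k \<Rightarrow> real) \<Rightarrow> real" where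
  "std_expectation m g = (LINT z|ell_measure m 0 (mat 1). g z)"

text \<open>\<open>cond_density P f\<close>: the conditional distribution of the first coordinate given that the
  second one equals \<open>X\<close> has Lebesgue density \<open>f X\<close>, i.e. these densities define a regular
  version of the conditional distribution.\<close>

definition cond_density :: "('a::euclidean_space \<times> 'b::euclidean_space) measure \<Rightarrow> ('b \<Rightarrow> 'a \<Rightarrow> real) \<Rightarrow> bool" where
  "cond_density P f \<longleftrightarrow>
    (\<forall>X. f X \<in> borel_measurable borel \<and> (\<forall>y. 0 \<le> f X y) \<and>
         prob_space (density lborel (\<lambda>y. ennreal (f X y)))) \<and>
    (\<forall>A\<in>sets borel. \<forall>B\<in>sets borel.
      emeasure P (A \<times> B) =
        (\<integral>\<^sup>+X\<in>B. emeasure (density lborel (\<lambda>y. ennreal (f X y))) A \<partial>(distr P borel snd)))"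

definition contaminate :: "'a measure \<Rightarrow> 'a \<Rightarrow> real \<Rightarrow> 'a measure" where
  "contaminate P s h = measure_of (space P) (sets P)
     (\<lambda>A. ennreal (1 - h) * emeasure P A + ennreal h * emeasure (return P s) A)"

lemma emeasure_contaminate:
  assumes "A \<in> sets P"
  shows "emeasure (contaminate P s h) A =
    ennreal (1 - h) * emeasure P A + ennreal h * emeasure (return P s) A"
proof (rule emeasure_measure_of[OF contaminate_def])
  show "countably_additive (sets (contaminate P s h))
     (\<lambda>A. ennreal (1 - h) * emeasure P A + ennreal h * emeasure (return P s) A)"
    unfolding countably_additive_def
  proof (intro allI impI)
    fix F :: "nat \<Rightarrow> 'a set"
    assume F: "range F \<subseteq> sets (contaminate P s h)" "disjoint_family F"
    then have F': "range F \<subseteq> sets P" "range F \<subseteq> sets (return P s)"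
      by (auto simp: contaminate_def)
    show "(\<Sum>i. ennreal (1 - h) * emeasure P (F i) + ennreal h * emeasure (return P s) (F i)) =
      ennreal (1 - h) * emeasure P (\<Union>i. F i) + ennreal h * emeasure (return P s) (\<Union>i. F i)"
      by (simp add: suminf_emeasure[OF F'(1) F(2), symmetric] 
          suminf_emeasure[OF F'(2) F(2), symmetric] suminf_add[symmetric])
  qed
  show "positive (sets (contaminate P s h))
     (\<lambda>A. ennreal (1 - h) * emeasure P A + ennreal h * emeasure (return P s) A)"
    by (simp add: positive_def)
  show "sets P \<subseteq> Pow (space P)"
    by (rule sets.space_closed)
  show "A \<in> sets (contaminate P s h)"
    using assms by (simp add: contaminate_def)
qed

text \<open>Existence of the limit is part of this predicate.\<close>

definition has_influence ::
  "'s \<Rightarrow> ('s measure \<Rightarrow> 'v::real_normed_vector) \<Rightarrow> 's measure \<Rightarrow> 'v \<Rightarrow> bool" where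
  "has_influence s T P d \<longleftrightarrow>
    ((\<lambda>h. (T (contaminate P s h) - T P) /\<^sub>R h) \<longlongrightarrow> d) (at_right 0)"

definition mahal :: "real^'q \<Rightarrow> real^'k^'k \<Rightarrow> ('k, 'q) obs \<Rightarrow> real" where
  "mahal \<beta> C = (\<lambda>(y, X). sqrt ((y - X *v \<beta>) \<bullet> (matrix_inv C *v (y - X *v \<beta>))))"

definition solves_scale ::
  "(real \<Rightarrow> real) \<Rightarrow> real \<Rightarrow> (real^'l \<Rightarrow> real^'k^'k) \<Rightarrow> ('k, 'q) obs measure \<Rightarrow>
   real^'q \<Rightarrow> real^'l \<Rightarrow> real \<Rightarrow> bool" where
  "solves_scale \<rho>0 b0 V Q \<beta>0 \<theta>0 \<sigma> \<longleftrightarrow>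
    0 < \<sigma> \<and> (LINT s|Q. \<rho>0 (mahal \<beta>0 (shape V \<theta>0) s / \<sigma>)) = b0"

definition objective ::
  "(real \<Rightarrow> real) \<Rightarrow> ('k, 'q) obs measure \<Rightarrow> real \<Rightarrow> real^'q \<Rightarrow> real^'k^'k \<Rightarrow> real" where
  "objective \<rho>1 Q \<sigma> \<beta> C = (LINT s|Q. \<rho>1 (mahal \<beta> C s / \<sigma>))"

definition feasible ::
  "(real^'l \<Rightarrow> real^'k^'k) \<Rightarrow> (real^'l) set \<Rightarrow> ((real^'q) \<times> (real^'l)) set" where
  "feasible V \<Theta> = {(\<beta>, \<gamma>). \<gamma> \<in> \<Theta> \<and> pds (V \<gamma>) \<and> det (V \<gamma>) = 1}"

end

theory Submission
  imports Defs
begin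

text \<open>Write \<open>C = V \<gamma>\<close> for the shape matrix. Because \<open>V\<close> is linear with a full-rank \<open>L\<close>, the equation
\<open>V \<theta>\<^sub>1 = \<sigma>\<^sup>2 V \<gamma>\<close> says \<open>\<theta>\<^sub>1 = \<sigma>\<^sup>2 \<gamma>\<close>. Hence along the path \<open>h \<mapsto> (1 - h) P + h \<delta>\<^sub>s\<close> the right derivative of
\<open>\<theta>\<^sub>1\<close> at \<open>0\<close> is \<open>\<sigma>\<^sup>2 \<gamma>' + 2 \<sigma> \<sigma>' \<gamma>\<close>, and the theorem reduces to computing \<open>\<sigma>'\<close> and to showing that
\<open>\<gamma>'\<close> exists and has the right value.

Both computations use the parameter \<open>(\<beta>, A)\<close> with \<open>A = C\<^sup>-\<^sup>1 / \<sigma>\<^sup>2\<close>. With the residual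
\<open>r = y - X \<beta>\<close> every loss then depends on the quadratic form \<open>r \<bullet> A r\<close> alone. A loss function
is constant beyond its cutoff, so the derivatives of the integrands are dominated by multiples of
\<open>(1 + \<parallel>X\<parallel>)\<^sup>2\<close>, and the functionals are differentiable under the integral sign
(\<open>has_derivative_integral\<close>, \<open>wres_has_derivative\<close>).

At the model the derivatives are explicit. The positive square root \<open>T\<close> of \<open>S\<close> (\<open>matrix_sqrt\<close>)
turns the elliptical law into a spherical one: \<open>P\<close> is the image of a product \<open>\<nu> \<Otimes> P\<^sub>X\<close> under
\<open>(z, X) \<mapsto> (X \<beta> + T z, X)\<close> (\<open>elliptical_representation\<close>), where \<open>\<nu>\<close> is rotation invariant. Odd
terms in \<open>z\<close> integrate to zero, and the even ones are second and fourth moments, which rotation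
invariance determines up to one constant each (\<open>radial_second_moment\<close>, \<open>radial_fourth_moment\<close>).

For \<open>\<sigma>'\<close> the scale equation is differentiated along the path. The derivative in \<open>\<beta>\<close> vanishes
because its integrand is odd, the derivative in the initial shape vanishes because a normalised inverse moves only
in directions \<open>N\<close> with \<open>trace (S N) = 0\<close>, and what is left is a linear equation for \<open>\<sigma>'\<close>
(\<open>scale_influence_path\<close>).

For \<open>\<gamma>'\<close> only convergence of the local minima is known, not differentiability. A local minimum
satisfies stationarity conditions: in \<open>\<beta>\<close> along straight lines, in \<open>\<gamma>\<close> along the curves
\<open>t \<mapsto> (\<gamma> + t g) / |V (\<gamma> + t g)|\<^sup>1\<^sup>/\<^sup>k\<close>, which stay in the set of determinant one
(\<open>contaminated_stationarity\<close>). Together with the constraint \<open>|V \<gamma>| = 1\<close> these conditions have the form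
\<open>(1 - h) \<Psi> (x\<^sub>h, \<sigma>\<^sub>h) + h \<psi>\<^sub>h = 0\<close> with \<open>x = (\<beta>, \<gamma>)\<close>. The map \<open>\<Psi>\<close> is differentiable at the model point
(\<open>score_has_derivative\<close>), and its derivative is injective in \<open>x\<close>: the regression part because
\<open>X\<close> has full rank almost surely and \<open>\<alpha>\<^sub>1 \<noteq> 0\<close>, the shape part because \<open>\<gamma>\<^sub>1 > 0\<close> and \<open>L\<close> has full rank
(\<open>dscore_injective\<close>). Under these circumstances a convergent solution path is differentiable, and its derivative is the
unique solution of the linearised equation (\<open>z_estimator_path\<close>). Solving that equation means
inverting \<open>L\<^sup>T (S\<^sup>-\<^sup>1 \<otimes> S\<^sup>-\<^sup>1) L\<close>, the matrix of the form \<open>(g, h) \<mapsto> trace (S\<^sup>-\<^sup>1 V(g) S\<^sup>-\<^sup>1 V(h))\<close>.\<close>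

section \<open>Matrices and the positive definite square root\<close>

lemma matrix_inner_eq_trace:
  fixes A B :: "real^'n^'m"
  shows "A \<bullet> B = trace (transpose A ** B)"
  unfolding inner_vec_def trace_def transpose_def matrix_matrix_mult_def
  by (simp add: sum.swap[of _ "UNIV::'n set"])

lemma inner_outer: "(G::real^'n^'m) \<bullet> outer x y = x \<bullet> (G *v y)"
  by (simp add: inner_vec_def outer_def matrix_vector_mult_def sum_distrib_left mult_ac)

lemma bounded_bilinear_outer: "bounded_bilinear (outer :: real^'m \<Rightarrow> real^'n \<Rightarrow> real^'n^'m)"
proof
  show "\<exists>K. \<forall>a b. norm (outer a b :: real^'n^'m) \<le> norm (a::real^'m) * norm (b::real^'n) * K"
  proof (intro exI allI)
    fix a :: "real^'m" and b :: "real^'n"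
    have "norm (outer a b)^2 = (norm a * norm b)^2"
      unfolding power2_norm_eq_inner power_mult_distrib
      by (simp add: inner_vec_def outer_def sum_product mult_ac)
    then show "norm (outer a b :: real^'n^'m) \<le> norm a * norm b * 1"
      using power2_eq_imp_eq[of "norm (outer a b)" "norm a * norm b"] by simp
  qed
qed (simp_all add: outer_def vec_eq_iff algebra_simps)

lemma norm_outer: "norm (outer a b :: real^'n^'m) = norm a * norm b"
proof -
  have "norm (outer a b :: real^'n^'m)^2 = (norm a * norm b)^2"
    unfolding power2_norm_eq_inner power_mult_distrib
    by (simp add: inner_vec_def outer_def sum_product mult_ac)
  then show ?thesis
    using power2_eq_imp_eq[of "norm (outer a b :: real^'n^'m)" "norm a * norm b"] by simp
qed

lemma norm_matrix_vector_le:
  fixes A :: "real^'n^'m"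
  shows "norm (A *v x) \<le> norm A * norm x"
proof -
  have "norm (A *v x)^2 = (\<Sum>i\<in>UNIV. (A$i \<bullet> x)^2)"
    unfolding power2_norm_eq_inner by (simp add: inner_vec_def matrix_vector_mult_def power2_eq_square)
  also have "\<dots> \<le> (\<Sum>i\<in>UNIV. (norm (A$i) * norm x)^2)"
    by (intro sum_mono) (metis Cauchy_Schwarz_ineq2 abs_ge_zero power2_abs power_mono)
  also have "\<dots> = (norm A * norm x)^2"
    unfolding power_mult_distrib power2_norm_eq_inner[of A]
    by (simp add: inner_vec_def[of A] sum_distrib_right power2_norm_eq_inner)
  finally show ?thesis
    by (rule power2_le_imp_le) simp
qed

lemma norm_transpose: "norm (transpose A) = norm (A::real^'n^'m)"
proof -
  have "norm (transpose A)^2 = norm A ^2"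
    unfolding power2_norm_eq_inner inner_vec_def transpose_def
    by (simp add: sum.swap[of _ "UNIV::'n set"])
  then show ?thesis by simp
qed

lemma norm_vector_matrix_le: "norm (x v* A) \<le> norm (A::real^'n^'m) * norm x"
  using norm_matrix_vector_le[of "transpose A" x] by (simp add: norm_transpose)

lemma bounded_bilinear_matrix_vector:
  "bounded_bilinear ((*v) :: real^'n^'m \<Rightarrow> real^'n \<Rightarrow> real^'m)"
proof
  show "\<exists>K. \<forall>a b. norm ((a::real^'n^'m) *v b) \<le> norm a * norm b * K"
    using norm_matrix_vector_le by (metis mult.right_neutral)
qed (simp_all add: matrix_vector_right_distrib matrix_vector_mult_add_rdistrib
    scaleR_matrix_vector_assoc matrix_vector_mult_scaleR)

lemma bounded_bilinear_matrix_mult: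
  "bounded_bilinear ((**) :: real^'n^'m \<Rightarrow> real^'p^'n \<Rightarrow> real^'p^'m)"
proof (rule bilinear_conv_bounded_bilinear[THEN iffD1])
  show "bilinear ((**) :: real^'n^'m \<Rightarrow> real^'p^'n \<Rightarrow> real^'p^'m)"
    unfolding bilinear_def
    by (auto intro!: linearI simp: matrix_matrix_mult_def vec_eq_iff sum.distrib algebra_simps sum_distrib_left)
qed

lemma linear_trace: "linear (trace :: real^'n^'n \<Rightarrow> real)"
  by (rule linearI) (simp_all add: trace_def sum.distrib sum_distrib_left)

lemma bounded_linear_trace: "bounded_linear (trace :: real^'n^'n \<Rightarrow> real)"
  using linear_trace by (rule linear_conv_bounded_linear[THEN iffD1])

lemma pds_inner_sym: "pds A \<Longrightarrow> x \<bullet> (A *v y) = (A *v x) \<bullet> y"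
  unfolding pds_def by (metis dot_lmul_matrix transpose_matrix_vector)

lemma invertible_if_pos:
  fixes A :: "real^'n^'n"
  assumes "\<And>x. x \<noteq> 0 \<Longrightarrow> 0 < x \<bullet> (A *v x)"
  shows "invertible A"
proof -
  have "A *v x = 0 \<Longrightarrow> x = 0" for x
    using assms[of x] by fastforce
  then show ?thesis
    by (metis invertible_left_inverse matrix_left_invertible_ker)
qed

lemma pds_invertible: "pds A \<Longrightarrow> invertible A"
  by (rule invertible_if_pos) (simp add: pds_def)

lemma matrix_inv_mult:
  assumes "invertible (A::real^'n^'n)"
  shows "A ** matrix_inv A = mat 1" "matrix_inv A ** A = mat 1"
proof -
  have "A ** matrix_inv A = mat 1 \<and> matrix_inv A ** A = mat 1"
    unfolding matrix_inv_def by (rule someI_ex) (use assms in \<open>simp add: invertible_def\<close>)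
  then show "A ** matrix_inv A = mat 1" "matrix_inv A ** A = mat 1" by auto
qed

lemma matrix_inv_unique: 
  fixes A B :: "real^'n^'n"
  assumes "A ** B = mat 1" 
  shows "matrix_inv A = B"
proof -
  have "invertible A" using assms invertible_right_inverse by blast
  then have "matrix_inv A = matrix_inv A ** (A ** B)" using assms by simp
  then show ?thesis using \<open>invertible A\<close> by (simp add: matrix_mul_assoc matrix_inv_mult)
qed

lemma matrix_inv_scaleR:
  fixes A :: "real^'n^'n"
  assumes "invertible A" "r \<noteq> 0"
  shows "matrix_inv (r *\<^sub>R A) = (1 / r) *\<^sub>R matrix_inv A"
  using assms by (intro matrix_inv_unique) (simp add: matrix_scalar_ac matrix_inv_mult flip: scalar_matrix_assoc)

lemma matrix_inv_matrix_mult: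
  fixes A B :: "real^'n^'n"
  assumes "invertible A" "invertible B"
  shows "matrix_inv (A ** B) = matrix_inv B ** matrix_inv A"
proof (rule matrix_inv_unique)
  have "(A ** B) ** (matrix_inv B ** matrix_inv A) = A ** (B ** matrix_inv B) ** matrix_inv A"
    by (simp only: matrix_mul_assoc)
  then show "(A ** B) ** (matrix_inv B ** matrix_inv A) = mat 1"
    using assms by (simp add: matrix_inv_mult)
qed

lemma transpose_matrix_inv:
  fixes A :: "real^'n^'n"
  assumes "invertible A"
  shows "transpose (matrix_inv A) = matrix_inv (transpose A)"
  using assms by (intro matrix_inv_unique[symmetric]) (simp add: matrix_inv_mult flip: matrix_transpose_mul)

lemma pds_matrix_inv:
  fixes A :: "real^'n^'n"
  assumes "pds A"
  shows "pds (matrix_inv A)"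
proof -
  have inv: "invertible A" using assms by (rule pds_invertible)
  show ?thesis
    unfolding pds_def
  proof (intro conjI allI impI)
    show "transpose (matrix_inv A) = matrix_inv A"
      using assms inv by (simp add: transpose_matrix_inv pds_def)
    fix x :: "real^'n" assume "x \<noteq> 0"
    define y where "y = matrix_inv A *v x"
    have x: "x = A *v y" using inv by (simp add: y_def matrix_vector_mul_assoc matrix_inv_mult)
    then have "y \<noteq> 0" using \<open>x \<noteq> 0\<close> by auto
    then have "0 < y \<bullet> (A *v y)" using assms by (simp add: pds_def)
    then show "0 < x \<bullet> (matrix_inv A *v x)"
      by (metis x y_def inner_commute)
  qed
qed

text \<open>The quadratic form attains its minimum on the unit sphere; that minimum is the constant.\<close>

lemma pds_coercive:
  fixes A :: "real^'n^'n"
  assumes "pds A"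
  obtains l where "0 < l" "\<And>x. l * (norm x)^2 \<le> x \<bullet> (A *v x)"
proof -
  have "continuous_on (sphere 0 1) (\<lambda>x::real^'n. x \<bullet> (A *v x))"
    by (intro continuous_intros linear_continuous_on_compose[of _ id, simplified] matrix_vector_mul_bounded_linear bounded_linear.continuous_on[OF matrix_vector_mul_bounded_linear])
  then obtain z where z: "z \<in> sphere 0 1" "\<And>x. x \<in> sphere 0 1 \<Longrightarrow> z \<bullet> (A *v z) \<le> x \<bullet> (A *v x)"
    using continuous_attains_inf[of "sphere 0 (1::real)" "\<lambda>x::real^'n. x \<bullet> (A *v x)"]
    by (metis compact_sphere sphere_eq_empty linorder_not_less zero_le_one)
  show ?thesis
  proof
    have "z \<noteq> 0" using z(1) by auto
    then show "0 < z \<bullet> (A *v z)" using assms by (simp add: pds_def)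
    fix x :: "real^'n"
    show "z \<bullet> (A *v z) * (norm x)^2 \<le> x \<bullet> (A *v x)"
    proof (cases "x = 0")
      case False
      define y where "y = x /\<^sub>R norm x"
      have "x = norm x *\<^sub>R y" "y \<in> sphere 0 1" using False by (auto simp: y_def)
      then show ?thesis using mult_right_mono[OF z(2)[of y], of "(norm x)^2"]
        by (metis (no_types, lifting) inner_scaleR_left inner_scaleR_right matrix_vector_mult_scaleR mult.assoc
            mult.commute power2_eq_square zero_le_power2)
    qed simp
  qed
qed

text \<open>For large \<open>t\<close> the symmetric operator \<open>E = I - A / t\<close> has norm below one. A square root of
\<open>I - E\<close> of the form \<open>I - Y\<close> is the same as a fixed point of \<open>Y \<mapsto> (E + Y\<^sup>2) / 2\<close>, and this map is a
contraction of the symmetric operators of norm at most \<open>1 - sqrt (1 - \<parallel>E\<parallel>)\<close>. Positivity of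
\<open>I - Y\<close> follows from \<open>\<parallel>Y\<parallel> < 1\<close>.\<close>

lemma pds_sqrt_exists:
  fixes A :: "real^'n^'n"
  assumes "pds A"
  shows "\<exists>B. pds B \<and> B ** B = A"
proof -
  obtain l where l: "0 < l" "\<And>x. l * (norm x)^2 \<le> x \<bullet> (A *v x)"
    using pds_coercive[OF assms] by blast
  define N where "N = norm A + l"
  have N: "0 < N" "l \<le> N" "\<And>x. norm (A *v x) \<le> N * norm x"
    using l(1) norm_matrix_vector_le[of A]
    by (auto simp: N_def add_nonneg_pos distrib_right intro: add_increasing2)
  \<comment> \<open>The bound \<open>\<parallel>E x\<parallel>\<^sup>2 \<le> (1 - 2 l / t + N\<^sup>2 / t\<^sup>2) \<parallel>x\<parallel>\<^sup>2\<close> is smallest for this \<open>t\<close>, with value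
    \<open>1 - (l / N)\<^sup>2\<close>.\<close>
  define t where "t = N^2 / l"
  have t: "t > 0" using N l by (simp add: t_def)
  define e where "e = sqrt (1 - (l/N)^2)"
  have ln: "0 < l / N" "l / N \<le> 1" using N l by auto
  then have "(l/N)^2 \<le> 1" by (simp add: power_le_one)
  then have e0: "0 \<le> e" and e2: "e^2 = 1 - (l/N)^2" by (auto simp: e_def)
  have e1: "e < 1" using zero_less_power[OF ln(1), of 2] unfolding e_def by simp
  define E :: "(real^'n) \<Rightarrow>\<^sub>L (real^'n)" where "E = Blinfun (\<lambda>x. x - A *v x /\<^sub>R t)"
  have bl: "bounded_linear (\<lambda>x. x - A *v x /\<^sub>R t)"
    by (intro bounded_linear_intros matrix_vector_mul_bounded_linear)
  have E: "blinfun_apply E x = x - A *v x /\<^sub>R t" for x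
    unfolding E_def by (simp add: bounded_linear_Blinfun_apply[OF bl])
  have normE: "norm E \<le> e"
  proof (rule norm_blinfun_bound[OF e0])
    fix x :: "real^'n"
    have "(norm (blinfun_apply E x))^2 = (norm x)^2 - 2 * (x \<bullet> (A *v x)) / t + (norm (A *v x))^2 / t^2"
      unfolding E power2_norm_eq_inner
      by (simp add: inner_diff_left inner_diff_right inner_commute power2_eq_square divide_inverse)
    also have "\<dots> \<le> (norm x)^2 - 2 * (l * (norm x)^2) / t + (N * norm x)^2 / t^2"
      using l(2)[of x] N t by (intro add_mono diff_mono divide_right_mono power_mono) auto
    also have "\<dots> = (e * norm x)^2"
      using N l unfolding power_mult_distrib e2 t_def by (simp add: field_simps power2_eq_square)
    finally show "norm (blinfun_apply E x) \<le> e * norm x"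
      by (rule power2_le_imp_le) (simp add: e0)
  qed
  \<comment> \<open>the smaller root of \<open>(e + r\<^sup>2) / 2 = r\<close>, so that the ball of radius \<open>r\<close> is mapped into itself\<close>
  define r where "r = 1 - sqrt (1 - e)"
  have r: "0 \<le> r" "r < 1" "(e + r^2) / 2 = r"
    using e0 e1 by (auto simp: r_def power2_diff)
  define S where "S = {Y :: (real^'n) \<Rightarrow>\<^sub>L (real^'n). norm Y \<le> r \<and> (\<forall>x y. blinfun_apply Y x \<bullet> y = x \<bullet> blinfun_apply Y y)}"
  define F :: "((real^'n) \<Rightarrow>\<^sub>L (real^'n)) \<Rightarrow> ((real^'n) \<Rightarrow>\<^sub>L (real^'n))" where "F = (\<lambda>Y. (1/2) *\<^sub>R (E + (Y o\<^sub>L Y)))"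
  have closedS: "closed S"
    unfolding S_def Collect_conj_eq Collect_all_eq
    by (intro closed_Int closed_INT ballI closed_Collect_le closed_Collect_eq continuous_intros)
  have "\<exists>!Y. Y \<in> S \<and> F Y = Y"
  proof (rule Banach_fix[OF complete_eq_closed[THEN iffD2, OF closedS]])
    show "S \<noteq> {}" using r by (auto simp: S_def intro!: exI[of _ 0])
    show "0 \<le> r" "r < 1" by fact+
    show "F ` S \<subseteq> S"
    proof (clarsimp simp: S_def)
      fix Y :: "(real^'n) \<Rightarrow>\<^sub>L (real^'n)"
      assume Y: "norm Y \<le> r" "\<forall>x y. blinfun_apply Y x \<bullet> y = x \<bullet> blinfun_apply Y y"
      have "norm (F Y) = (1/2) * norm (E + (Y o\<^sub>L Y))" by (simp add: F_def)
      also have "norm (E + (Y o\<^sub>L Y)) \<le> e + r * r"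
        using norm_blinfun_compose[of Y Y] mult_mono[OF Y(1) Y(1)] r(1) normE
        by (intro norm_triangle_le) force
      finally have "norm (F Y) \<le> r" using r(3) by (simp add: power2_eq_square)
      moreover have "blinfun_apply (F Y) x \<bullet> y = x \<bullet> blinfun_apply (F Y) y" for x y
      proof -
        have "blinfun_apply Y (blinfun_apply Y x) \<bullet> y = x \<bullet> blinfun_apply Y (blinfun_apply Y y)"
          using Y(2) by metis
        then show ?thesis
          using pds_inner_sym[OF assms, of x y]
          by (simp add: F_def blinfun.add_left blinfun.scaleR_left E inner_diff_left inner_diff_right
              inner_add_left inner_add_right)
      qed
      ultimately show "norm (F Y) \<le> r \<and> (\<forall>x y. blinfun_apply (F Y) x \<bullet> y = x \<bullet> blinfun_apply (F Y) y)"
        by blast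
    qed
    fix Y Z assume YZ: "Y \<in> S" "Z \<in> S"
    have "F Y - F Z = (1/2) *\<^sub>R ((Y o\<^sub>L (Y - Z)) + ((Y - Z) o\<^sub>L Z))"
      by (simp add: F_def algebra_simps bounded_bilinear.diff_left[OF bounded_bilinear_blinfun_compose]
          bounded_bilinear.diff_right[OF bounded_bilinear_blinfun_compose])
    then have "norm (F Y - F Z) = (1/2) * norm ((Y o\<^sub>L (Y - Z)) + ((Y - Z) o\<^sub>L Z))" by simp
    also have "norm ((Y o\<^sub>L (Y - Z)) + ((Y - Z) o\<^sub>L Z)) \<le> r * norm (Y - Z) + norm (Y - Z) * r"
    proof (rule norm_triangle_le, rule add_mono)
      show "norm (Y o\<^sub>L (Y - Z)) \<le> r * norm (Y - Z)"
        using YZ by (intro order_trans[OF norm_blinfun_compose] mult_right_mono) (auto simp: S_def)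
      show "norm ((Y - Z) o\<^sub>L Z) \<le> norm (Y - Z) * r"
        using YZ by (intro order_trans[OF norm_blinfun_compose] mult_left_mono) (auto simp: S_def)
    qed
    finally show "dist (F Y) (F Z) \<le> r * dist Y Z" by (simp add: dist_norm)
  qed
  then obtain Y where Y: "norm Y \<le> r" "\<And>x y. blinfun_apply Y x \<bullet> y = x \<bullet> blinfun_apply Y y" "F Y = Y"
    by (auto simp: S_def)
  define B where "B = matrix (\<lambda>x. sqrt t *\<^sub>R (x - blinfun_apply Y x))"
  have lin: "linear (\<lambda>x. sqrt t *\<^sub>R (x - blinfun_apply Y x))"
    by (rule bounded_linear.linear) (intro bounded_linear_intros)
  have B: "B *v x = sqrt t *\<^sub>R (x - blinfun_apply Y x)" for x
    unfolding B_def by (rule matrix_works[OF lin[folded linear_matrix_vector_mul_eq]])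
  have "B ** B = A"
  proof (rule matrix_eq[THEN iffD2, rule_format])
    fix x
    have "2 *\<^sub>R blinfun_apply Y x = blinfun_apply E x + blinfun_apply Y (blinfun_apply Y x)"
      using arg_cong[OF Y(3), of "\<lambda>Z. 2 *\<^sub>R blinfun_apply Z x"]
      by (simp add: F_def blinfun.add_left blinfun.scaleR_left)
    then have "x - 2 *\<^sub>R blinfun_apply Y x + blinfun_apply Y (blinfun_apply Y x) = A *v x /\<^sub>R t"
      by (simp add: E)
    moreover have "(B ** B) *v x = t *\<^sub>R (x - 2 *\<^sub>R blinfun_apply Y x + blinfun_apply Y (blinfun_apply Y x))"
      using t by (simp add: B flip: matrix_vector_mul_assoc)
        (simp add: blinfun.diff_right blinfun.scaleR_right algebra_simps scaleR_2)
    ultimately show "(B ** B) *v x = A *v x" using t by simp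
  qed
  moreover have "pds B"
    unfolding pds_def
  proof (intro conjI allI impI)
    have *: "x \<bullet> (B *v y) = (B *v x) \<bullet> y" for x y
      using Y(2)[of x y] by (simp add: B inner_diff_left inner_diff_right)
    show "transpose B = B"
    proof (rule matrix_eq[THEN iffD2, rule_format])
      fix x show "transpose B *v x = B *v x"
        by (rule vector_eq_rdot[THEN iffD1]) (use * in \<open>metis dot_lmul_matrix transpose_matrix_vector inner_commute\<close>)
    qed
    fix x :: "real^'n" assume x: "x \<noteq> 0"
    have "x \<bullet> blinfun_apply Y x \<le> norm x * (norm Y * norm x)"
      by (intro order_trans[OF norm_cauchy_schwarz] mult_left_mono norm_blinfun) simp
    also have "\<dots> \<le> norm x * (r * norm x)"
      using Y(1) by (intro mult_left_mono mult_right_mono) auto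
    also have "\<dots> < x \<bullet> x"
      using mult_strict_right_mono[OF r(2), of "norm x * norm x"] x
      by (simp add: power2_norm_eq_inner[symmetric] power2_eq_square mult_ac)
    finally show "0 < x \<bullet> (B *v x)"
      using t by (simp add: B inner_diff_right)
  qed
  ultimately show ?thesis by blast
qed

text \<open>The trace is the sum of the values of the quadratic form of \<open>B\<close> at the columns of \<open>D\<close>.\<close>

lemma trace_congruence_pos:
  fixes B D :: "real^'n^'n"
  assumes "pds B"
  shows "0 \<le> trace (transpose D ** B ** D)" "trace (transpose D ** B ** D) = 0 \<Longrightarrow> D = 0"
proof -
  have eq: "trace (transpose D ** B ** D) = (\<Sum>i\<in>UNIV. column i D \<bullet> (B *v column i D))"
  proof -
    have "trace (transpose D ** B ** D) = (\<Sum>i\<in>UNIV. \<Sum>j\<in>UNIV. D$j$i * (\<Sum>k\<in>UNIV. B$j$k * D$k$i))"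
      unfolding matrix_mul_assoc[symmetric] by (simp add: trace_def matrix_matrix_mult_def transpose_def)
    then show ?thesis
      by (simp add: inner_vec_def column_def matrix_vector_mult_def)
  qed
  have nn: "0 \<le> x \<bullet> (B *v x)" for x
    using assms by (cases "x = 0") (auto simp: pds_def less_imp_le)
  show "0 \<le> trace (transpose D ** B ** D)" unfolding eq by (intro sum_nonneg nn)
  assume "trace (transpose D ** B ** D) = 0"
  then have "\<And>i. column i D \<bullet> (B *v column i D) = 0"
    unfolding eq using nn by (subst (asm) sum_nonneg_eq_0_iff) auto
  then have "\<And>i. column i D = 0" using assms unfolding pds_def by (metis less_irrefl)
  then show "D = 0" by (auto simp: vec_eq_iff column_def)
qed

text \<open>The difference \<open>D\<close> of two roots satisfies \<open>D B + C D = 0\<close>. Multiplying by \<open>D\<close> and taking traces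
gives a sum of two nonnegative terms that vanishes.\<close>

lemma pds_sqrt_unique:
  fixes B C :: "real^'n^'n"
  assumes "pds B" "pds C" "B ** B = C ** C"
  shows "B = C"
proof -
  define D where "D = B - C"
  have tD: "transpose D = D"
    using assms by (simp add: D_def pds_def transpose_def vec_eq_iff)
  have "D ** B + C ** D = 0"
    using assms(3) by (simp add: D_def bounded_bilinear.diff_left[OF bounded_bilinear_matrix_mult]
        bounded_bilinear.diff_right[OF bounded_bilinear_matrix_mult])
  then have "D ** (D ** B) + D ** (C ** D) = 0"
    using bounded_bilinear.add_right[OF bounded_bilinear_matrix_mult, of D "D ** B" "C ** D"]
      bounded_bilinear.zero_right[OF bounded_bilinear_matrix_mult, of D] by simp
  then have "trace (D ** (D ** B)) + trace (D ** (C ** D)) = 0"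
    using linear_add[OF linear_trace, of "D ** (D ** B)" "D ** (C ** D)"] linear_0[OF linear_trace] by metis
  moreover have "trace (D ** (D ** B)) = trace (transpose D ** B ** D)"
    unfolding tD by (metis trace_mul_sym matrix_mul_assoc)
  moreover have "trace (D ** (C ** D)) = trace (transpose D ** C ** D)"
    unfolding tD by (simp add: matrix_mul_assoc)
  ultimately have "trace (transpose D ** B ** D) = 0"
    using trace_congruence_pos(1)[OF assms(1), of D] trace_congruence_pos(1)[OF assms(2), of D] by linarith
  then have "D = 0" using trace_congruence_pos(2)[OF assms(1)] by blast
  then show ?thesis by (simp add: D_def)
qed

lemma matrix_sqrt:
  assumes "pds A"
  shows "pds (matrix_sqrt A)" "matrix_sqrt A ** matrix_sqrt A = A"
proof -
  have "\<exists>!B. pds B \<and> B ** B = A"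
    using pds_sqrt_exists[OF assms] pds_sqrt_unique by metis
  then have "pds (matrix_sqrt A) \<and> matrix_sqrt A ** matrix_sqrt A = A"
    unfolding matrix_sqrt_def by (rule theI')
  then show "pds (matrix_sqrt A)" "matrix_sqrt A ** matrix_sqrt A = A" by auto
qed

lemma pds_det_pos:
  assumes "pds A"
  shows "0 < det A"
proof -
  have "det A = (det (matrix_sqrt A))^2"
    by (metis matrix_sqrt(2)[OF assms] det_mul power2_eq_square)
  moreover have "det A \<noteq> 0" using pds_invertible[OF assms] invertible_det_nz by blast
  ultimately show ?thesis by auto
qed

section \<open>Lebesgue measure under linear maps and elliptical densities\<close>

text \<open>Translating the box moves its lower \<open>n\<close>-th coordinate to zero; for boxes in that half space the
volume formula for shears is \<open>measure_shear_interval\<close>.\<close>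

lemma measure_shear_cbox:
  fixes a b :: "real^'n"
  assumes mn: "m \<noteq> n"
  defines "h \<equiv> \<lambda>v::real^'n. \<chi> i. if i = m then v$m + v$n else v$i"
  shows "measure lebesgue (h ` cbox a b) = measure lebesgue (cbox a b)"
proof (cases "cbox a b = {}")
  case False
  define w :: "real^'n" where "w = axis n (- (a$n))"
  have lin: "linear h" unfolding h_def
    by (rule linearI) (auto simp: vec_eq_iff algebra_simps)
  have "h ` (+) w ` cbox a b = (+) (h w) ` h ` cbox a b"
    by (simp add: image_image linear_add[OF lin])
  then have "measure lebesgue (h ` cbox a b) = measure lebesgue (h ` cbox (w + a) (w + b))"
    by (simp add: cbox_translation measure_translation)
  also have "\<dots> = measure lebesgue (cbox (w + a) (w + b))"
    unfolding h_def using False mn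
    by (intro measure_shear_interval) (auto simp: cbox_translation w_def)
  finally show ?thesis
    by (metis cbox_translation measure_translation)
qed simp

text \<open>Every linear map is composed of maps that annihilate a coordinate, coordinatewise scalings, swaps
and shears. For each of these the formula is elementary, and it is stable under composition because
determinants multiply. Swaps and shears of two coordinates make sense for an arbitrary finite index
type.\<close>

lemma measure_linear_image_cart:
  fixes f :: "real^'n \<Rightarrow> real^'n"
  assumes "linear f" "S \<in> lmeasurable"
  shows "f ` S \<in> lmeasurable" "measure lebesgue (f ` S) = \<bar>det (matrix f)\<bar> * measure lebesgue S"
proof -
  define Q where "Q = (\<lambda>f::real^'n \<Rightarrow> real^'n. \<forall>S\<in>lmeasurable. f ` S \<in> lmeasurable \<and>
    measure lebesgue (f ` S) = \<bar>det (matrix f)\<bar> * measure lebesgue S)"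
  have unimodular: "Q h" if "linear h" "\<bar>det (matrix h)\<bar> = 1"
    "\<And>a b. measure lebesgue (h ` cbox a b) = measure lebesgue (cbox a b)" for h
    unfolding Q_def that(2) using measure_linear_sufficient[OF that(1), where m=1] that(3) by (metis mult_1)
  have "Q f"
  proof (rule induct_linear_elementary[OF assms(1)])
    fix f g :: "real^'n \<Rightarrow> real^'n"
    assume fg: "linear f" "linear g" "Q f" "Q g"
    show "Q (f \<circ> g)"
      unfolding Q_def
    proof
      fix S :: "(real^'n) set" assume S: "S \<in> lmeasurable"
      show "(f \<circ> g) ` S \<in> lmeasurable \<and>
        measure lebesgue ((f \<circ> g) ` S) = \<bar>det (matrix (f \<circ> g))\<bar> * measure lebesgue S"
        using fg(1,2) fg(3,4)[unfolded Q_def, rule_format] S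
        unfolding image_comp[symmetric] by (simp add: matrix_compose det_mul abs_mult del: image_comp)
    qed
  next
    fix f :: "real^'n \<Rightarrow> real^'n" and i
    assume f: "linear f" "\<And>x. f x $ i = 0"
    then have "\<not> surj f"
      by (metis axis_nth surjD zero_neq_one)
    then have ni: "\<not> inj f" using f(1) linear_injective_imp_surjective by blast
    then have "negligible (f ` S)" for S using negligible_linear_singular_image f(1) by blast
    moreover have "det (matrix f) = 0" using ni det_nz_iff_inj[OF f(1)] by blast
    ultimately show "Q f"
      unfolding Q_def by (simp add: negligible_iff_measure)
  next
    fix c
    show "Q (\<lambda>x. \<chi> i. c i * x $ i)"
      unfolding Q_def by (simp add: measurable_stretch measure_stretch axis_def matrix_def det_diagonal)
  next
    fix m n :: 'n assume "m \<noteq> n"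
    let ?h = "\<lambda>v::real^'n. \<chi> i. v $ Transposition.transpose m n i"
    have lin: "linear ?h" by (rule linearI) (simp_all add: vec_eq_iff)
    have "?h \<circ> ?h = id" by (auto simp: vec_eq_iff)
    then have "det (matrix ?h) * det (matrix ?h) = 1"
      by (metis det_I det_mul lin matrix_compose matrix_id_mat_1)
    then have "\<bar>det (matrix ?h)\<bar> = 1" by (simp only: abs_square_eq_1 power2_eq_square[symmetric])
    moreover have "measure lebesgue (?h ` cbox a b) = measure lebesgue (cbox a b)" for a b
    proof (cases "cbox a b = {}")
      case False
      have "?h ` cbox a b = cbox (?h a) (?h b)"
      proof (intro subset_antisym subsetI)
        fix x assume "x \<in> cbox (?h a) (?h b)"
        then have le: "a $ Transposition.transpose m n i \<le> x $ i \<and> x $ i \<le> b $ Transposition.transpose m n i" for i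
          by (simp add: mem_box_cart)
        have "?h x \<in> cbox a b"
          unfolding mem_box_cart using le[of "Transposition.transpose m n i" for i] by simp
        moreover have "x = ?h (?h x)" by (simp add: vec_eq_iff)
        ultimately show "x \<in> ?h ` cbox a b" by blast
      qed (auto simp: mem_box_cart)
      then show ?thesis
        using False prod.permute[OF permutes_swap_id[of m UNIV n], of "\<lambda>i. (b - a)$i"]
          image_is_empty[of ?h "cbox a b"]
        by (simp add: content_cbox_cart comp_def)
    qed simp
    ultimately show "Q ?h" using unimodular[OF lin] by blast
  next
    fix m n :: 'n assume mn: "m \<noteq> n"
    let ?h = "\<lambda>v::real^'n. \<chi> i. if i = m then v $ m + v $ n else v $ i"
    have lin: "linear ?h" by (rule linearI) (auto simp: vec_eq_iff algebra_simps)
    have "matrix ?h = (\<chi> k. if k = m then row m (mat 1) + 1 *s row n (mat 1) else row k (mat 1))"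
      using mn by (auto simp: matrix_def row_def vec_eq_iff mat_def axis_def)
    then have "det (matrix ?h) = 1" by (simp only: det_row_operation[OF mn] det_I)
    then show "Q ?h" using unimodular[OF lin] measure_shear_cbox[OF mn] by simp
  qed
  with assms(2) show "f ` S \<in> lmeasurable" "measure lebesgue (f ` S) = \<bar>det (matrix f)\<bar> * measure lebesgue S"
    unfolding Q_def by blast+
qed

lemma borel_measurable_matrix_vector [measurable]:
  "(\<lambda>x. (A::real^'n^'m) *v x) \<in> borel_measurable borel"
  by (intro borel_measurable_continuous_onI linear_continuous_on matrix_vector_mul_bounded_linear)

lemma lborel_invertible_matrix:
  fixes T :: "real^'n^'n"
  assumes "invertible T"
  shows "lborel = density (distr lborel borel ((*v) T)) (\<lambda>_. ennreal \<bar>det T\<bar>)"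
proof (rule lborel_eqI)
  fix l u :: "real^'n"
  assume lu: "\<And>b. b \<in> Basis \<Longrightarrow> l \<bullet> b \<le> u \<bullet> b"
  let ?R = "matrix_inv T"
  have TR: "T *v (?R *v x) = x" "?R *v (T *v x) = x" for x
    using assms by (simp_all add: matrix_vector_mul_assoc matrix_inv_mult)
  have vim: "(*v) T -` box l u = (*v) ?R ` box l u"
    by (auto simp: image_iff TR) (metis TR(2))
  have lm: "(*v) ?R ` box l u \<in> lmeasurable"
    and me: "measure lebesgue ((*v) ?R ` box l u) = \<bar>det ?R\<bar> * measure lebesgue (box l u)"
    using measure_linear_image_cart[of "(*v) ?R" "box l u"] by (simp_all add: matrix_vector_mul_linear)
  have b: "(*v) T -` box l u \<in> sets borel"
    using measurable_sets[OF borel_measurable_matrix_vector, of "box l u" T] by simp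
  have "emeasure lborel ((*v) T -` box l u) = emeasure lebesgue ((*v) T -` box l u)"
    using b by simp
  also have "\<dots> = ennreal (\<bar>det ?R\<bar> * measure lebesgue (box l u))"
    using lm me unfolding vim by (subst emeasure_eq_measure2) (auto simp: fmeasurable_def)
  finally have "emeasure lborel ((*v) T -` box l u) = ennreal (\<bar>det ?R\<bar> * (\<Prod>b\<in>Basis. (u - l) \<bullet> b))"
    using lu by (simp add: measure_lborel_box_eq)
  moreover have "\<bar>det T\<bar> * \<bar>det ?R\<bar> = 1"
    by (metis abs_mult abs_one assms det_I det_mul matrix_inv_mult(1))
  ultimately show "emeasure (density (distr lborel borel ((*v) T)) (\<lambda>_. ennreal \<bar>det T\<bar>)) (box l u) = ennreal (\<Prod>b\<in>Basis. (u - l) \<bullet> b)"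
    by (simp add: emeasure_density nn_integral_cmult emeasure_distr nn_integral_cmult_indicator 
       mult.assoc[symmetric] flip: ennreal_mult')
qed simp

lemma nn_integral_lborel_affine:
  fixes T :: "real^'n^'n" and F :: "real^'n \<Rightarrow> ennreal"
  assumes "invertible T" and [measurable]: "F \<in> borel_measurable borel"
  shows "(\<integral>\<^sup>+y. F y \<partial>lborel) = ennreal \<bar>det T\<bar> * (\<integral>\<^sup>+z. F (\<mu> + T *v z) \<partial>lborel)"
proof -
  have "(\<integral>\<^sup>+y. F y \<partial>lborel) = (\<integral>\<^sup>+y. F y \<partial>distr lborel borel ((+) \<mu>))"
    by (simp add: lborel_distr_plus)
  also have "\<dots> = (\<integral>\<^sup>+y. F (\<mu> + y) \<partial>lborel)"
    by (subst nn_integral_distr) auto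
  also have "\<dots> = (\<integral>\<^sup>+y. F (\<mu> + y) \<partial>density (distr lborel borel ((*v) T)) (\<lambda>_. ennreal \<bar>det T\<bar>))"
    by (subst lborel_invertible_matrix[OF assms(1)]) (rule refl)
  also have "\<dots> = ennreal \<bar>det T\<bar> * (\<integral>\<^sup>+z. F (\<mu> + T *v z) \<partial>lborel)"
    by (simp add: nn_integral_density nn_integral_distr nn_integral_cmult)
  finally show ?thesis .
qed

text \<open>The change of variables \<open>y = \<mu> + S\<^sup>1\<^sup>/\<^sup>2 z\<close> has Jacobian \<open>|S|\<^sup>1\<^sup>/\<^sup>2\<close>, which cancels the factor in
front of the elliptical density, and it turns the Mahalanobis form into \<open>z \<bullet> z\<close>. Measurability of
the radial profile is only available through that of the density, hence the first conclusion.\<close>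

lemma ell_measure_eq_distr:
  fixes S :: "real^'k^'k"
  assumes S: "pds S" and meas[measurable]: "ell_density m \<mu> S \<in> borel_measurable borel"
  shows "ell_density m (0::real^'k) (mat 1) \<in> borel_measurable borel" (is ?M)
    and "ell_measure m \<mu> S = distr (ell_measure m 0 (mat 1)) borel (\<lambda>z. \<mu> + matrix_sqrt S *v z)"
proof -
  let ?T = "matrix_sqrt S"
  have T: "pds ?T" "?T ** ?T = S" using matrix_sqrt[OF S] .
  have invT: "invertible ?T" using T(1) by (rule pds_invertible)
  have dT: "det ?T > 0" using T(1) by (rule pds_det_pos)
  have dS: "det S = (det ?T)^2" by (metis T(2) det_mul power2_eq_square)
  have c: "det S powr (- (1/2)) = 1 / det ?T"
  proof -
    have "det S powr (1/2) = det ?T" using dT powr_half_sqrt[of "(det ?T)^2"] unfolding dS by simp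
    then show ?thesis using powr_minus[of "det S" "1/2"] by (simp add: inverse_eq_divide)
  qed
  have q: "(?T *v z) \<bullet> (matrix_inv S *v (?T *v z)) = z \<bullet> z" for z
  proof -
    have "matrix_inv S = matrix_inv ?T ** matrix_inv ?T"
      using matrix_inv_matrix_mult[OF invT invT] T(2) by simp
    then have "?T *v (matrix_inv S *v (?T *v z)) = z"
      using invT by (simp add: matrix_vector_mul_assoc matrix_mul_assoc matrix_inv_mult)
    then show ?thesis by (simp add: pds_inner_sym[OF T(1), symmetric])
  qed
  have e1: "ell_density m 0 (mat 1) z = m (z \<bullet> z)" for z :: "real^'k"
    using matrix_inv_unique[of "mat 1 :: real^'k^'k" "mat 1"] by (simp add: ell_density_def)
  have eS: "ell_density m \<mu> S (\<mu> + ?T *v z) = 1 / det ?T * m (z \<bullet> z)" for z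
    by (simp add: ell_density_def c q)
  have "(\<lambda>z. det ?T * ell_density m \<mu> S (\<mu> + ?T *v z)) \<in> borel_measurable borel"
    by measurable
  then show ?M using dT unfolding eS e1[abs_def] by simp
  then have [measurable]: "(\<lambda>z::real^'k. m (z \<bullet> z)) \<in> borel_measurable borel" by (simp add: e1[abs_def])
  show "ell_measure m \<mu> S = distr (ell_measure m 0 (mat 1)) borel (\<lambda>z. \<mu> + ?T *v z)"
  proof (rule measure_eqI)
    fix A assume "A \<in> sets (ell_measure m \<mu> S)"
    then have [measurable]: "A \<in> sets borel" by (simp add: ell_measure_def)
    have ind: "indicator ((\<lambda>z. \<mu> + ?T *v z) -` A) z = (indicator A (\<mu> + ?T *v z) :: ennreal)" for z
      by (simp add: indicator_def)
    have [measurable]: "(\<lambda>z. \<mu> + ?T *v z) -` A \<in> sets borel"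
      using measurable_sets[of "\<lambda>z. \<mu> + ?T *v z" borel borel A] by simp
    have "emeasure (ell_measure m \<mu> S) A = (\<integral>\<^sup>+y. ennreal (ell_density m \<mu> S y) * indicator A y \<partial>lborel)"
      unfolding ell_measure_def by (subst emeasure_density) auto
    also have "\<dots> = ennreal \<bar>det ?T\<bar> * (\<integral>\<^sup>+z. ennreal (ell_density m \<mu> S (\<mu> + ?T *v z)) * indicator A (\<mu> + ?T *v z) \<partial>lborel)"
      by (rule nn_integral_lborel_affine[OF invT]) measurable
    also have "\<dots> = (\<integral>\<^sup>+z. ennreal (m (z \<bullet> z)) * indicator A (\<mu> + ?T *v z) \<partial>lborel)"
    proof -
      have "ennreal \<bar>det ?T\<bar> * (ennreal (1 / det ?T * m (z \<bullet> z)) * i) = ennreal (m (z \<bullet> z)) * i" for z :: "real^'k" and i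
        using dT by (simp add: mult.assoc[symmetric] flip: ennreal_mult')
      then show ?thesis unfolding eS by (subst nn_integral_cmult[symmetric]) auto
    qed
    also have "\<dots> = emeasure (distr (ell_measure m 0 (mat 1)) borel (\<lambda>z. \<mu> + ?T *v z)) A"
      unfolding ell_measure_def
      by (subst emeasure_distr) (auto simp: emeasure_density e1 ind)
    finally show "emeasure (ell_measure m \<mu> S) A = emeasure (distr (ell_measure m 0 (mat 1)) borel (\<lambda>z. \<mu> + ?T *v z)) A" .
  qed (simp add: ell_measure_def)
qed

text \<open>The standard density depends on \<open>z \<bullet> z\<close> only, and orthogonal maps have determinant \<open>\<plusminus>1\<close>.\<close>

lemma ell_measure_std_rotation:
  fixes f :: "real^'k \<Rightarrow> real^'k"
  assumes f: "orthogonal_transformation f" 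
    and meas[measurable]: "ell_density m (0::real^'k) (mat 1) \<in> borel_measurable borel"
  shows "distr (ell_measure m 0 (mat 1)) borel f = ell_measure m 0 (mat 1)"
proof (rule measure_eqI)
  have lin: "linear f" and om: "orthogonal_matrix (matrix f)"
    using f orthogonal_transformation_matrix by auto
  define A where "A = matrix f"
  have fm: "f x = A *v x" for x unfolding A_def using matrix_works[OF lin[folded linear_matrix_vector_mul_eq]] by simp
  have fmeas[measurable]: "f \<in> borel_measurable borel" unfolding fm[abs_def] by measurable
  have inv: "invertible A"
    using om unfolding A_def[symmetric] orthogonal_matrix_def invertible_def by blast
  have det1: "\<bar>det A\<bar> = 1" using det_orthogonal_matrix[OF om] unfolding A_def by auto
  have e1: "ell_density m 0 (mat 1) z = m (z \<bullet> z)" for z :: "real^'k"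
    using matrix_inv_unique[of "mat 1 :: real^'k^'k" "mat 1"] by (simp add: ell_density_def)
  have ef: "m (f z \<bullet> f z) = m (z \<bullet> z)" for z
    using f by (simp add: orthogonal_transformation_def)
  have [measurable]: "(\<lambda>z::real^'k. m (z \<bullet> z)) \<in> borel_measurable borel" using meas by (simp add: e1[abs_def])
  fix D assume "D \<in> sets (distr (ell_measure m 0 (mat 1)) borel f)"
  then have [measurable]: "D \<in> sets borel" by simp
  have [measurable]: "f -` D \<in> sets borel"
    using measurable_sets[OF fmeas, of D] by simp
  have ind: "indicator (f -` D) z = (indicator D (f z) :: ennreal)" for z
    by (simp add: indicator_def)
  have "emeasure (ell_measure m 0 (mat 1)) D = (\<integral>\<^sup>+y. ennreal (m (y \<bullet> y)) * indicator D y \<partial>lborel)"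
    unfolding ell_measure_def by (subst emeasure_density) (auto simp: e1)
  also have "\<dots> = ennreal \<bar>det A\<bar> * (\<integral>\<^sup>+z. ennreal (m ((0 + A *v z) \<bullet> (0 + A *v z))) * indicator D (0 + A *v z) \<partial>lborel)"
    by (rule nn_integral_lborel_affine[OF inv]) measurable
  also have "\<dots> = (\<integral>\<^sup>+z. ennreal (m (z \<bullet> z)) * indicator D (f z) \<partial>lborel)"
    by (simp add: det1 ef flip: fm)
  also have "\<dots> = emeasure (distr (ell_measure m 0 (mat 1)) borel f) D"
    unfolding ell_measure_def
    by (subst emeasure_distr) (auto simp: emeasure_density e1 ind)
  finally show "emeasure (distr (ell_measure m 0 (mat 1)) borel f) D = emeasure (ell_measure m 0 (mat 1)) D" ..
qed (simp add: ell_measure_def)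

text \<open>Given \<open>X\<close>, the response has the law of \<open>X \<beta> + S\<^sup>1\<^sup>/\<^sup>2 z\<close> with the same \<open>z\<close>-law \<open>\<nu>\<close> for every \<open>X\<close>; hence the
two measures agree on all rectangles. In this form integrals over \<open>P\<close> become iterated integrals with a
rotation invariant inner one.\<close>

lemma elliptical_representation:
  fixes P :: "((real^'k) \<times> (real^'q^'k)) measure"
  assumes P: "prob_space P" "sets P = sets borel" and S: "pds S"
    and cd: "cond_density P (\<lambda>X. ell_density m (X *v \<beta>) S)"
  defines "\<nu> \<equiv> ell_measure m (0::real^'k) (mat 1)"
  shows "prob_space \<nu>" 
    and "ell_density m (0::real^'k) (mat 1) \<in> borel_measurable borel"
    and "P = distr (\<nu> \<Otimes>\<^sub>M distr P borel snd) borel (\<lambda>(z, X). (X *v \<beta> + matrix_sqrt S *v z, X))"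
proof -
  let ?T = "matrix_sqrt S"
  have meas: "ell_density m (X *v \<beta>) S \<in> borel_measurable borel"
    and pr: "prob_space (ell_measure m (X *v \<beta>) S)" for X :: "real^'q^'k"
    using cd by (simp_all add: cond_density_def ell_measure_def)
  have rep: "ell_measure m (X *v \<beta>) S = distr \<nu> borel (\<lambda>z. X *v \<beta> + ?T *v z)" for X :: "real^'q^'k"
    unfolding \<nu>_def by (rule ell_measure_eq_distr(2)[OF S meas])
  show "ell_density m (0::real^'k) (mat 1) \<in> borel_measurable borel"
    by (rule ell_measure_eq_distr(1)[OF S meas[of 0]])
  have sets_nu[measurable_cong]: "sets \<nu> = sets borel" by (simp add: \<nu>_def ell_measure_def)
  show "prob_space \<nu>"
    using pr[of 0] unfolding rep
    by (rule prob_space_distrD[rotated]) measurable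
  then interpret nu: prob_space \<nu> .
  interpret PS: prob_space P by fact
  have [measurable_cong]: "sets P = sets (borel \<Otimes>\<^sub>M borel)" by (simp only: P(2) borel_prod)
  have snd_meas[measurable]: "snd \<in> measurable P borel" by measurable
  let ?PX = "distr P borel snd"
  interpret PX: prob_space ?PX by (rule PS.prob_space_distr) measurable
  interpret pp: pair_prob_space \<nu> ?PX ..
  let ?H = "\<lambda>(z, X). (X *v \<beta> + ?T *v z, X :: real^'q^'k)"
  have cont: "continuous_on UNIV ?H"
    unfolding split_beta
    by (intro continuous_intros bounded_bilinear.continuous_on[OF bounded_bilinear_matrix_vector])
  have H: "?H \<in> measurable (\<nu> \<Otimes>\<^sub>M ?PX) borel"
  proof -
    have "?H \<in> borel_measurable borel" using cont by (rule borel_measurable_continuous_onI)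
    moreover have "sets (\<nu> \<Otimes>\<^sub>M ?PX) = sets borel"
      using sets_pair_measure_cong[OF sets_nu sets_distr[of P borel snd]] unfolding borel_prod .
    ultimately show ?thesis by (simp cong: measurable_cong_sets)
  qed
  let ?E = "{A \<times> B | A B. A \<in> sets (borel :: (real^'k) measure) \<and> B \<in> sets (borel :: (real^'q^'k) measure)}"
  have gen: "sets (borel :: ((real^'k) \<times> (real^'q^'k)) measure) = sigma_sets UNIV ?E"
    using sets_pair_measure[of "borel :: (real^'k) measure" "borel :: (real^'q^'k) measure"]
    unfolding borel_prod by simp
  show "P = distr (\<nu> \<Otimes>\<^sub>M ?PX) borel ?H"
  proof (rule measure_eqI_generator_eq[where E="?E" and \<Omega>=UNIV and A="\<lambda>_. UNIV"])
    show "Int_stable ?E" by (rule Int_stable_pair_measure_generator)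
    show "sets P = sigma_sets UNIV ?E" "sets (distr (\<nu> \<Otimes>\<^sub>M ?PX) borel ?H) = sigma_sets UNIV ?E"
      using P(2) gen by simp_all
    show "range (\<lambda>_. UNIV) \<subseteq> ?E" by (auto intro!: exI[of _ UNIV])
    show "emeasure P UNIV \<noteq> \<infinity>" by simp
    fix Y assume "Y \<in> ?E"
    then obtain A B where AB[measurable]: "A \<in> sets (borel :: (real^'k) measure)" "B \<in> sets (borel :: (real^'q^'k) measure)"
      and Y: "Y = A \<times> B" by blast
    have Ym: "Y \<in> sets borel" unfolding Y unfolding borel_prod[symmetric] using AB by measurable
    have V: "?H -` Y \<inter> space (\<nu> \<Otimes>\<^sub>M ?PX) \<in> sets (\<nu> \<Otimes>\<^sub>M ?PX)"
      using measurable_sets[OF H Ym] .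
    have "emeasure (distr (\<nu> \<Otimes>\<^sub>M ?PX) borel ?H) Y = emeasure (\<nu> \<Otimes>\<^sub>M ?PX) (?H -` Y \<inter> space (\<nu> \<Otimes>\<^sub>M ?PX))"
      using H Ym by (rule emeasure_distr)
    also have "\<dots> = (\<integral>\<^sup>+X. emeasure \<nu> ((\<lambda>z. (z, X)) -` (?H -` Y \<inter> space (\<nu> \<Otimes>\<^sub>M ?PX))) \<partial>?PX)"
      by (rule pp.emeasure_pair_measure_alt2[OF V])
    also have "\<dots> = (\<integral>\<^sup>+X. emeasure (ell_measure m (X *v \<beta>) S) A * indicator B X \<partial>?PX)"
    proof (intro nn_integral_cong)
      fix X :: "real^'q^'k"
      have "(\<lambda>z. (z, X)) -` (?H -` Y \<inter> space (\<nu> \<Otimes>\<^sub>M ?PX)) = (if X \<in> B then (\<lambda>z. X *v \<beta> + ?T *v z) -` A \<inter> space \<nu> else {})"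
        unfolding Y by (auto simp: space_pair_measure)
      then show "emeasure \<nu> ((\<lambda>z. (z, X)) -` (?H -` Y \<inter> space (\<nu> \<Otimes>\<^sub>M ?PX))) = emeasure (ell_measure m (X *v \<beta>) S) A * indicator B X"
        unfolding rep by (subst emeasure_distr) (auto simp: indicator_def)
    qed
    also have "\<dots> = emeasure P Y"
      using cd AB unfolding Y cond_density_def ell_measure_def by simp
    finally show "emeasure P Y = emeasure (distr (\<nu> \<Otimes>\<^sub>M ?PX) borel ?H) Y" ..
  qed auto
qed

section \<open>Moments of rotation invariant measures\<close>

text \<open>The property of the spherical density on which the moment formulas rest.\<close>

locale rotation_invariant =
  fixes \<nu> :: "(real^'k) measure"
  assumes sets_borel: "sets \<nu> = sets borel"
    and rotate: "orthogonal_transformation f \<Longrightarrow> distr \<nu> borel f = \<nu>"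
begin

lemma measurable_iff: "h \<in> measurable \<nu> N \<longleftrightarrow> h \<in> measurable borel N"
  by (simp add: measurable_cong_sets[OF sets_borel refl])

lemma integral_rotate:
  fixes h :: "real^'k \<Rightarrow> real"
  assumes f: "orthogonal_transformation f" and h: "h \<in> borel_measurable borel"
  shows "(LINT z|\<nu>. h (f z)) = (LINT z|\<nu>. h z)"
proof -
  have "f \<in> borel_measurable borel"
    using orthogonal_transformation_linear[OF f]
    by (intro borel_measurable_continuous_onI linear_continuous_on) (simp add: linear_conv_bounded_linear)
  then have "(LINT z|distr \<nu> borel f. h z) = (LINT z|\<nu>. h (f z))"
    using h by (intro integral_distr) (simp_all add: measurable_iff)
  then show ?thesis by (simp add: rotate[OF f])
qed

lemma integral_even:
  fixes h :: "real^'k \<Rightarrow> real"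
  assumes h: "h \<in> borel_measurable borel" 
  shows "(LINT z|\<nu>. h (- z)) = (LINT z|\<nu>. h z)"
  using integral_rotate[OF _ h, of uminus]
  by (simp add: orthogonal_transformation_neg orthogonal_transformation_id[unfolded id_def])

lemma integrable_radial_product:
  assumes g[measurable]: "g \<in> borel_measurable borel"
    and int: "integrable \<nu> (\<lambda>z. g (norm z) * norm z ^ 2)"
  shows "integrable \<nu> (\<lambda>z. g (norm z) * ((z \<bullet> a) * (z \<bullet> b)))"
proof (rule Bochner_Integration.integrable_bound[OF integrable_mult_left[OF int, of "norm a * norm b"]])
  show "(\<lambda>z. g (norm z) * ((z \<bullet> a) * (z \<bullet> b))) \<in> borel_measurable \<nu>"
    unfolding measurable_iff by measurable
  show "AE z in \<nu>. norm (g (norm z) * ((z \<bullet> a) * (z \<bullet> b))) \<le> norm (g (norm z) * norm z ^ 2 * (norm a * norm b))"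
  proof (rule AE_I2)
    fix z
    have "\<bar>z \<bullet> a\<bar> * \<bar>z \<bullet> b\<bar> \<le> (norm z * norm a) * (norm z * norm b)"
      by (intro mult_mono Cauchy_Schwarz_ineq2) auto
    then have "\<bar>g (norm z)\<bar> * (\<bar>z \<bullet> a\<bar> * \<bar>z \<bullet> b\<bar>) \<le> \<bar>g (norm z)\<bar> * ((norm z * norm a) * (norm z * norm b))"
      by (intro mult_left_mono) auto
    then show "norm (g (norm z) * ((z \<bullet> a) * (z \<bullet> b))) \<le> norm (g (norm z) * norm z ^ 2 * (norm a * norm b))"
      by (simp add: abs_mult power2_eq_square mult_ac)
  qed
qed

text \<open>Some rotation carries \<open>\<parallel>a\<parallel> e\<^sub>i\<close> to \<open>a\<close>.\<close>

lemma integral_radial_even_power: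
  assumes g[measurable]: "g \<in> borel_measurable borel"
  shows "(LINT z|\<nu>. g (norm z) * (z \<bullet> a) ^ (2 * n)) = (LINT z|\<nu>. g (norm z) * (z \<bullet> axis i 1) ^ (2 * n)) * norm a ^ (2 * n)"
proof -
  define b :: "real^'k" where "b = norm a *\<^sub>R axis i 1"
  have "norm b = norm a" by (simp add: b_def norm_axis_1)
  then obtain f where f: "orthogonal_transformation f" "f b = a"
    using orthogonal_transformation_exists by blast
  have "(LINT z|\<nu>. g (norm z) * (z \<bullet> a) ^ (2 * n)) = (LINT z|\<nu>. g (norm (f z)) * (f z \<bullet> a) ^ (2 * n))"
    by (rule integral_rotate[OF f(1), symmetric]) measurable
  also have "\<dots> = (LINT z|\<nu>. (g (norm z) * (z \<bullet> axis i 1) ^ (2 * n)) * norm a ^ (2 * n))"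
  proof (rule Bochner_Integration.integral_cong[OF refl])
    fix z
    have "f z \<bullet> f b = z \<bullet> b"
      using f(1) unfolding orthogonal_transformation_def by blast
    then have "f z \<bullet> a = norm a * (z \<bullet> axis i 1)"
      unfolding f(2) by (simp add: b_def)
    moreover have "norm (f z) = norm z" using f(1) unfolding orthogonal_transformation by blast
    ultimately show "g (norm (f z)) * (f z \<bullet> a) ^ (2 * n) = (g (norm z) * (z \<bullet> axis i 1) ^ (2 * n)) * norm a ^ (2 * n)"
      by (simp add: power_mult_distrib mult_ac)
  qed
  finally show ?thesis by simp
qed

lemma norm_power2_sum: "norm (z::real^'k) ^ 2 = (\<Sum>i\<in>UNIV. (z \<bullet> axis i 1) ^ 2)"
  unfolding power2_norm_eq_inner inner_axis by (simp add: inner_vec_def power2_eq_square)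

text \<open>The integral is a symmetric bilinear form in \<open>(a, b)\<close> that is constant on spheres, hence a multiple of
the inner product by polarisation. Summing over an orthonormal basis identifies the factor.\<close>

lemma radial_second_moment:
  assumes g[measurable]: "g \<in> borel_measurable borel"
    and int: "integrable \<nu> (\<lambda>z. g (norm z) * norm z ^ 2)"
  shows "(LINT z|\<nu>. g (norm z) * ((z \<bullet> a) * (z \<bullet> b))) = (LINT z|\<nu>. g (norm z) * norm z ^ 2) / real CARD('k) * (a \<bullet> b)"
proof -
  define i :: 'k where "i = undefined"
  define \<kappa> where "\<kappa> = (LINT z|\<nu>. g (norm z) * (z \<bullet> axis i 1) ^ 2)"
  have I: "integrable \<nu> (\<lambda>z. g (norm z) * (z \<bullet> a) ^ 2)" for a
    using integrable_radial_product[OF g int, of a a] by (simp add: power2_eq_square)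
  have sq: "(LINT z|\<nu>. g (norm z) * (z \<bullet> a) ^ 2) = \<kappa> * norm a ^ 2" for a
    using integral_radial_even_power[OF g, of a 1 i] by (simp add: \<kappa>_def)
  have "(LINT z|\<nu>. g (norm z) * norm z ^ 2) = (\<Sum>j\<in>UNIV. (LINT z|\<nu>. g (norm z) * (z \<bullet> axis j 1) ^ 2))"
    unfolding norm_power2_sum sum_distrib_left by (rule Bochner_Integration.integral_sum) (rule I)
  also have "\<dots> = \<kappa> * real CARD('k)" by (simp add: sq norm_axis_1)
  finally have \<kappa>: "\<kappa> = (LINT z|\<nu>. g (norm z) * norm z ^ 2) / real CARD('k)" by simp
  have "(LINT z|\<nu>. g (norm z) * ((z \<bullet> a) * (z \<bullet> b))) =
    (LINT z|\<nu>. (g (norm z) * (z \<bullet> (a + b)) ^ 2 - g (norm z) * (z \<bullet> (a - b)) ^ 2) / 4)"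
    by (rule Bochner_Integration.integral_cong) (auto simp: inner_add_right inner_diff_right power2_eq_square algebra_simps)
  also have "\<dots> = (\<kappa> * norm (a + b) ^ 2 - \<kappa> * norm (a - b) ^ 2) / 4"
    using I by (simp add: sq)
  also have "\<dots> = \<kappa> * (a \<bullet> b)"
    unfolding power2_norm_eq_inner by (simp add: inner_add_left inner_add_right inner_diff_left inner_diff_right inner_commute algebra_simps)
  finally show ?thesis by (simp add: \<kappa>)
qed

lemma integrable_radial_product4:
  assumes g[measurable]: "g \<in> borel_measurable borel"
    and int: "integrable \<nu> (\<lambda>z. g (norm z) * norm z ^ 4)"
  shows "integrable \<nu> (\<lambda>z. g (norm z) * ((z \<bullet> a) * (z \<bullet> b) * ((z \<bullet> p) * (z \<bullet> q))))"
proof (rule Bochner_Integration.integrable_bound[OF integrable_mult_left[OF int, of "norm a * norm b * (norm p * norm q)"]])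
  show "(\<lambda>z. g (norm z) * ((z \<bullet> a) * (z \<bullet> b) * ((z \<bullet> p) * (z \<bullet> q)))) \<in> borel_measurable \<nu>"
    unfolding measurable_iff by measurable
  show "AE z in \<nu>. norm (g (norm z) * ((z \<bullet> a) * (z \<bullet> b) * ((z \<bullet> p) * (z \<bullet> q))))
     \<le> norm (g (norm z) * norm z ^ 4 * (norm a * norm b * (norm p * norm q)))"
  proof (rule AE_I2)
    fix z
    have "\<bar>z \<bullet> a\<bar> * \<bar>z \<bullet> b\<bar> * (\<bar>z \<bullet> p\<bar> * \<bar>z \<bullet> q\<bar>) \<le> (norm z * norm a) * (norm z * norm b) * ((norm z * norm p) * (norm z * norm q))"
      by (intro mult_mono Cauchy_Schwarz_ineq2) auto
    then have "\<bar>g (norm z)\<bar> * (\<bar>z \<bullet> a\<bar> * \<bar>z \<bullet> b\<bar> * (\<bar>z \<bullet> p\<bar> * \<bar>z \<bullet> q\<bar>))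
      \<le> \<bar>g (norm z)\<bar> * ((norm z * norm a) * (norm z * norm b) * ((norm z * norm p) * (norm z * norm q)))"
      by (intro mult_left_mono) auto
    then show "norm (g (norm z) * ((z \<bullet> a) * (z \<bullet> b) * ((z \<bullet> p) * (z \<bullet> q))))
     \<le> norm (g (norm z) * norm z ^ 4 * (norm a * norm b * (norm p * norm q)))"
      by (simp add: abs_mult power4_eq_xxxx mult_ac)
  qed
qed

text \<open>The integral is a symmetric quartilinear form. On the diagonal it is a multiple of \<open>\<parallel>a\<parallel>\<^sup>4\<close>, and
polarisation extends this to four different arguments. The multiple is found from
\<open>\<parallel>z\<parallel>\<^sup>4 = (\<Sum>r s. z\<^sub>r\<^sup>2 z\<^sub>s\<^sup>2)\<close>, in which the terms with \<open>r = s\<close> count three times as much as those with \<open>r \<noteq> s\<close>.\<close>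

lemma radial_fourth_moment:
  assumes g[measurable]: "g \<in> borel_measurable borel"
    and int: "integrable \<nu> (\<lambda>z. g (norm z) * norm z ^ 4)"
  shows "(LINT z|\<nu>. g (norm z) * ((z \<bullet> a) * (z \<bullet> b) * ((z \<bullet> p) * (z \<bullet> q)))) =
    (LINT z|\<nu>. g (norm z) * norm z ^ 4) / (real CARD('k) * (real CARD('k) + 2)) *
    ((a \<bullet> b) * (p \<bullet> q) + (a \<bullet> p) * (b \<bullet> q) + (a \<bullet> q) * (b \<bullet> p))"
proof -
  define i :: 'k where "i = undefined"
  define \<kappa> where "\<kappa> = (LINT z|\<nu>. g (norm z) * (z \<bullet> axis i 1) ^ 4) / 3"
  define F where "F = (\<lambda>a b p q (z::real^'k). g (norm z) * ((z \<bullet> a) * (z \<bullet> b) * ((z \<bullet> p) * (z \<bullet> q))))"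
  define M where "M = (\<lambda>a b p q. LINT z|\<nu>. F a b p q z)"
  have I: "integrable \<nu> (\<lambda>z. F a b p q z)" for a b p q
    unfolding F_def by (rule integrable_radial_product4[OF g int])
  \<comment> \<open>The factor \<open>3\<close> makes the polarised form the plain sum over the three pairings.\<close>
  have quartic: "M a a a a = 3 * \<kappa> * (a \<bullet> a)^2" for a
    using integral_radial_even_power[OF g, of a 2 i]
    by (simp add: \<kappa>_def M_def F_def power4_eq_xxxx power2_norm_eq_inner[symmetric] power2_eq_square mult_ac)
  \<comment> \<open>Polarisation in three steps: fourth powers, then two squares, then a product and a square, then four factors.\<close>
  have sq: "M a a b b = \<kappa> * ((a \<bullet> a) * (b \<bullet> b) + 2 * (a \<bullet> b)^2)" for a b
  proof -
    have "M a a b b = (LINT z|\<nu>. (F (a + b) (a + b) (a + b) (a + b) z + F (a - b) (a - b) (a - b) (a - b) z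
        - 2 * F a a a a z - 2 * F b b b b z) / 12)"
      unfolding M_def F_def by (rule Bochner_Integration.integral_cong) (auto simp: inner_add_right inner_diff_right algebra_simps)
    also have "\<dots> = (M (a + b) (a + b) (a + b) (a + b) + M (a - b) (a - b) (a - b) (a - b) - 2 * M a a a a - 2 * M b b b b) / 12"
      unfolding M_def using I by simp
    finally show ?thesis
      unfolding quartic
      by (simp add: inner_add_left inner_add_right inner_diff_left inner_diff_right inner_commute power2_eq_square algebra_simps)
  qed
  have half: "M a b p p = \<kappa> * ((a \<bullet> b) * (p \<bullet> p) + 2 * (a \<bullet> p) * (b \<bullet> p))" for a b p
  proof -
    have "M a b p p = (LINT z|\<nu>. (F (a + b) (a + b) p p z - F (a - b) (a - b) p p z) / 4)"
      unfolding M_def F_def by (rule Bochner_Integration.integral_cong) (auto simp: inner_add_right inner_diff_right algebra_simps)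
    also have "\<dots> = (M (a + b) (a + b) p p - M (a - b) (a - b) p p) / 4"
      unfolding M_def using I by simp
    finally show ?thesis
      unfolding sq
      by (simp add: inner_add_left inner_add_right inner_diff_left inner_diff_right inner_commute power2_eq_square algebra_simps)
  qed
  have full: "M a b p q = \<kappa> * ((a \<bullet> b) * (p \<bullet> q) + (a \<bullet> p) * (b \<bullet> q) + (a \<bullet> q) * (b \<bullet> p))" for a b p q
  proof -
    have "M a b p q = (LINT z|\<nu>. (F a b (p + q) (p + q) z - F a b (p - q) (p - q) z) / 4)"
      unfolding M_def F_def by (rule Bochner_Integration.integral_cong) (auto simp: inner_add_right inner_diff_right algebra_simps)
    also have "\<dots> = (M a b (p + q) (p + q) - M a b (p - q) (p - q)) / 4"
      unfolding M_def using I by simp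
    finally show ?thesis
      unfolding half
      by (simp add: inner_add_left inner_add_right inner_diff_left inner_diff_right inner_commute power2_eq_square algebra_simps)
  qed
  have p4: "g (norm z) * norm z ^ 4 = (\<Sum>r\<in>UNIV. \<Sum>s\<in>UNIV. F (axis r 1) (axis r 1) (axis s 1) (axis s 1) z)" for z :: "real^'k"
  proof -
    have "norm z ^ 4 = norm z ^ 2 * norm z ^ 2" by (simp flip: power_add)
    then show ?thesis
      unfolding F_def norm_power2_sum sum_product by (simp only: sum_distrib_left power2_eq_square)
  qed
  have "(LINT z|\<nu>. g (norm z) * norm z ^ 4) = (\<Sum>r\<in>UNIV. \<Sum>s\<in>UNIV. M (axis r 1) (axis r 1) (axis s 1) (axis s 1))"
    unfolding p4 M_def by (simp add: I)
  also have "\<dots> = (\<Sum>r\<in>(UNIV::'k set). \<Sum>s\<in>(UNIV::'k set). \<kappa> * (1 + 2 * (if r = s then 1 else (0::real))))"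
    unfolding sq by (intro sum.cong refl) (auto simp: inner_axis_axis inner_real_def)
  also have "\<dots> = \<kappa> * (real CARD('k) * (real CARD('k) + 2))"
    by (simp add: distrib_left sum.distrib flip: sum_distrib_left)
  finally have "\<kappa> = (LINT z|\<nu>. g (norm z) * norm z ^ 4) / (real CARD('k) * (real CARD('k) + 2))"
    by (simp add: add_pos_nonneg)
  then show ?thesis using full unfolding M_def F_def by simp
qed

lemma quadratic_form_eq_sum:
  fixes E :: "real^'k^'k"
  shows "z \<bullet> (E *v z) = (\<Sum>i\<in>UNIV. \<Sum>j\<in>UNIV. E$i$j * ((z \<bullet> axis i 1) * (z \<bullet> axis j 1)))"
  by (simp add: inner_vec_def[of z] matrix_vector_mult_def inner_axis sum_distrib_left mult_ac)

lemma radial_quadratic_form: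
  fixes E :: "real^'k^'k"
  assumes g[measurable]: "g \<in> borel_measurable borel"
    and int: "integrable \<nu> (\<lambda>z. g (norm z) * norm z ^ 2)"
  shows "integrable \<nu> (\<lambda>z. g (norm z) * (z \<bullet> (E *v z)))"
    and "(LINT z|\<nu>. g (norm z) * (z \<bullet> (E *v z))) = (LINT z|\<nu>. g (norm z) * norm z ^ 2) / real CARD('k) * trace E"
proof -
  have eq: "g (norm z) * (z \<bullet> (E *v z)) = (\<Sum>i\<in>UNIV. \<Sum>j\<in>UNIV. E$i$j * (g (norm z) * ((z \<bullet> axis i 1) * (z \<bullet> axis j 1))))" for z
    unfolding quadratic_form_eq_sum sum_distrib_left by (simp add: mult_ac)
  note I = integrable_radial_product[OF g int]
  show "integrable \<nu> (\<lambda>z. g (norm z) * (z \<bullet> (E *v z)))" unfolding eq using I by simp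
  let ?K = "(LINT z|\<nu>. g (norm z) * norm z ^ 2) / real CARD('k)"
  have "(LINT z|\<nu>. g (norm z) * (z \<bullet> (E *v z))) = (\<Sum>i\<in>UNIV. \<Sum>j\<in>UNIV. E$i$j * (?K * (axis i 1 \<bullet> (axis j 1 :: real^'k))))"
    unfolding eq using I by (simp add: radial_second_moment[OF g int])
  also have "\<dots> = ?K * trace E"
    by (simp add: inner_axis_axis trace_def sum_distrib_left if_distrib cong: if_cong) (simp add: mult_ac)
  finally show "(LINT z|\<nu>. g (norm z) * (z \<bullet> (E *v z))) = ?K * trace E" .
qed

lemma radial_quadratic_form_product:
  fixes E B :: "real^'k^'k"
  assumes g[measurable]: "g \<in> borel_measurable borel"
    and int: "integrable \<nu> (\<lambda>z. g (norm z) * norm z ^ 4)"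
  shows "integrable \<nu> (\<lambda>z. g (norm z) * ((z \<bullet> (E *v z)) * (z \<bullet> (B *v z))))"
    and "(LINT z|\<nu>. g (norm z) * ((z \<bullet> (E *v z)) * (z \<bullet> (B *v z)))) =
      (LINT z|\<nu>. g (norm z) * norm z ^ 4) / (real CARD('k) * (real CARD('k) + 2)) *
      (trace E * trace B + E \<bullet> B + E \<bullet> transpose B)"
proof -
  have eq: "g (norm z) * ((z \<bullet> (E *v z)) * (z \<bullet> (B *v z))) = (\<Sum>i\<in>UNIV. \<Sum>j\<in>UNIV. \<Sum>r\<in>UNIV. \<Sum>s\<in>UNIV. (E$i$j * B$r$s) *
     (g (norm z) * ((z \<bullet> axis i 1) * (z \<bullet> axis j 1) * ((z \<bullet> axis r 1) * (z \<bullet> axis s 1)))))" for z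
    unfolding quadratic_form_eq_sum sum_distrib_right
    unfolding sum_distrib_left by (simp add: mult_ac)
  note I = integrable_radial_product4[OF g int]
  show "integrable \<nu> (\<lambda>z. g (norm z) * ((z \<bullet> (E *v z)) * (z \<bullet> (B *v z))))" unfolding eq using I by simp
  let ?K = "(LINT z|\<nu>. g (norm z) * norm z ^ 4) / (real CARD('k) * (real CARD('k) + 2))"
  let ?d = "\<lambda>i j::'k. if i = j then 1 else (0::real)"
  have "(LINT z|\<nu>. g (norm z) * ((z \<bullet> (E *v z)) * (z \<bullet> (B *v z)))) = (\<Sum>i\<in>UNIV. \<Sum>j\<in>UNIV. \<Sum>r\<in>UNIV. \<Sum>s\<in>UNIV. (E$i$j * B$r$s) *
     (?K * (?d i j * ?d r s + ?d i r * ?d j s + ?d i s * ?d j r)))"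
    unfolding eq using I by (simp add: radial_fourth_moment[OF g int] inner_axis_axis inner_real_def cong: if_cong)
  also have "\<dots> = ?K * ((\<Sum>i\<in>UNIV. \<Sum>j\<in>UNIV. \<Sum>r\<in>UNIV. \<Sum>s\<in>UNIV. (E$i$j * ?d i j) * (B$r$s * ?d r s))
    + (\<Sum>i\<in>UNIV. \<Sum>j\<in>UNIV. \<Sum>r\<in>UNIV. \<Sum>s\<in>UNIV. E$i$j * (B$r$s * ?d j s) * ?d i r)
    + (\<Sum>i\<in>UNIV. \<Sum>j\<in>UNIV. \<Sum>r\<in>UNIV. \<Sum>s\<in>UNIV. E$i$j * (B$r$s * ?d i s) * ?d j r))"
    unfolding sum.distrib[symmetric] sum_distrib_left
    by (intro sum.cong refl) (simp add: algebra_simps)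
  also have "(\<Sum>i\<in>UNIV. \<Sum>j\<in>UNIV. \<Sum>r\<in>UNIV. \<Sum>s\<in>UNIV. (E$i$j * ?d i j) * (B$r$s * ?d r s)) = trace E * trace B"
    unfolding sum_distrib_left[symmetric] sum_distrib_right[symmetric] trace_def
    by (simp add: if_distrib cong: if_cong)
  also have "(\<Sum>i\<in>UNIV. \<Sum>j\<in>UNIV. \<Sum>r\<in>UNIV. \<Sum>s\<in>UNIV. E$i$j * (B$r$s * ?d j s) * ?d i r) = E \<bullet> B"
    unfolding inner_vec_def sum_distrib_left[symmetric] sum_distrib_right[symmetric]
    by (simp add: if_distrib cong: if_cong)
  also have "(\<Sum>i\<in>UNIV. \<Sum>j\<in>UNIV. \<Sum>r\<in>UNIV. \<Sum>s\<in>UNIV. E$i$j * (B$r$s * ?d i s) * ?d j r) = E \<bullet> transpose B"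
    unfolding inner_vec_def transpose_def sum_distrib_left[symmetric] sum_distrib_right[symmetric]
    by (simp add: if_distrib cong: if_cong)
  finally show "(LINT z|\<nu>. g (norm z) * ((z \<bullet> (E *v z)) * (z \<bullet> (B *v z)))) =
      ?K * (trace E * trace B + E \<bullet> B + E \<bullet> transpose B)" .
qed

end

section \<open>Loss functions\<close>

lemma C1_on_UNIV_deriv:
  fixes f :: "real \<Rightarrow> real"
  assumes "f C1_differentiable_on UNIV"
  shows "(f has_real_derivative deriv f s) (at s)" "continuous_on UNIV (deriv f)"
proof -
  obtain D where D: "\<And>x. (f has_vector_derivative D x) (at x)" "continuous_on UNIV D"
    using assms unfolding C1_differentiable_on_def by auto
  have d: "(f has_real_derivative D x) (at x)" for x
    using D(1) by (simp add: has_real_derivative_iff_has_vector_derivative)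
  then have "deriv f = D" using DERIV_imp_deriv by blast
  then show "(f has_real_derivative deriv f s) (at s)" "continuous_on UNIV (deriv f)"
    using d D(2) by auto
qed

context
  fixes \<rho> :: "real \<Rightarrow> real"
  assumes loss: "loss_function \<rho>"
begin

lemma loss_has_derivative: "(\<rho> has_real_derivative deriv \<rho> s) (at s)"
  and loss_deriv_continuous: "continuous_on UNIV (deriv \<rho>)"
  and u_continuous: "continuous_on UNIV (u_fun \<rho>)"
  using loss C1_on_UNIV_deriv unfolding loss_function_def by blast+

text \<open>At \<open>0\<close> this says \<open>\<rho>'(0) = 0\<close>, which is forced by continuity of \<open>\<rho>'(s) / s\<close>.\<close>

lemma loss_deriv_eq_u: "deriv \<rho> s = s * u_fun \<rho> s"
proof (cases "s = 0")
  case True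
  have "(u_fun \<rho> \<longlongrightarrow> u_fun \<rho> 0) (at 0)"
    using u_continuous by (simp add: continuous_on_eq_continuous_at isCont_def)
  then have "((\<lambda>t. t * u_fun \<rho> t) \<longlongrightarrow> 0) (at 0)"
    using tendsto_mult[OF tendsto_ident_at, of "u_fun \<rho>" "u_fun \<rho> 0" 0 UNIV] by simp
  moreover have "eventually (\<lambda>t. t * u_fun \<rho> t = deriv \<rho> t) (at 0)"
    by (auto simp: eventually_at_filter u_fun_def)
  ultimately have "(deriv \<rho> \<longlongrightarrow> 0) (at 0)" by (rule Lim_transform_eventually)
  moreover have "(deriv \<rho> \<longlongrightarrow> deriv \<rho> 0) (at 0)"
    using loss_deriv_continuous by (simp add: continuous_on_eq_continuous_at isCont_def)
  ultimately have "deriv \<rho> 0 = 0" using tendsto_unique[OF at_neq_bot] by blast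
  then show ?thesis using True by simp
qed (simp add: u_fun_def)

lemma u_tendsto_0: "((\<lambda>t. deriv \<rho> t / t) \<longlongrightarrow> u_fun \<rho> 0) (at 0)"
proof -
  have "(u_fun \<rho> \<longlongrightarrow> u_fun \<rho> 0) (at 0)"
    using u_continuous by (simp add: continuous_on_eq_continuous_at isCont_def)
  moreover have "eventually (\<lambda>t. u_fun \<rho> t = deriv \<rho> t / t) (at 0)"
    by (auto simp: eventually_at_filter u_fun_def)
  ultimately show ?thesis by (rule Lim_transform_eventually)
qed

lemma loss_cutoff:
  obtains c where "0 < c" "\<And>s. c \<le> s \<Longrightarrow> deriv \<rho> s = 0" "\<And>s. c \<le> s \<Longrightarrow> u_fun \<rho> s = 0"
    "\<And>s. 0 \<le> s \<Longrightarrow> \<rho> s \<le> \<rho> c"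
proof -
  have "\<exists>c>0. mono_on {0..c} \<rho> \<and> (\<forall>s\<ge>c. \<rho> s = \<rho> c)"
    using loss unfolding loss_function_def by (elim conjE)
  then obtain c where c: "0 < c" "mono_on {0..c} \<rho>" "\<forall>s\<ge>c. \<rho> s = \<rho> c"
    by (elim exE conjE)
  have gt: "deriv \<rho> s = 0" if "c < s" for s
  proof -
    have "eventually (\<lambda>t. \<rho> t = \<rho> c) (nhds s)"
      by (rule eventually_mono[OF eventually_nhds_in_open[of "{c<..}" s]]) (use that in \<open>auto intro: c(3)[rule_format]\<close>)
    from DERIV_cong_ev[OF refl this refl, THEN iffD2, OF DERIV_const]
    show ?thesis by (rule DERIV_imp_deriv)
  qed
  have eq0: "deriv \<rho> c = 0"
  proof -
    have "(deriv \<rho> \<longlongrightarrow> deriv \<rho> c) (at_right c)"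
    proof -
      have "(deriv \<rho> \<longlongrightarrow> deriv \<rho> c) (at c)"
        using loss_deriv_continuous by (simp add: continuous_on_eq_continuous_at isCont_def)
      then show ?thesis by (rule tendsto_within_subset) simp
    qed
    moreover have "eventually (\<lambda>t. deriv \<rho> t = 0) (at_right c)"
      using gt by (auto simp: eventually_at_filter)
    then have "(deriv \<rho> \<longlongrightarrow> 0) (at_right c)" by (rule tendsto_eventually)
    ultimately show ?thesis by (rule tendsto_unique[OF trivial_limit_at_right_real])
  qed
  have d0: "deriv \<rho> s = 0" if "c \<le> s" for s using gt eq0 that by (cases "s = c") auto
  show ?thesis
  proof
    show "u_fun \<rho> s = 0" if "c \<le> s" for s using d0[OF that] c(1) that by (simp add: u_fun_def)
    show "\<rho> s \<le> \<rho> c" if "0 \<le> s" for s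
    proof (cases "s \<le> c")
      case True
      then show ?thesis using mono_onD[OF c(2), of s c] c(1) that by simp
    next
      case False
      then show ?thesis using c(3)[rule_format, of s] by linarith
    qed
  qed (use c(1) d0 in auto)
qed

lemma u_bounded: obtains K where "0 < K" "\<And>s. 0 \<le> s \<Longrightarrow> \<bar>u_fun \<rho> s\<bar> \<le> K"
proof -
  obtain c where c: "0 < c" "\<And>s. c \<le> s \<Longrightarrow> u_fun \<rho> s = 0" using loss_cutoff by metis
  have "compact (u_fun \<rho> ` {0..c})"
    by (intro compact_continuous_image continuous_on_subset[OF u_continuous]) auto
  then obtain B where B: "\<And>s. s \<in> {0..c} \<Longrightarrow> \<bar>u_fun \<rho> s\<bar> \<le> B"
    using compact_imp_bounded bounded_iff by (metis imageI real_norm_def)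
  show ?thesis
  proof (rule that[of "\<bar>B\<bar> + 1"])
    show "\<bar>u_fun \<rho> s\<bar> \<le> \<bar>B\<bar> + 1" if "0 \<le> s" for s
      using B[of s] c(2)[of s] that by (cases "s \<le> c") auto
  qed auto
qed

text \<open>At \<open>q = 0\<close>, where the square root is not differentiable, the function
\<open>F s = \<rho> s - \<rho> 0 - u 0 s\<^sup>2 / 2\<close> has the derivative \<open>s (u s - u 0)\<close>, and the mean value theorem gives
\<open>F s = o(s\<^sup>2)\<close>. The derivative is one-sided there; this is enough since quadratic forms are nonnegative.\<close>

lemma loss_sqrt_has_derivative:
  assumes "0 \<le> q"
  shows "((\<lambda>q. \<rho> (sqrt q)) has_real_derivative u_fun \<rho> (sqrt q) / 2) (at q within {0..})"
proof (cases "q = 0")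
  case False
  then have q: "0 < q" using assms by simp
  have "((\<lambda>q. \<rho> (sqrt q)) has_real_derivative deriv \<rho> (sqrt q) * (inverse (sqrt q) / 2)) (at q)"
    by (rule DERIV_chain2[OF loss_has_derivative DERIV_real_sqrt[OF q]])
  moreover have "deriv \<rho> (sqrt q) * (inverse (sqrt q) / 2) = u_fun \<rho> (sqrt q) / 2"
    using q by (simp add: loss_deriv_eq_u)
  ultimately have "((\<lambda>q. \<rho> (sqrt q)) has_real_derivative u_fun \<rho> (sqrt q) / 2) (at q)" by simp
  then show ?thesis by (rule has_field_derivative_at_within)
next
  case True
  have "((\<lambda>y. (\<rho> (sqrt y) - \<rho> 0) / y) \<longlongrightarrow> u_fun \<rho> 0 / 2) (at 0 within {0..})"
  proof (rule tendstoI)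
    fix e :: real assume e: "0 < e"
    have "isCont (u_fun \<rho>) 0" using u_continuous by (simp add: continuous_on_eq_continuous_at)
    from this[unfolded continuous_at_eps_delta, rule_format, OF half_gt_zero[OF e]]
    obtain d where d0: "0 < d" "\<And>s. dist s 0 < d \<Longrightarrow> dist (u_fun \<rho> s) (u_fun \<rho> 0) < e / 2"
      by blast
    then have d: "0 < d" "\<And>s. \<bar>s\<bar> < d \<Longrightarrow> \<bar>u_fun \<rho> s - u_fun \<rho> 0\<bar> < e / 2"
      by (simp_all add: dist_real_def)
    have "dist ((\<rho> (sqrt y) - \<rho> 0) / y) (u_fun \<rho> 0 / 2) < e" if y: "0 < y" "y < d^2" for y
    proof -
      define s where "s = sqrt y"
      have s: "0 < s" "s < d" "y = s^2" using y d(1) by (auto simp: s_def real_less_lsqrt)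
      define F where "F = (\<lambda>t. \<rho> t - \<rho> 0 - u_fun \<rho> 0 * t^2 / 2)"
      have dF: "(F has_real_derivative (t * (u_fun \<rho> t - u_fun \<rho> 0))) (at t)" for t
      proof -
        have "(F has_real_derivative (deriv \<rho> t - 0 - u_fun \<rho> 0 * (2 * t) / 2)) (at t)"
          unfolding F_def
          by (intro DERIV_diff DERIV_const loss_has_derivative DERIV_cdivide DERIV_cmult)
            (use DERIV_pow[of 2 t UNIV] in simp)
        then show ?thesis by (simp add: loss_deriv_eq_u algebra_simps)
      qed
      have "\<exists>x>0. x < s \<and> F s - F 0 = (s - 0) * (x * (u_fun \<rho> x - u_fun \<rho> 0))"
        by (rule MVT2[OF s(1) dF])
      then obtain x where x: "0 < x" "x < s" "F s - F 0 = (s - 0) * (x * (u_fun \<rho> x - u_fun \<rho> 0))"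
        by (elim exE conjE)
      have "\<bar>F s\<bar> = s * (x * \<bar>u_fun \<rho> x - u_fun \<rho> 0\<bar>)"
        using x s(1) by (simp add: F_def abs_mult)
      also have "\<dots> \<le> s * (s * (e / 2))"
        using x s d(2)[of x] by (intro mult_left_mono mult_mono) auto
      also have "\<dots> = y * (e / 2)" by (simp add: s(3) power2_eq_square)
      finally have le: "\<bar>F s / y\<bar> \<le> e / 2" using y(1) by (simp add: abs_divide divide_le_eq mult.commute)
      have "F s / y = (\<rho> s - \<rho> 0) / y - u_fun \<rho> 0 * s^2 / 2 / y"
        by (simp add: F_def diff_divide_distrib)
      also have "s^2 = y" using s(3) by (rule sym)
      finally have "(\<rho> (sqrt y) - \<rho> 0) / y - u_fun \<rho> 0 / 2 = F s / y"
        using y(1) by (simp add: s_def)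
      then show ?thesis using le e unfolding dist_real_def by linarith
    qed
    then show "eventually (\<lambda>y. dist ((\<rho> (sqrt y) - \<rho> 0) / y) (u_fun \<rho> 0 / 2) < e) (at 0 within {0..})"
      unfolding eventually_at using d(1) by (intro exI[of _ "d^2"]) (auto simp: dist_real_def)
  qed
  then show ?thesis unfolding True has_field_derivative_iff by simp
qed

lemma loss_borel_measurable [measurable]: "\<rho> \<in> borel_measurable borel"
  and u_borel_measurable [measurable]: "u_fun \<rho> \<in> borel_measurable borel"
  and loss_deriv_borel_measurable [measurable]: "deriv \<rho> \<in> borel_measurable borel"
  using loss_has_derivative u_continuous loss_deriv_continuous
  by (auto intro!: borel_measurable_continuous_onI continuous_at_imp_continuous_on DERIV_isCont)

end

text \<open>For \<open>s \<noteq> 0\<close> this is \<open>s u'(s)\<close>. In this form it is continuous up to \<open>s = 0\<close>, where \<open>u\<close> itself need not be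
differentiable.\<close>

definition tau_fun :: "(real \<Rightarrow> real) \<Rightarrow> real \<Rightarrow> real" where
  "tau_fun \<rho> s = deriv (deriv \<rho>) s - u_fun \<rho> s"

context
  fixes \<rho> :: "real \<Rightarrow> real"
  assumes loss: "loss_function \<rho>" and C2: "deriv \<rho> C1_differentiable_on UNIV"
begin

lemma tau_continuous: "continuous_on UNIV (tau_fun \<rho>)"
  unfolding tau_fun_def[abs_def]
  by (intro continuous_intros C1_on_UNIV_deriv(2)[OF C2] u_continuous[OF loss])

lemma tau_borel_measurable [measurable]: "tau_fun \<rho> \<in> borel_measurable borel"
  using tau_continuous by (rule borel_measurable_continuous_onI)

lemma tau_0: "tau_fun \<rho> 0 = 0"
proof -
  have "((\<lambda>t. (deriv \<rho> t - deriv \<rho> 0) / (t - 0)) \<longlongrightarrow> deriv (deriv \<rho>) 0) (at 0)"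
    using C1_on_UNIV_deriv(1)[OF C2, of 0] unfolding has_field_derivative_iff .
  then have "deriv (deriv \<rho>) 0 = u_fun \<rho> 0"
    using tendsto_unique[OF at_neq_bot _ u_tendsto_0[OF loss]] by (simp add: loss_deriv_eq_u[OF loss, of 0])
  then show ?thesis by (simp add: tau_fun_def)
qed

lemma tau_cutoff:
  obtains c where "0 < c" "\<And>s. c \<le> s \<Longrightarrow> u_fun \<rho> s = 0" "\<And>s. c \<le> s \<Longrightarrow> tau_fun \<rho> s = 0"
proof -
  obtain c where c: "0 < c" "\<And>s. c \<le> s \<Longrightarrow> deriv \<rho> s = 0" "\<And>s. c \<le> s \<Longrightarrow> u_fun \<rho> s = 0"
    using loss_cutoff[OF loss] by metis
  have "deriv (deriv \<rho>) s = 0" if "c < s" for s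
  proof -
    have "eventually (\<lambda>t. deriv \<rho> t = 0) (nhds s)"
      by (rule eventually_mono[OF eventually_nhds_in_open[of "{c<..}" s]]) (use that c(2) in auto)
    from DERIV_cong_ev[OF refl this refl, THEN iffD2, OF DERIV_const]
    show ?thesis by (rule DERIV_imp_deriv)
  qed
  then have t: "tau_fun \<rho> s = 0" if "c < s" for s using that c(3) by (simp add: tau_fun_def)
  show ?thesis
  \<comment> \<open>At \<open>c\<close> the function \<open>\<rho>'\<close> is known to be constant on the right only, so the cutoff is moved.\<close>
  proof (rule that[of "c + 1"])
  qed (use c t in auto)
qed

lemma tau_bounded: obtains K where "0 < K" "\<And>s. 0 \<le> s \<Longrightarrow> \<bar>tau_fun \<rho> s\<bar> \<le> K"
proof -
  obtain c where c: "0 < c" "\<And>s. c \<le> s \<Longrightarrow> tau_fun \<rho> s = 0" using tau_cutoff by metis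
  have "compact (tau_fun \<rho> ` {0..c})"
    by (intro compact_continuous_image continuous_on_subset[OF tau_continuous]) auto
  then obtain B where B: "\<And>s. s \<in> {0..c} \<Longrightarrow> \<bar>tau_fun \<rho> s\<bar> \<le> B"
    using compact_imp_bounded bounded_iff by (metis imageI real_norm_def)
  show ?thesis
  proof (rule that[of "\<bar>B\<bar> + 1"])
    show "\<bar>tau_fun \<rho> s\<bar> \<le> \<bar>B\<bar> + 1" if "0 \<le> s" for s
      using B[of s] c(2)[of s] that by (cases "s \<le> c") auto
  qed auto
qed

lemma u_sqrt_has_derivative:
  assumes "0 < q"
  shows "((\<lambda>q. u_fun \<rho> (sqrt q)) has_real_derivative tau_fun \<rho> (sqrt q) / (2 * q)) (at q)"
proof -
  have s: "0 < sqrt q" using assms by simp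
  have "((\<lambda>q. deriv \<rho> (sqrt q) / sqrt q) has_real_derivative
      (deriv (deriv \<rho>) (sqrt q) * (inverse (sqrt q) / 2) * sqrt q - deriv \<rho> (sqrt q) * (inverse (sqrt q) / 2)) / (sqrt q * sqrt q)) (at q)"
    by (rule DERIV_divide[OF DERIV_chain2[OF C1_on_UNIV_deriv(1)[OF C2] DERIV_real_sqrt[OF assms]] DERIV_real_sqrt[OF assms]])
      (use s in simp)
  moreover have "eventually (\<lambda>t. deriv \<rho> (sqrt t) / sqrt t = u_fun \<rho> (sqrt t)) (nhds q)"
    by (rule eventually_mono[OF eventually_nhds_in_open[of "{0<..}" q]]) (use assms in \<open>auto simp: u_fun_def\<close>)
  ultimately have "((\<lambda>q. u_fun \<rho> (sqrt q)) has_real_derivative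
      (deriv (deriv \<rho>) (sqrt q) * (inverse (sqrt q) / 2) * sqrt q - deriv \<rho> (sqrt q) * (inverse (sqrt q) / 2)) / (sqrt q * sqrt q)) (at q)"
    by (subst (asm) DERIV_cong_ev[OF refl _ refl])
  moreover have "(deriv (deriv \<rho>) (sqrt q) * (inverse (sqrt q) / 2) * sqrt q - deriv \<rho> (sqrt q) * (inverse (sqrt q) / 2)) / (sqrt q * sqrt q)
    = tau_fun \<rho> (sqrt q) / (2 * q)"
    using assms by (simp add: tau_fun_def loss_deriv_eq_u[OF loss] field_simps)
  ultimately show ?thesis by simp
qed

end

section \<open>Differentiation of residual functions and of their integrals\<close>

text \<open>Dominated convergence applied to the difference quotients: the mean value inequality on the convex
set \<open>U\<close> and the bound on \<open>f'\<close> at \<open>x0\<close> dominate the normalised remainder by \<open>2 K\<close>.\<close>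

lemma has_derivative_integral:
  fixes f :: "'a::euclidean_space \<Rightarrow> 's \<Rightarrow> 'b::{banach,second_countable_topology}"
  assumes U: "open U" "convex U" "x0 \<in> U"
    and meas[measurable]: "\<And>x. f x \<in> borel_measurable M"
    and int: "integrable M (f x0)"
    and der: "\<And>x s. x \<in> U \<Longrightarrow> s \<in> space M \<Longrightarrow> ((\<lambda>x. f x s) has_derivative f' x s) (at x)"
    and meas'[measurable]: "\<And>v. (\<lambda>s. f' x0 s v) \<in> borel_measurable M"
    and bound: "\<And>x s v. x \<in> U \<Longrightarrow> s \<in> space M \<Longrightarrow> norm (f' x s v) \<le> K s * norm v"
    and K: "integrable M K"
  shows "((\<lambda>x. \<integral>s. f x s \<partial>M) has_derivative (\<lambda>v. \<integral>s. f' x0 s v \<partial>M)) (at x0)"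
    and "integrable M (\<lambda>s. f' x0 s v)"
    and "x \<in> U \<Longrightarrow> integrable M (f x)"
proof -
  have lin: "bounded_linear (f' x0 s)" if "s \<in> space M" for s
    using der[OF U(3) that] by (rule has_derivative_bounded_linear)
  have Lip: "norm (f x s - f x0 s) \<le> K s * norm (x - x0)" if "x \<in> U" "s \<in> space M" for x s
    using that U(3)
    by (intro differentiable_bound[OF U(2) has_derivative_at_withinI[OF der] onorm_le[OF bound]]) auto
  have I': "integrable M (\<lambda>s. f' x0 s v)" for v
    by (rule Bochner_Integration.integrable_bound[OF integrable_mult_left[OF K, of "norm v"]])
      (use bound[OF U(3)] in \<open>auto intro!: AE_I2 intro: order_trans[OF _ abs_ge_self]\<close>)
  then show "integrable M (\<lambda>s. f' x0 s v)" .
  have Id: "integrable M (\<lambda>s. f x s - f x0 s)" if "x \<in> U" for x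
    by (rule Bochner_Integration.integrable_bound[OF integrable_mult_left[OF K, of "norm (x - x0)"]])
      (use Lip that in \<open>auto intro!: AE_I2 intro: order_trans[OF _ abs_ge_self]\<close>)
  have If: "integrable M (f x)" if "x \<in> U" for x
    using Bochner_Integration.integrable_add[OF Id[OF that] int] by simp
  then show "x \<in> U \<Longrightarrow> integrable M (f x)" .
  define g where "g = (\<lambda>y s. norm (f y s - f x0 s - f' x0 s (y - x0)) / norm (y - x0))"
  have conv: "((\<lambda>y. \<integral>s. g y s \<partial>M) \<longlongrightarrow> 0) (at x0 within U)"
    unfolding tendsto_at_iff_sequentially
  proof (intro allI impI)
    fix X :: "nat \<Rightarrow> 'a" assume X: "\<forall>i. X i \<in> U - {x0}" "X \<longlonglongrightarrow> x0"
    have "(\<lambda>i. \<integral>s. g (X i) s \<partial>M) \<longlonglongrightarrow> (\<integral>s. 0 \<partial>M)"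
    proof (rule integral_dominated_convergence[where w = "\<lambda>s. 2 * K s"])
      show "(\<lambda>s. g (X i) s) \<in> borel_measurable M" for i unfolding g_def by measurable
      show "integrable M (\<lambda>s. 2 * K s)" using K by simp
      show "AE s in M. (\<lambda>i. g (X i) s) \<longlonglongrightarrow> 0"
      proof (rule AE_I2)
        fix s assume s: "s \<in> space M"
        have "((\<lambda>y. g y s) \<longlongrightarrow> 0) (at x0)"
          using der[OF U(3) s] unfolding has_derivative_iff_norm g_def by blast
        then have "((\<lambda>y. g y s) \<longlongrightarrow> 0) (at x0 within U)" by (rule tendsto_within_subset) simp
        then show "(\<lambda>i. g (X i) s) \<longlonglongrightarrow> 0"
          using X unfolding tendsto_at_iff_sequentially comp_def by blast
      qed
      show "AE s in M. norm (g (X i) s) \<le> 2 * K s" for i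
      proof (rule AE_I2)
        fix s assume s: "s \<in> space M"
        have pos: "0 < norm (X i - x0)" "X i \<in> U" using X(1) by auto
        have "norm (f (X i) s - f x0 s - f' x0 s (X i - x0)) \<le> K s * norm (X i - x0) + K s * norm (X i - x0)"
          using Lip[OF pos(2) s] bound[OF U(3) s, of "X i - x0"] by (meson add_mono norm_triangle_ineq4 order_trans)
        then show "norm (g (X i) s) \<le> 2 * K s" using pos(1) by (simp add: g_def divide_le_eq)
      qed
    qed simp
    then show "((\<lambda>y. \<integral>s. g y s \<partial>M) \<circ> X) \<longlonglongrightarrow> 0" by (simp add: comp_def)
  qed
  have le: "norm (integral\<^sup>L M (f y) - integral\<^sup>L M (f x0) - (\<integral>s. f' x0 s (y - x0) \<partial>M)) / norm (y - x0) \<le> (\<integral>s. g y s \<partial>M)"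
    if "y \<in> U" for y
  proof -
    have "norm (integral\<^sup>L M (f y) - integral\<^sup>L M (f x0) - (\<integral>s. f' x0 s (y - x0) \<partial>M)) = norm (\<integral>s. f y s - f x0 s - f' x0 s (y - x0) \<partial>M)"
      using If[OF that] int I' by simp
    also have "\<dots> \<le> (\<integral>s. norm (f y s - f x0 s - f' x0 s (y - x0)) \<partial>M)"
      by (rule integral_norm_bound)
    finally show ?thesis unfolding g_def by (simp add: divide_right_mono)
  qed
  have "((\<lambda>y. norm (integral\<^sup>L M (f y) - integral\<^sup>L M (f x0) - (\<integral>s. f' x0 s (y - x0) \<partial>M)) / norm (y - x0)) \<longlongrightarrow> 0) (at x0 within U)"
  proof (rule tendsto_sandwich[OF _ _ tendsto_const conv])
    show "\<forall>\<^sub>F y in at x0 within U. norm (integral\<^sup>L M (f y) - integral\<^sup>L M (f x0) - (\<integral>s. f' x0 s (y - x0) \<partial>M)) / norm (y - x0) \<le> (\<integral>s. g y s \<partial>M)"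
      unfolding eventually_at_filter using le by (intro always_eventually) auto
  qed (simp add: always_eventually)
  moreover have "bounded_linear (\<lambda>v. \<integral>s. f' x0 s v \<partial>M)"
  proof (rule bounded_linear_intro)
    show "(\<integral>s. f' x0 s (v + w) \<partial>M) = (\<integral>s. f' x0 s v \<partial>M) + (\<integral>s. f' x0 s w \<partial>M)" for v w
      unfolding Bochner_Integration.integral_add[OF I' I', symmetric]
      using lin by (intro Bochner_Integration.integral_cong refl) (simp add: linear_add bounded_linear.linear)
    show "(\<integral>s. f' x0 s (r *\<^sub>R v) \<partial>M) = r *\<^sub>R (\<integral>s. f' x0 s v \<partial>M)" for r v
      unfolding integral_scaleR_right[symmetric]
      using lin by (intro Bochner_Integration.integral_cong refl) (simp add: linear_scale bounded_linear.linear)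
    show "norm (\<integral>s. f' x0 s v \<partial>M) \<le> norm v * (\<integral>s. K s \<partial>M)" for v
    proof -
      have "norm (\<integral>s. f' x0 s v \<partial>M) \<le> (\<integral>s. K s * norm v \<partial>M)"
        by (rule order_trans[OF integral_norm_bound integral_mono])
          (use I' K bound[OF U(3)] in auto)
      then show ?thesis by (simp add: mult.commute)
    qed
  qed
  ultimately have "((\<lambda>x. \<integral>s. f x s \<partial>M) has_derivative (\<lambda>v. \<integral>s. f' x0 s v \<partial>M)) (at x0 within U)"
    unfolding has_derivative_iff_norm by blast
  then show "((\<lambda>x. \<integral>s. f x s \<partial>M) has_derivative (\<lambda>v. \<integral>s. f' x0 s v \<partial>M)) (at x0)"
    using at_within_open[OF U(3,1)] by simp
qed

text \<open>A pair \<open>(\<beta>, A)\<close> where \<open>A\<close> stands for \<open>C\<^sup>-\<^sup>1 / \<sigma>\<^sup>2\<close>: the argument of the loss is then the root of the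
single quadratic form \<open>qf\<close>, in which scale and shape enter jointly.\<close>

type_synonym ('k, 'q) par = "(real^'q) \<times> (real^'k^'k)"

definition res :: "('k::finite, 'q::finite) par \<Rightarrow> ('k, 'q) obs \<Rightarrow> real^'k" where
  "res p s = fst s - snd s *v fst p"

definition qf :: "('k::finite, 'q::finite) par \<Rightarrow> ('k, 'q) obs \<Rightarrow> real" where
  "qf p s = res p s \<bullet> (snd p *v res p s)"

definition dqf :: "('k::finite, 'q::finite) par \<Rightarrow> ('k, 'q) obs \<Rightarrow> ('k, 'q) par \<Rightarrow> real" where
  "dqf p s v = res p s \<bullet> (snd v *v res p s)
     - (snd s *v fst v) \<bullet> (snd p *v res p s) - res p s \<bullet> (snd p *v (snd s *v fst v))"

text \<open>The weighted residual \<open>u r\<close>: the regression equation integrates \<open>X\<^sup>T A (u r)\<close>, the scatter equation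
\<open>(u r) r\<^sup>T\<close>.\<close>

definition wres :: "(real \<Rightarrow> real) \<Rightarrow> ('k::finite, 'q::finite) par \<Rightarrow> ('k, 'q) obs \<Rightarrow> real^'k" where
  "wres \<rho> p s = u_fun \<rho> (sqrt (qf p s)) *\<^sub>R res p s"

text \<open>At a zero residual \<open>qf p s = 0\<close>, and the first summand is zero whatever the quotient means; this is the
correct derivative there.\<close>

definition dwres :: "(real \<Rightarrow> real) \<Rightarrow> ('k::finite, 'q::finite) par \<Rightarrow> ('k, 'q) obs \<Rightarrow> ('k, 'q) par \<Rightarrow> real^'k" where
  "dwres \<rho> p s v = (tau_fun \<rho> (sqrt (qf p s)) / (2 * qf p s) * dqf p s v) *\<^sub>R res p s
     - u_fun \<rho> (sqrt (qf p s)) *\<^sub>R (snd s *v fst v)"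

definition coercive :: "real \<Rightarrow> real^'k^'k \<Rightarrow> bool" where
  "coercive l A \<longleftrightarrow> (\<forall>x. l * (norm x)^2 \<le> x \<bullet> (A *v x))"

lemma coercive_perturb:
  assumes "coercive l A" "norm (B - A) \<le> d"
  shows "coercive (l - d) B"
  unfolding coercive_def
proof
  fix x :: "real^'a"
  have "\<bar>x \<bullet> ((B - A) *v x)\<bar> \<le> norm x * (norm (B - A) * norm x)"
    by (intro order_trans[OF Cauchy_Schwarz_ineq2] mult_left_mono norm_matrix_vector_le) simp
  also have "\<dots> \<le> norm x * (d * norm x)"
    using assms(2) by (intro mult_left_mono mult_right_mono) auto
  finally have "\<bar>x \<bullet> (B *v x) - x \<bullet> (A *v x)\<bar> \<le> d * (norm x)^2"
    by (simp add: matrix_vector_mult_diff_rdistrib inner_diff_right power2_eq_square mult_ac)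
  moreover have "l * (norm x)^2 \<le> x \<bullet> (A *v x)" using assms(1) by (simp add: coercive_def)
  ultimately show "(l - d) * (norm x)^2 \<le> x \<bullet> (B *v x)" by (simp add: algebra_simps)
qed

lemma res_has_derivative: "((\<lambda>p. res p s) has_derivative (\<lambda>v. - (snd s *v fst v))) (at p)"
  unfolding res_def
  by (rule derivative_eq_intros bounded_linear.has_derivative[OF matrix_vector_mul_bounded_linear] refl)+ simp

lemma qf_has_derivative: "((\<lambda>p. qf p s) has_derivative dqf p s) (at p)"
proof -
  have "((\<lambda>p. qf p s) has_derivative (\<lambda>v. res p s \<bullet> (snd p *v - (snd s *v fst v) + snd v *v res p s)
     + - (snd s *v fst v) \<bullet> (snd p *v res p s))) (at p)"
    unfolding qf_def
    by (intro has_derivative_inner res_has_derivative bounded_bilinear.FDERIV[OF bounded_bilinear_matrix_vector]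
       has_derivative_snd[OF has_derivative_ident])
  moreover have "(\<lambda>v. res p s \<bullet> (snd p *v - (snd s *v fst v) + snd v *v res p s)
     + - (snd s *v fst v) \<bullet> (snd p *v res p s)) = dqf p s"
    by (simp add: fun_eq_iff dqf_def inner_add_right inner_diff_right bounded_bilinear.minus_right[OF bounded_bilinear_matrix_vector])
  ultimately show ?thesis by simp
qed

lemma norm_fst_bound: "norm (fst v) \<le> norm v" and norm_snd_bound: "norm (snd v) \<le> norm v"
  using norm_fst_le[of "fst v" "snd v"] norm_snd_le[of "snd v" "fst v"] by simp_all

lemma dqf_bound:
  assumes "norm (snd p) \<le> a" 
  shows "\<bar>dqf p s v\<bar> \<le> (norm (res p s)^2 + 2 * a * norm (res p s) * norm (snd s)) * norm v"
proof -
  let ?r = "norm (res p s)" and ?X = "norm (snd s)"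
  have v: "norm (fst v) \<le> norm v" "norm (snd v) \<le> norm v" by (rule norm_fst_bound norm_snd_bound)+
  have a: "0 \<le> a" using assms norm_ge_zero order_trans by blast
  have X: "norm (snd s *v fst v) \<le> ?X * norm v"
    by (rule order_trans[OF norm_matrix_vector_le mult_left_mono[OF v(1)]]) simp
  have Ar: "norm (snd p *v res p s) \<le> a * ?r"
    by (rule order_trans[OF norm_matrix_vector_le mult_right_mono[OF assms]]) simp
  have AX: "norm (snd p *v (snd s *v fst v)) \<le> a * (?X * norm v)"
    by (rule order_trans[OF norm_matrix_vector_le mult_mono[OF assms X]]) (use a in auto)
  have dr: "norm (snd v *v res p s) \<le> norm v * ?r"
    by (rule order_trans[OF norm_matrix_vector_le mult_right_mono[OF v(2)]]) simp
  have "\<bar>res p s \<bullet> (snd v *v res p s)\<bar> \<le> ?r * (norm v * ?r)"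
    by (rule order_trans[OF Cauchy_Schwarz_ineq2 mult_left_mono[OF dr]]) simp
  moreover have "\<bar>(snd s *v fst v) \<bullet> (snd p *v res p s)\<bar> \<le> (?X * norm v) * (a * ?r)"
    by (rule order_trans[OF Cauchy_Schwarz_ineq2 mult_mono[OF X Ar]]) auto
  moreover have "\<bar>res p s \<bullet> (snd p *v (snd s *v fst v))\<bar> \<le> ?r * (a * (?X * norm v))"
    by (rule order_trans[OF Cauchy_Schwarz_ineq2 mult_left_mono[OF AX]]) simp
  ultimately have "\<bar>dqf p s v\<bar> \<le> ?r * (norm v * ?r) + (?X * norm v) * (a * ?r) + ?r * (a * (?X * norm v))"
    unfolding dqf_def by linarith
  then show ?thesis by (simp add: algebra_simps power2_eq_square)
qed

text \<open>Near \<open>p\<close> the quadratic form stays nonnegative, so the one-sided derivative of \<open>\<rho> \<circ> sqrt\<close> suffices.\<close>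

lemma loss_qf_has_derivative:
  assumes \<rho>: "loss_function \<rho>" and l: "0 < l" "coercive l (snd p)"
  shows "((\<lambda>p. \<rho> (sqrt (qf p s))) has_derivative (\<lambda>v. u_fun \<rho> (sqrt (qf p s)) / 2 * dqf p s v)) (at p)"
proof -
  let ?U = "UNIV \<times> ball (snd p) l"
  have pU: "p \<in> ?U" using l(1) by (simp add: mem_Times_iff)
  have nn: "0 \<le> qf p' s" if "p' \<in> ?U" for p'
  proof -
    have "coercive (l - norm (snd p' - snd p)) (snd p')"
      by (rule coercive_perturb[OF l(2)]) simp
    moreover have "norm (snd p' - snd p) < l" using that by (auto simp: dist_norm norm_minus_commute)
    ultimately show ?thesis
      unfolding coercive_def qf_def by (meson diff_ge_0_iff_ge less_imp_le mult_nonneg_nonneg order_trans zero_le_power2)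
  qed
  have "((\<lambda>q. \<rho> (sqrt q)) has_derivative (\<lambda>h. u_fun \<rho> (sqrt (qf p s)) / 2 * h)) (at (qf p s) within (\<lambda>p. qf p s) ` ?U)"
    by (rule has_derivative_subset[OF loss_sqrt_has_derivative[OF \<rho> nn[OF pU], unfolded has_field_derivative_def]])
      (use nn in auto)
  then have "((\<lambda>p. \<rho> (sqrt (qf p s))) has_derivative (\<lambda>v. u_fun \<rho> (sqrt (qf p s)) / 2 * dqf p s v)) (at p within ?U)"
    by (rule has_derivative_in_compose[OF has_derivative_at_withinI[OF qf_has_derivative]])
  moreover have "open ?U" by (intro open_Times) auto
  ultimately show ?thesis using at_within_open[OF pU \<open>open ?U\<close>] by metis
qed

text \<open>Product rule at a zero of the second factor, where continuity of the first factor replaces its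
differentiability. It serves at zero residuals, where \<open>u \<circ> sqrt\<close> need not be differentiable.\<close>

lemma has_derivative_scaleR_zero:
  fixes g :: "'a::real_normed_vector \<Rightarrow> 'b::real_normed_vector"
  assumes f: "isCont f x" and g: "(g has_derivative g') (at x)" and g0: "g x = 0"
  shows "((\<lambda>y. f y *\<^sub>R g y) has_derivative (\<lambda>v. f x *\<^sub>R g' v)) (at x)"
proof -
  define e where "e = (\<lambda>y. (1 / norm (y - x)) *\<^sub>R (g y - (g x + g' (y - x))))"
  have bl: "bounded_linear g'" using g by (rule has_derivative_bounded_linear)
  then obtain K where K: "\<And>v. norm (g' v) \<le> norm v * K" by (auto simp: bounded_linear_axioms_def bounded_linear_def)
  have "(e \<longlongrightarrow> 0) (at x)" using g unfolding has_derivative_within e_def by blast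
  then have 1: "((\<lambda>y. f y *\<^sub>R e y) \<longlongrightarrow> f x *\<^sub>R 0) (at x)"
    using f unfolding isCont_def by (intro tendsto_scaleR)
  have 2: "((\<lambda>y. (f y - f x) *\<^sub>R ((1 / norm (y - x)) *\<^sub>R g' (y - x))) \<longlongrightarrow> 0) (at x)"
  proof (rule Lim_null_comparison)
    show "\<forall>\<^sub>F y in at x. norm ((f y - f x) *\<^sub>R ((1 / norm (y - x)) *\<^sub>R g' (y - x))) \<le> \<bar>f y - f x\<bar> * \<bar>K\<bar>"
      unfolding eventually_at_filter
    proof (intro always_eventually allI impI)
      fix y assume "y \<noteq> x"
      have "norm (g' (y - x)) \<le> norm (y - x) * \<bar>K\<bar>"
        by (rule order_trans[OF K]) (simp add: mult_left_mono)
      then have "norm ((1 / norm (y - x)) *\<^sub>R g' (y - x)) \<le> \<bar>K\<bar>"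
        using \<open>y \<noteq> x\<close> by (simp add: divide_le_eq mult.commute)
      then show "norm ((f y - f x) *\<^sub>R ((1 / norm (y - x)) *\<^sub>R g' (y - x))) \<le> \<bar>f y - f x\<bar> * \<bar>K\<bar>"
        unfolding norm_scaleR[of "f y - f x"] by (rule mult_left_mono) simp
    qed
    show "((\<lambda>y. \<bar>f y - f x\<bar> * \<bar>K\<bar>) \<longlongrightarrow> 0) (at x)"
      using f unfolding isCont_def by (auto intro!: tendsto_eq_intros)
  qed
  have "f y *\<^sub>R e y + (f y - f x) *\<^sub>R ((1 / norm (y - x)) *\<^sub>R g' (y - x))
    = (1 / norm (y - x)) *\<^sub>R (f y *\<^sub>R g y - (f x *\<^sub>R g x + f x *\<^sub>R g' (y - x)))" for y
    by (simp add: e_def g0 scaleR_diff_right scaleR_diff_left diff_divide_distrib)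
  then have "((\<lambda>y. (1 / norm (y - x)) *\<^sub>R (f y *\<^sub>R g y - (f x *\<^sub>R g x + f x *\<^sub>R g' (y - x)))) \<longlongrightarrow> 0) (at x)"
    using tendsto_add[OF 1 2] by simp
  then show ?thesis
    unfolding has_derivative_within using bounded_linear_const_scaleR[OF bl] by blast
qed

lemma wres_has_derivative:
  assumes \<rho>: "loss_function \<rho>" "deriv \<rho> C1_differentiable_on UNIV" and l: "0 < l" "coercive l (snd p)"
  shows "((\<lambda>p. wres \<rho> p s) has_derivative dwres \<rho> p s) (at p)"
proof (cases "res p s = 0")
  case True
  have "isCont (\<lambda>p. u_fun \<rho> (sqrt (qf p s))) p"
    using u_continuous[OF \<rho>(1)]
    by (intro isCont_o2[OF isCont_o2[OF has_derivative_continuous[OF qf_has_derivative] isCont_real_sqrt]])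
      (simp add: continuous_on_eq_continuous_at)
  from has_derivative_scaleR_zero[OF this res_has_derivative True] show ?thesis
    unfolding wres_def dwres_def[abs_def] using True by simp
next
  case False
  have "0 < l * norm (res p s)^2" using l(1) False by simp
  then have q: "0 < qf p s" using l(2) unfolding coercive_def qf_def by (metis less_le_trans)
  have d: "((\<lambda>p. u_fun \<rho> (sqrt (qf p s))) has_derivative (\<lambda>v. tau_fun \<rho> (sqrt (qf p s)) / (2 * qf p s) * dqf p s v)) (at p)"
    by (rule has_derivative_compose[OF qf_has_derivative u_sqrt_has_derivative[OF \<rho> q, unfolded has_field_derivative_def]])
  have "((\<lambda>p. wres \<rho> p s) has_derivative (\<lambda>v. u_fun \<rho> (sqrt (qf p s)) *\<^sub>R (- (snd s *v fst v))
     + (tau_fun \<rho> (sqrt (qf p s)) / (2 * qf p s) * dqf p s v) *\<^sub>R res p s)) (at p)"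
    unfolding wres_def by (rule has_derivative_scaleR[OF d res_has_derivative])
  moreover have "(\<lambda>v. u_fun \<rho> (sqrt (qf p s)) *\<^sub>R (- (snd s *v fst v))
     + (tau_fun \<rho> (sqrt (qf p s)) / (2 * qf p s) * dqf p s v) *\<^sub>R res p s) = dwres \<rho> p s"
    by (simp add: fun_eq_iff dwres_def)
  ultimately show ?thesis by simp
qed

lemma res_bound_if_small:
  assumes "0 < l" "coercive l (snd p)" "sqrt (qf p s) < c"
  shows "norm (res p s) \<le> c / sqrt l" "0 \<le> qf p s"
proof -
  have le: "l * norm (res p s)^2 \<le> qf p s" using assms(2) by (simp add: coercive_def qf_def)
  then show nn: "0 \<le> qf p s" using assms(1) by (meson less_imp_le mult_nonneg_nonneg order_trans zero_le_power2)
  have "sqrt l * norm (res p s) \<le> sqrt (qf p s)"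
    using real_sqrt_le_mono[OF le] by (simp add: real_sqrt_mult)
  then show "norm (res p s) \<le> c / sqrt l"
    using assms(1,3) by (simp add: le_divide_eq mult.commute)
qed

text \<open>Where \<open>u\<close> does not vanish the quadratic form is bounded, hence so is the residual by coercivity. Only the
design matrix is left as an unbounded factor; the constant is uniform over parameters near a given one.\<close>

lemma loss_qf_derivative_bound:
  assumes \<rho>: "loss_function \<rho>" and l: "0 < l"
  obtains C where "\<And>(p :: ('k::finite, 'q::finite) par) s v. coercive l (snd p) \<Longrightarrow> norm (snd p) \<le> a \<Longrightarrow>
    \<bar>u_fun \<rho> (sqrt (qf p s)) / 2 * dqf p s v\<bar> \<le> C * (1 + norm (snd s))^2 * norm v"
proof -
  obtain c where c: "0 < c" "\<And>s. c \<le> s \<Longrightarrow> u_fun \<rho> s = 0" using loss_cutoff[OF \<rho>] by metis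
  obtain K where K: "0 < K" "\<And>s. 0 \<le> s \<Longrightarrow> \<bar>u_fun \<rho> s\<bar> \<le> K" using u_bounded[OF \<rho>] by metis
  define R where "R = c / sqrt l"
  have R: "0 < R" using c(1) l by (simp add: R_def)
  show ?thesis
  proof (rule that[of "K / 2 * (R^2 + 2 * \<bar>a\<bar> * R)"])
    fix p :: "('k, 'q) par" and s and v :: "('k, 'q) par"
    assume p: "coercive l (snd p)" "norm (snd p) \<le> a"
    have a: "0 \<le> a" using p(2) norm_ge_zero order_trans by blast
    show "\<bar>u_fun \<rho> (sqrt (qf p s)) / 2 * dqf p s v\<bar> \<le> K / 2 * (R^2 + 2 * \<bar>a\<bar> * R) * (1 + norm (snd s))^2 * norm v"
    proof (cases "sqrt (qf p s) < c")
      case True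
      note r = res_bound_if_small[OF l p(1) True, folded R_def]
      have X: "1 \<le> (1 + norm (snd s))^2" "norm (snd s) \<le> (1 + norm (snd s))^2"
        by (simp_all add: power2_eq_square algebra_simps add_increasing)
      have "\<bar>dqf p s v\<bar> \<le> (R^2 * (1 + norm (snd s))^2 + 2 * a * R * (1 + norm (snd s))^2) * norm v"
      proof (rule order_trans[OF dqf_bound[OF p(2)]], intro mult_right_mono add_mono)
        show "(norm (res p s))\<^sup>2 \<le> R\<^sup>2 * (1 + norm (snd s))\<^sup>2"
          using mult_mono[OF power_mono[OF r(1), of 2] X(1)] by simp
        show "2 * a * norm (res p s) * norm (snd s) \<le> 2 * a * R * (1 + norm (snd s))\<^sup>2"
          using a r(1) X(2) R by (intro mult_mono) auto
      qed simp
      then have "\<bar>u_fun \<rho> (sqrt (qf p s)) / 2\<bar> * \<bar>dqf p s v\<bar> \<le> K / 2 * ((R^2 * (1 + norm (snd s))^2 + 2 * a * R * (1 + norm (snd s))^2) * norm v)"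
        using K(2)[of "sqrt (qf p s)"] r(2) K(1) by (intro mult_mono) auto
      then show ?thesis using a by (simp add: abs_mult algebra_simps)
    next
      case False
      then show ?thesis using c(2)[of "sqrt (qf p s)"] K(1) R a by simp
    qed
  qed
qed

text \<open>The quotient by \<open>qf\<close> is harmless: the derivative of \<open>qf\<close> contains one residual, the prefactor
another one, and \<open>qf\<close> is at least \<open>l\<close> times the squared residual. Outside a fixed ball of residuals
everything vanishes.\<close>

lemma dwres_bound:
  assumes \<rho>: "loss_function \<rho>" "deriv \<rho> C1_differentiable_on UNIV" and l: "0 < l"
  obtains R C where "0 < R" "0 < C"
    "\<And>(p :: ('k::finite, 'q::finite) par) s. coercive l (snd p) \<Longrightarrow> norm (snd p) \<le> a \<Longrightarrow> norm (wres \<rho> p s) \<le> C"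
    "\<And>(p :: ('k::finite, 'q::finite) par) s v. coercive l (snd p) \<Longrightarrow> norm (snd p) \<le> a \<Longrightarrow> norm (dwres \<rho> p s v) \<le> C * (1 + norm (snd s)) * norm v"
    "\<And>(p :: ('k::finite, 'q::finite) par) s v. coercive l (snd p) \<Longrightarrow> norm (snd p) \<le> a \<Longrightarrow> R < norm (res p s) \<Longrightarrow> wres \<rho> p s = 0 \<and> dwres \<rho> p s v = 0"
proof -
  obtain c where c: "0 < c" "\<And>s. c \<le> s \<Longrightarrow> u_fun \<rho> s = 0" "\<And>s. c \<le> s \<Longrightarrow> tau_fun \<rho> s = 0"
    using tau_cutoff[OF \<rho>] by metis
  obtain K where K: "0 < K" "\<And>s. 0 \<le> s \<Longrightarrow> \<bar>u_fun \<rho> s\<bar> \<le> K" using u_bounded[OF \<rho>(1)] by metis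
  obtain H where H: "0 < H" "\<And>s. 0 \<le> s \<Longrightarrow> \<bar>tau_fun \<rho> s\<bar> \<le> H" using tau_bounded[OF \<rho>] by metis
  define R where "R = c / sqrt l"
  have R: "0 < R" using c(1) l by (simp add: R_def)
  define C where "C = K * R + (H / (2 * l) * (R + 2 * \<bar>a\<bar>) + K)"
  have C1: "K * R \<le> C" "H / (2 * l) * (R + 2 * \<bar>a\<bar>) + K \<le> C" "0 < C"
    using K(1) H(1) R l by (auto simp: C_def intro!: add_nonneg_nonneg add_pos_nonneg mult_nonneg_nonneg mult_pos_pos)
  have zero: "wres \<rho> p s = 0 \<and> dwres \<rho> p s v = 0" if "\<not> sqrt (qf p s) < c" for p :: "('k,'q) par" and s v
    using c(2,3)[of "sqrt (qf p s)"] that by (simp add: wres_def dwres_def)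
  show ?thesis
  proof (rule that[OF R C1(3)])
    fix p :: "('k,'q) par" and s and v :: "('k,'q) par"
    assume p: "coercive l (snd p)" "norm (snd p) \<le> a"
    have a: "0 \<le> a" using p(2) norm_ge_zero order_trans by blast
    show "norm (wres \<rho> p s) \<le> C"
    proof (cases "sqrt (qf p s) < c")
      case True
      note r = res_bound_if_small[OF l p(1) True, folded R_def]
      have "norm (wres \<rho> p s) \<le> K * R"
        unfolding wres_def norm_scaleR using K(2)[of "sqrt (qf p s)"] r K(1) by (intro mult_mono) auto
      then show ?thesis using C1(1) by simp
    qed (use zero C1(3) in auto)
    show "R < norm (res p s) \<Longrightarrow> wres \<rho> p s = 0 \<and> dwres \<rho> p s v = 0"
      using res_bound_if_small[OF l p(1), of s c] zero[of p s v] unfolding R_def by fastforce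
    show "norm (dwres \<rho> p s v) \<le> C * (1 + norm (snd s)) * norm v"
    proof (cases "sqrt (qf p s) < c")
      case True
      note r = res_bound_if_small[OF l p(1) True, folded R_def]
      let ?X = "norm (snd s)"
      have "norm (u_fun \<rho> (sqrt (qf p s)) *\<^sub>R (snd s *v fst v)) \<le> K * (?X * norm v)"
        unfolding norm_scaleR using K(2)[of "sqrt (qf p s)"] r(2) K(1)
        by (intro mult_mono order_trans[OF norm_matrix_vector_le mult_left_mono[OF norm_fst_bound]]) auto
      moreover have "norm ((tau_fun \<rho> (sqrt (qf p s)) / (2 * qf p s) * dqf p s v) *\<^sub>R res p s) \<le> H / (2 * l) * ((R + 2 * a * ?X) * norm v)"
      proof (cases "res p s = 0")
        case True then show ?thesis using H(1) l R a by simp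
      next
        case False
        let ?r = "norm (res p s)"
        have rpos: "0 < ?r" using False by simp
        have q: "l * ?r^2 \<le> qf p s" using p(1) by (simp add: coercive_def qf_def)
        have lr: "0 < l * ?r^2" using l False by simp
        have "\<bar>tau_fun \<rho> (sqrt (qf p s))\<bar> / (2 * qf p s) \<le> H / (2 * (l * ?r^2))"
          using H(2)[of "sqrt (qf p s)"] r(2) q lr H(1) by (intro frac_le) auto
        then have "\<bar>tau_fun \<rho> (sqrt (qf p s))\<bar> / (2 * qf p s) * (\<bar>dqf p s v\<bar> * ?r)
          \<le> H / (2 * (l * ?r^2)) * (((?r^2 + 2 * a * ?r * ?X) * norm v) * ?r)"
          using dqf_bound[OF p(2), of s v] H(1) lr
          by (intro mult_mono) auto
        also have "\<dots> = H / (2 * l) * ((?r + 2 * a * ?X) * norm v)"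
          using rpos l by (simp add: field_simps power2_eq_square)
        also have "\<dots> \<le> H / (2 * l) * ((R + 2 * a * ?X) * norm v)"
          using r(1) H(1) l by (intro mult_left_mono mult_right_mono add_mono) auto
        finally show ?thesis using r(2) by (simp add: abs_mult mult_ac)
      qed
      ultimately have "norm (dwres \<rho> p s v) \<le> H / (2 * l) * ((R + 2 * a * ?X) * norm v) + K * (?X * norm v)"
        unfolding dwres_def by (meson add_mono norm_triangle_ineq4 order_trans)
      also have "\<dots> \<le> (H / (2 * l) * (R + 2 * \<bar>a\<bar>) + K) * (1 + ?X) * norm v"
      proof -
        have "H / (2 * l) * (R + 2 * a * ?X) \<le> H / (2 * l) * ((R + 2 * a) * (1 + ?X))"
          using H(1) l a R by (intro mult_left_mono) (auto simp: algebra_simps)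
        moreover have "K * ?X \<le> K * (1 + ?X)" using K(1) by simp
        ultimately have "H / (2 * l) * (R + 2 * a * ?X) + K * ?X \<le> (H / (2 * l) * (R + 2 * \<bar>a\<bar>) + K) * (1 + ?X)"
          using a by (simp only: abs_of_nonneg distrib_right[of _ K] mult.assoc)
        from mult_right_mono[OF this, of "norm v"] show ?thesis by (simp add: algebra_simps)
      qed
      also have "\<dots> \<le> C * (1 + ?X) * norm v"
        using C1(2) by (intro mult_right_mono) auto
      finally show ?thesis .
    qed (use zero C1(3) in auto)
  qed
qed

section \<open>Contaminated measures and influence functions\<close>

lemma sets_contaminate [simp, measurable_cong]: "sets (contaminate P s h) = sets P"
  and space_contaminate [simp]: "space (contaminate P s h) = space P"
  by (simp_all add: contaminate_def)

lemma contaminate_0: "contaminate P s 0 = P"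
  by (rule measure_eqI) (simp_all add: emeasure_contaminate)

text \<open>The defining formula for sets passes to nonnegative functions by monotone approximation.\<close>

lemma nn_integral_contaminate:
  assumes f: "f \<in> borel_measurable P" and s: "s \<in> space P" and h: "0 \<le> h" "h \<le> 1"
  shows "(\<integral>\<^sup>+x. f x \<partial>contaminate P s h) = ennreal (1 - h) * (\<integral>\<^sup>+x. f x \<partial>P) + ennreal h * f s"
  using f
proof (induct rule: borel_measurable_induct)
  case (cong f g)
  then show ?case
    using nn_integral_cong[of P f g] nn_integral_cong[of "contaminate P s h" f g] s by simp
next
  case (set A)
  then show ?case by (simp add: emeasure_contaminate)
next
  case (mult u c)
  then show ?case by (simp add: nn_integral_cmult distrib_left mult_ac)
next
  case (add u v)
  then show ?case by (simp add: nn_integral_add distrib_left add_ac)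
next
  case (seq U)
  have inc: "incseq (\<lambda>i. ennreal (1 - h) * (\<integral>\<^sup>+x. U i x \<partial>P))" "incseq (\<lambda>i. ennreal h * U i s)"
    using seq(4) by (auto simp: incseq_def le_fun_def intro!: mult_left_mono nn_integral_mono)
  have "(\<integral>\<^sup>+x. (SUP i. U i) x \<partial>contaminate P s h) = (SUP i. \<integral>\<^sup>+x. U i x \<partial>contaminate P s h)"
    using seq(1,4) by (simp add: nn_integral_monotone_convergence_SUP image_comp)
  also have "\<dots> = (SUP i. ennreal (1 - h) * (\<integral>\<^sup>+x. U i x \<partial>P) + ennreal h * U i s)"
    using seq by simp
  also have "\<dots> = ennreal (1 - h) * (SUP i. \<integral>\<^sup>+x. U i x \<partial>P) + ennreal h * (SUP i. U i s)"
    by (subst ennreal_SUP_add[OF inc]) (simp add: SUP_mult_left_ennreal)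
  also have "(SUP i. \<integral>\<^sup>+x. U i x \<partial>P) = (\<integral>\<^sup>+x. (SUP i. U i) x \<partial>P)"
    using seq(1,4) by (simp add: nn_integral_monotone_convergence_SUP image_comp)
  finally show ?case by (simp add: image_comp)
qed

lemma integral_contaminate:
  fixes f :: "'a \<Rightarrow> real"
  assumes P: "prob_space P" and f: "f \<in> borel_measurable P" "\<And>x. 0 \<le> f x" "\<And>x. f x \<le> B"
    and s: "s \<in> space P" and h: "0 \<le> h" "h \<le> 1"
  shows "(LINT x|contaminate P s h. f x) = (1 - h) * (LINT x|P. f x) + h * f s"
proof -
  interpret prob_space P by fact
  have I: "integrable P f" using f by (intro integrable_const_bound[where B=B]) auto
  have E: "0 \<le> (LINT x|P. f x)" using f(2) by simp
  have "(LINT x|contaminate P s h. f x) = enn2real (\<integral>\<^sup>+x. ennreal (f x) \<partial>contaminate P s h)"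
    using f(1,2) by (intro integral_eq_nn_integral) (auto simp: measurable_cong_sets[OF sets_contaminate refl])
  also have "(\<integral>\<^sup>+x. ennreal (f x) \<partial>contaminate P s h) = ennreal (1 - h) * (\<integral>\<^sup>+x. ennreal (f x) \<partial>P) + ennreal h * ennreal (f s)"
    using f(1) by (intro nn_integral_contaminate[OF _ s h]) simp
  also have "\<dots> = ennreal ((1 - h) * (LINT x|P. f x) + h * f s)"
    using h f(2) E by (simp add: nn_integral_eq_integral[OF I] ennreal_mult)
  finally show ?thesis
    using h f(2) E by (simp add: enn2real_ennreal add_nonneg_nonneg del: ennreal_plus)
qed

lemma right_derivative_iff_quotient:
  "(f has_vector_derivative d) (at (0::real) within {0<..}) \<longleftrightarrow> ((\<lambda>h. (f h - f 0) /\<^sub>R h) \<longlongrightarrow> d) (at_right 0)"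
proof -
  have "((\<lambda>h. (f h - f 0) /\<^sub>R h) \<longlongrightarrow> d) (at_right 0) \<longleftrightarrow> ((\<lambda>h. (f h - f 0) /\<^sub>R h - d) \<longlongrightarrow> 0) (at_right 0)"
    by (rule Lim_null)
  also have "\<dots> \<longleftrightarrow> ((\<lambda>h. (f h - f 0 - h *\<^sub>R d) /\<^sub>R norm h) \<longlongrightarrow> 0) (at_right 0)"
  proof (rule tendsto_cong)
    show "\<forall>\<^sub>F h in at_right 0. (f h - f 0) /\<^sub>R h - d = (f h - f 0 - h *\<^sub>R d) /\<^sub>R norm h"
      by (auto simp: eventually_at_filter scaleR_diff_right)
  qed
  finally show ?thesis
    unfolding has_vector_derivative_def has_derivative_def
    by (simp add: Lim_ident_at trivial_limit_at_right_real bounded_linear_scaleR_left)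
qed

text \<open>Contamination with weight \<open>0\<close> gives \<open>P\<close> back, so the influence function is the right derivative at
\<open>0\<close> of the functional along the contamination path, and the calculus of derivatives applies.\<close>

lemma has_influence_iff:
  "has_influence s T P d \<longleftrightarrow> ((\<lambda>h. T (contaminate P s h)) has_vector_derivative d) (at 0 within {0<..})"
  unfolding right_derivative_iff_quotient has_influence_def contaminate_0 ..

section \<open>Z-estimators along a path\<close>

lemma path_remainder:
  assumes "(x has_vector_derivative x') (at 0 within {0<..})" "0 < e"
  shows "\<forall>\<^sub>F h in at_right 0. norm (x h - x 0 - h *\<^sub>R x') \<le> e * h"
proof -
  obtain d where "0 < d" "\<And>h. 0 < h \<Longrightarrow> h < d \<Longrightarrow> norm (x h - x 0 - h *\<^sub>R x') \<le> e * h"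
    using assms unfolding has_vector_derivative_def has_derivative_within_alt by fastforce
  then show ?thesis unfolding eventually_at_right_field by (auto intro!: exI[of _ d])
qed

text \<open>With the remainder \<open>u = x h - x 0 - h x'\<close>, expanding \<open>\<Psi>\<close> at \<open>(x 0, t 0)\<close> and subtracting the linearised
equation gives \<open>\<parallel>\<Psi>' (u, 0)\<parallel> \<le> e (\<parallel>u\<parallel> + O(h))\<close> for every \<open>e > 0\<close> and small \<open>h\<close>. Injectivity bounds the left
side below by \<open>B \<parallel>u\<parallel>\<close>; for \<open>e \<le> B / 2\<close> the term \<open>e \<parallel>u\<parallel>\<close> is absorbed and \<open>u = o(h)\<close> remains. The
derivative of \<open>\<Psi>\<close> at the one point is enough because convergence of \<open>x\<close> is assumed, and \<open>\<Psi>\<close> may have more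
components than unknowns.\<close>

lemma z_estimator_path:
  fixes \<Psi> :: "'a::euclidean_space \<times> real \<Rightarrow> 'b::euclidean_space"
  assumes der: "(\<Psi> has_derivative \<Psi>') (at (x 0, t 0))" and zero: "\<Psi> (x 0, t 0) = 0"
    and x: "(x \<longlongrightarrow> x 0) (at_right 0)"
    and t: "(t has_vector_derivative t') (at 0 within {0<..})"
    and eq: "\<forall>\<^sub>F h in at_right 0. (1 - h) *\<^sub>R \<Psi> (x h, t h) + h *\<^sub>R \<psi> h = 0"
    and \<psi>: "(\<psi> \<longlongrightarrow> \<psi>0) (at_right 0)"
    and inj: "\<And>v. \<Psi>' (v, 0) = 0 \<Longrightarrow> v = 0"
    and sol: "\<Psi>' (x', t') + \<psi>0 = 0"
  shows "(x has_vector_derivative x') (at 0 within {0<..})"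
proof -
  have bl: "bounded_linear \<Psi>'" using der by (rule has_derivative_bounded_linear)
  interpret \<Psi>': bounded_linear \<Psi>' by (rule bl)
  have linv: "linear (\<lambda>v. \<Psi>' (v, 0))"
    by (rule linearI) (simp_all flip: \<Psi>'.add \<Psi>'.scaleR)
  moreover have "inj (\<lambda>v. \<Psi>' (v, 0))"
    using inj by (simp add: linear_injective_0[OF linv])
  ultimately obtain B where B: "0 < B" "\<And>v. B * norm v \<le> norm (\<Psi>' (v, 0))"
    using linear_inj_bounded_below_pos by metis
  obtain N where N: "0 < N" "\<And>v. norm (\<Psi>' v) \<le> norm v * N" using \<Psi>'.pos_bounded by blast
  have tc: "(t \<longlongrightarrow> t 0) (at_right 0)"
    using has_vector_derivative_continuous[OF t] by (simp add: continuous_within)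
  have \<psi>'': "((\<lambda>h. \<psi>0 - \<psi> h /\<^sub>R (1 - h)) \<longlongrightarrow> 0) (at_right 0)"
  proof -
    have "((\<lambda>h. \<psi>0 - \<psi> h /\<^sub>R (1 - h)) \<longlongrightarrow> \<psi>0 - \<psi>0 /\<^sub>R (1 - 0)) (at_right 0)"
      by (intro tendsto_intros \<psi>) auto
    then show ?thesis by simp
  qed
  \<comment> \<open>the constant of the final estimate \<open>\<parallel>u\<parallel> \<le> e D h\<close>; the summand \<open>3\<close> covers the \<open>2\<close> that arises there\<close>
  define D where "D = 2 * (3 + N + norm x' + norm t') / B"
  have D: "0 < D" using B(1) N(1) by (simp add: D_def add_pos_nonneg)
  have main: "\<forall>\<^sub>F h in at_right 0. norm (x h - x 0 - h *\<^sub>R x') \<le> \<eta> * h" if \<eta>: "0 < \<eta>" for \<eta>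
  proof -
    define e where "e = min (min (B / 2) 1) (\<eta> / D)"
    have e: "0 < e" "e \<le> B / 2" "e \<le> 1"
    proof -
      show "0 < e" using B(1) D \<eta> by (simp add: e_def)
      have "e \<le> min (B / 2) 1" unfolding e_def by (rule min.cobounded1)
      then show "e \<le> B / 2" "e \<le> 1" unfolding min.bounded_iff by simp_all
    qed
    have "e \<le> \<eta> / D" by (simp add: e_def)
    then have eD: "e * D \<le> \<eta>" using D by (simp add: pos_le_divide_eq)
    obtain d where d: "0 < d" "\<And>p. norm (p - (x 0, t 0)) < d \<Longrightarrow>
      norm (\<Psi> p - \<Psi> (x 0, t 0) - \<Psi>' (p - (x 0, t 0))) \<le> e * norm (p - (x 0, t 0))"
      using der[unfolded has_derivative_within_alt, THEN conjunct2, rule_format, OF e(1)] by auto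
    have "((\<lambda>h. (x h, t h)) \<longlongrightarrow> (x 0, t 0)) (at_right 0)" by (intro tendsto_Pair x tc)
    then have "\<forall>\<^sub>F h in at_right 0. dist (x h, t h) (x 0, t 0) < d" using d(1) by (rule tendstoD)
    moreover have "\<forall>\<^sub>F h in at_right 0. norm (t h - t 0 - h *\<^sub>R t') \<le> e * h" using t e(1) by (rule path_remainder)
    moreover have "\<forall>\<^sub>F h in at_right 0. dist (\<psi>0 - \<psi> h /\<^sub>R (1 - h)) 0 < e" using \<psi>'' e(1) by (rule tendstoD)
    moreover have "\<forall>\<^sub>F h in at_right 0. h < (1::real)" by (rule eventually_at_rightI[of 0 1]) simp_all
    moreover have "\<forall>\<^sub>F h in at_right 0. (0::real) < h" by (rule eventually_at_right_less)
    ultimately show ?thesis using eq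
    proof eventually_elim
      case (elim h)
      define p where "p = (x h, t h)"
      define u where "u = x h - x 0 - h *\<^sub>R x'"
      define r where "r = t h - t 0 - h *\<^sub>R t'"
      have pu: "p - (x 0, t 0) = (u, 0) + (0, r) + h *\<^sub>R (x', t')" by (simp add: p_def u_def r_def)
      have rem: "norm (\<Psi> p - \<Psi>' (p - (x 0, t 0))) \<le> e * norm (p - (x 0, t 0))"
        using d(2)[of p] elim(1) by (simp add: zero p_def dist_norm)
      have "\<Psi> p = - ((h / (1 - h)) *\<^sub>R \<psi> h)"
      proof -
        have "(1 - h) *\<^sub>R \<Psi> p = - (h *\<^sub>R \<psi> h)" using elim(6) by (simp add: p_def eq_neg_iff_add_eq_0)
        then have "(1 / (1 - h)) *\<^sub>R ((1 - h) *\<^sub>R \<Psi> p) = (1 / (1 - h)) *\<^sub>R (- (h *\<^sub>R \<psi> h))" by simp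
        then show ?thesis using elim(4) by simp
      qed
      then have \<Psi>p: "\<Psi> p + h *\<^sub>R \<psi>0 = h *\<^sub>R (\<psi>0 - \<psi> h /\<^sub>R (1 - h))"
        by (simp add: scaleR_diff_right divide_inverse)
      have \<psi>0: "\<psi>0 = - \<Psi>' (x', t')" using sol by (simp add: eq_neg_iff_add_eq_0 add.commute)
      \<comment> \<open>The linearised equation \<open>\<psi>0 = - \<Psi>' (x', t')\<close> removes the first-order terms.\<close>
      have "\<Psi>' (u, 0) = (\<Psi> p + h *\<^sub>R \<psi>0) - (\<Psi> p - \<Psi>' (p - (x 0, t 0))) - \<Psi>' (0, r)"
        unfolding pu \<psi>0 \<Psi>'.add \<Psi>'.scaleR by simp
      then have "norm (\<Psi>' (u, 0)) \<le> norm (\<Psi> p + h *\<^sub>R \<psi>0) + norm (\<Psi> p - \<Psi>' (p - (x 0, t 0))) + norm (\<Psi>' (0, r))"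
        by (simp only: order_trans[OF norm_triangle_ineq4 add_mono[OF norm_triangle_ineq4 order_refl]])
      moreover have "norm (\<Psi> p + h *\<^sub>R \<psi>0) \<le> h * e"
        unfolding \<Psi>p using elim(3,5) by (simp add: mult_left_mono)
      moreover have "norm (\<Psi>' (0, r)) \<le> (e * h) * N"
        by (rule order_trans[OF N(2) mult_right_mono]) (use N(1) elim(2) in \<open>auto simp: norm_Pair r_def\<close>)
      moreover have np: "norm (p - (x 0, t 0)) \<le> norm u + e * h + h * (norm x' + norm t')"
      proof -
        have "norm (p - (x 0, t 0)) \<le> norm (u, 0::real) + norm (0::'a, r) + norm (h *\<^sub>R (x', t'))"
          unfolding pu by (rule order_trans[OF norm_triangle_ineq add_mono[OF norm_triangle_ineq order_refl]])
        also have "norm (h *\<^sub>R (x', t')) \<le> h * (norm x' + norm t')"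
          using elim(5) norm_Pair_le[of x' t'] by (simp del: scaleR_Pair add: mult_left_mono)
        finally show ?thesis using elim(2) by (simp add: norm_Pair r_def)
      qed
      ultimately have "B * norm u \<le> h * e + e * (norm u + e * h + h * (norm x' + norm t')) + e * h * N"
        using B(2)[of u] rem mult_left_mono[OF np, of e] e(1) by linarith
      moreover have "e * norm u \<le> B / 2 * norm u" using e(2) by (rule mult_right_mono) simp
      moreover have "e * (e * h) \<le> e * (1 * h)" using e(1,3) elim(5) by (intro mult_left_mono mult_right_mono) auto
      ultimately have "B / 2 * norm u \<le> e * h * (2 + N + norm x' + norm t')" by (simp add: algebra_simps)
      also have "\<dots> \<le> e * h * (3 + N + norm x' + norm t')" using e(1) elim(5) by (intro mult_left_mono) auto
      finally have "norm u \<le> e * D * h" using B(1) by (simp add: D_def field_simps)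
      also have "\<dots> \<le> \<eta> * h" using eD elim(5) by (intro mult_right_mono) auto
      finally show ?case by (simp add: u_def)
    qed
  qed
  show ?thesis
    unfolding has_vector_derivative_def has_derivative_within_alt
  proof (intro conjI bounded_linear_scaleR_left allI impI)
    fix \<eta> :: real assume "0 < \<eta>"
    from main[OF this] obtain b where "0 < b" "\<And>h. 0 < h \<Longrightarrow> h < b \<Longrightarrow> norm (x h - x 0 - h *\<^sub>R x') \<le> \<eta> * h"
      unfolding eventually_at_right_field by auto
    then show "\<exists>d>0. \<forall>y\<in>{0<..}. norm (y - 0) < d \<longrightarrow> norm (x y - x 0 - (y - 0) *\<^sub>R x') \<le> \<eta> * norm (y - 0)"
      by (intro exI[of _ b]) auto
  qed
qed

section \<open>Functionals of the regression model\<close>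

lemma borel_measurable_matrix_vector_comp [measurable]:
  fixes A :: "'s \<Rightarrow> real^'n^'m" and x :: "'s \<Rightarrow> real^'n"
  assumes "A \<in> borel_measurable M" "x \<in> borel_measurable M"
  shows "(\<lambda>s. A s *v x s) \<in> borel_measurable M"
  using assms
  by (rule borel_measurable_continuous_Pair)
    (intro continuous_intros bounded_bilinear.continuous_on[OF bounded_bilinear_matrix_vector])

lemma borel_measurable_vector_matrix_comp [measurable]:
  fixes A :: "'s \<Rightarrow> real^'n^'m" and x :: "'s \<Rightarrow> real^'m"
  assumes "A \<in> borel_measurable M" "x \<in> borel_measurable M"
  shows "(\<lambda>s. x s v* A s) \<in> borel_measurable M"
proof -
  have "linear (transpose :: real^'n^'m \<Rightarrow> real^'m^'n)" by (rule linearI) (simp_all add: transpose_def vec_eq_iff)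
  then have "continuous_on UNIV (transpose :: real^'n^'m \<Rightarrow> real^'m^'n)"
    by (simp add: linear_continuous_on linear_conv_bounded_linear)
  then have "(\<lambda>s. transpose (A s)) \<in> borel_measurable M"
    using assms(1) measurable_compose borel_measurable_continuous_onI by blast
  from borel_measurable_matrix_vector_comp[OF this assms(2)] show ?thesis by simp
qed

lemma borel_measurable_outer_comp [measurable]:
  fixes x :: "'s \<Rightarrow> real^'m" and y :: "'s \<Rightarrow> real^'n"
  assumes "x \<in> borel_measurable M" "y \<in> borel_measurable M"
  shows "(\<lambda>s. outer (x s) (y s)) \<in> borel_measurable M"
  using assms
  by (rule borel_measurable_continuous_Pair)
    (intro continuous_intros bounded_bilinear.continuous_on[OF bounded_bilinear_outer])

lemma obs_measurable [measurable]:
  "(fst :: ('k::finite,'q::finite) obs \<Rightarrow> _) \<in> borel_measurable borel"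
  "(snd :: ('k::finite,'q::finite) obs \<Rightarrow> _) \<in> borel_measurable borel"
  by (auto intro!: borel_measurable_continuous_onI continuous_intros)

lemma res_measurable [measurable]: "res p \<in> borel_measurable borel"
  unfolding res_def[abs_def] by measurable

lemma qf_measurable [measurable]: "qf p \<in> borel_measurable borel"
  unfolding qf_def[abs_def] by measurable

lemma dqf_measurable [measurable]: "(\<lambda>s. dqf p s v) \<in> borel_measurable borel"
  unfolding dqf_def by measurable

lemma wres_measurable: 
  assumes \<rho>: "loss_function \<rho>"
  shows "wres \<rho> p \<in> borel_measurable borel"
proof -
  note [measurable] = u_borel_measurable[OF \<rho>]
  show ?thesis unfolding wres_def[abs_def] by measurable
qed

lemma dwres_measurable:
  assumes \<rho>: "loss_function \<rho>" "deriv \<rho> C1_differentiable_on UNIV"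
  shows "(\<lambda>s. dwres \<rho> p s v) \<in> borel_measurable borel"
proof -
  note [measurable] = u_borel_measurable[OF \<rho>(1)] tau_borel_measurable[OF \<rho>]
  show ?thesis unfolding dwres_def by measurable
qed

text \<open>A second moment of the design is what the dominating function \<open>(1 + \<parallel>X\<parallel>)\<^sup>2\<close> of all integrands
needs.\<close>

locale second_moment_design = prob_space P for P :: "('k::finite, 'q::finite) obs measure" +
  assumes sets_P: "sets P = sets borel"
    and moment: "integrable P (\<lambda>s. (norm (snd s))^2)"
begin

lemma measurable_P: "f \<in> measurable borel N \<Longrightarrow> f \<in> measurable P N"
  by (simp add: measurable_cong_sets[OF sets_P refl])

lemma integrable_design_bound: "integrable P (\<lambda>s. C * (1 + norm (snd s))^2)"
proof (intro integrable_mult_right, rule Bochner_Integration.integrable_bound)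
  show "integrable P (\<lambda>s. 2 + 2 * (norm (snd s))^2)" using moment by simp
  show "(\<lambda>s. (1 + norm (snd s))^2) \<in> borel_measurable P" by (rule measurable_P) measurable
  show "AE s in P. norm ((1 + norm (snd s))^2) \<le> norm (2 + 2 * (norm (snd s))^2)"
  proof (rule AE_I2)
    fix s :: "('k, 'q) obs"
    have "0 \<le> (1 - norm (snd s))^2" by simp
    then show "norm ((1 + norm (snd s))^2) \<le> norm (2 + 2 * (norm (snd s))^2)"
      by (simp add: power2_eq_square algebra_simps)
  qed
qed

context
  fixes \<rho> :: "real \<Rightarrow> real" and l :: real and p0 :: "('k, 'q) par"
  assumes \<rho>: "loss_function \<rho>" and l: "0 < l" "coercive l (snd p0)"
begin

text \<open>On this neighbourhood half of the coercivity constant survives, so that one dominating function serves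
all its parameters.\<close>

definition nbhd :: "('k, 'q) par set" where "nbhd = UNIV \<times> ball (snd p0) (l / 2)"

lemma nbhd: "open nbhd" "convex nbhd" "p0 \<in> nbhd"
  using l(1) by (auto simp: nbhd_def mem_Times_iff intro!: open_Times convex_Times)

lemma nbhd_coercive:
  assumes "p \<in> nbhd"
  shows "coercive (l / 2) (snd p)" "norm (snd p) \<le> norm (snd p0) + l / 2"
proof -
  have n: "norm (snd p - snd p0) \<le> l / 2" using assms by (auto simp: nbhd_def dist_norm norm_minus_commute)
  then show "coercive (l / 2) (snd p)" using coercive_perturb[OF l(2) n] by simp
  show "norm (snd p) \<le> norm (snd p0) + l / 2"
    using n norm_triangle_sub[of "snd p" "snd p0"] by simp
qed

text \<open>The derivative of the objective; it yields the stationarity conditions and, for the other loss, the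
derivative of the scale equation.\<close>

lemma loss_functional_has_derivative:
  shows "((\<lambda>p. LINT s|P. \<rho> (sqrt (qf p s))) has_derivative
      (\<lambda>v. LINT s|P. u_fun \<rho> (sqrt (qf p0 s)) / 2 * dqf p0 s v)) (at p0)"
    and "integrable P (\<lambda>s. u_fun \<rho> (sqrt (qf p0 s)) / 2 * dqf p0 s v)"
proof -
  obtain C where C: "\<And>p s v. coercive (l / 2) (snd p) \<Longrightarrow> norm (snd p) \<le> norm (snd p0) + l / 2 \<Longrightarrow>
    \<bar>u_fun \<rho> (sqrt (qf p (s :: ('k,'q) obs))) / 2 * dqf p s v\<bar> \<le> C * (1 + norm (snd s))^2 * norm v"
    using loss_qf_derivative_bound[OF \<rho>, of "l / 2" "norm (snd p0) + l / 2"] l(1) by (metis half_gt_zero)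
  obtain c where c: "\<And>s. 0 \<le> s \<Longrightarrow> \<rho> s \<le> \<rho> c" using loss_cutoff[OF \<rho>] by metis
  note [measurable] = u_borel_measurable[OF \<rho>] loss_borel_measurable[OF \<rho>]
  have nn: "0 \<le> sqrt (qf p0 s)" for s
    using l unfolding coercive_def qf_def
    by (meson less_imp_le mult_nonneg_nonneg order_trans real_sqrt_ge_zero zero_le_power2)
  note D = has_derivative_integral[where M=P and U=nbhd and f="\<lambda>p s. \<rho> (sqrt (qf p s))"
      and f'="\<lambda>p s v. u_fun \<rho> (sqrt (qf p s)) / 2 * dqf p s v" and K="\<lambda>s. C * (1 + norm (snd s))^2", OF nbhd]
  have 1: "(\<lambda>s. \<rho> (sqrt (qf p s))) \<in> borel_measurable P" for p by (rule measurable_P) measurable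
  have 2: "integrable P (\<lambda>s. \<rho> (sqrt (qf p0 s)))"
    using \<rho> c[OF nn] 1 by (intro integrable_const_bound[where B="\<rho> c"]) (auto simp: loss_function_def)
  have 3: "(\<lambda>s. u_fun \<rho> (sqrt (qf p0 s)) / 2 * dqf p0 s v) \<in> borel_measurable P" for v by (rule measurable_P) measurable
  have l2: "0 < l / 2" using l(1) by simp
  note D' = D[OF 1 2 loss_qf_has_derivative[OF \<rho> l2 nbhd_coercive(1)] 3 _ integrable_design_bound]
  show "((\<lambda>p. LINT s|P. \<rho> (sqrt (qf p s))) has_derivative
      (\<lambda>v. LINT s|P. u_fun \<rho> (sqrt (qf p0 s)) / 2 * dqf p0 s v)) (at p0)"
    by (rule D'(1)) (use C[OF nbhd_coercive] in auto)
  show "integrable P (\<lambda>s. u_fun \<rho> (sqrt (qf p0 s)) / 2 * dqf p0 s v)"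
    by (rule D'(2)) (use C[OF nbhd_coercive] in auto)
qed

context
  assumes C2: "deriv \<rho> C1_differentiable_on UNIV"
begin

text \<open>The part of the gradient that pairs with the direction of \<open>A\<close>.\<close>

lemma scatter_functional_has_derivative:
  shows "((\<lambda>p. \<integral>s. outer (wres \<rho> p s) (res p s) \<partial>P) has_derivative
      (\<lambda>v. \<integral>s. outer (dwres \<rho> p0 s v) (res p0 s) - outer (wres \<rho> p0 s) (snd s *v fst v) \<partial>P)) (at p0)"
    and "integrable P (\<lambda>s. outer (dwres \<rho> p0 s v) (res p0 s) - outer (wres \<rho> p0 s) (snd s *v fst v))"
    and "integrable P (\<lambda>s. outer (wres \<rho> p0 s) (res p0 s))"
proof -
  have l2: "0 < l / 2" using l(1) by simp
  obtain R C where RC: "0 < R" "0 < C"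
    "\<And>p s. coercive (l/2) (snd p) \<Longrightarrow> norm (snd p) \<le> norm (snd p0) + l / 2 \<Longrightarrow> norm (wres \<rho> p (s :: ('k,'q) obs)) \<le> C"
    "\<And>p s v. coercive (l/2) (snd p) \<Longrightarrow> norm (snd p) \<le> norm (snd p0) + l / 2 \<Longrightarrow> norm (dwres \<rho> p (s :: ('k,'q) obs) v) \<le> C * (1 + norm (snd s)) * norm v"
    "\<And>p s v. coercive (l/2) (snd p) \<Longrightarrow> norm (snd p) \<le> norm (snd p0) + l / 2 \<Longrightarrow> R < norm (res p s) \<Longrightarrow> wres \<rho> p (s :: ('k,'q) obs) = 0 \<and> dwres \<rho> p s v = 0"
    by (rule dwres_bound[where 'k='k and 'q='q, OF \<rho> C2 l2, of "norm (snd p0) + l / 2"]) blast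
  note [measurable] = wres_measurable[OF \<rho>] dwres_measurable[OF \<rho> C2]
  have 1: "(\<lambda>s. outer (wres \<rho> p s) (res p s)) \<in> borel_measurable P" for p by (rule measurable_P) measurable
  have 2: "integrable P (\<lambda>s. outer (wres \<rho> p0 s) (res p0 s))"
  proof (rule integrable_const_bound[where B="C * R"])
    show "AE s in P. norm (outer (wres \<rho> p0 s) (res p0 s)) \<le> C * R"
    proof (rule AE_I2)
      fix s
      note n = nbhd_coercive[OF nbhd(3)]
      show "norm (outer (wres \<rho> p0 s) (res p0 s)) \<le> C * R"
        using RC(1,2) RC(3)[OF n, of s] RC(5)[OF n, of s 0]
        by (cases "R < norm (res p0 s)") (auto simp: norm_outer intro!: mult_mono)
    qed
  qed (rule 1)
  have 3: "(\<lambda>s. outer (dwres \<rho> p0 s v) (res p0 s) - outer (wres \<rho> p0 s) (snd s *v fst v)) \<in> borel_measurable P" for v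
    by (rule measurable_P) measurable
  have 4: "((\<lambda>p. outer (wres \<rho> p s) (res p s)) has_derivative (\<lambda>v. outer (dwres \<rho> p s v) (res p s) - outer (wres \<rho> p s) (snd s *v fst v))) (at p)"
    if "p \<in> nbhd" for p s
    using bounded_bilinear.FDERIV[OF bounded_bilinear_outer wres_has_derivative[OF \<rho> C2 l2 nbhd_coercive(1)[OF that]] res_has_derivative, of s]
    by (simp add: bounded_bilinear.minus_right[OF bounded_bilinear_outer])
  have 5: "norm (outer (dwres \<rho> p s v) (res p s) - outer (wres \<rho> p s) (snd s *v fst v)) \<le> C * (R + 1) * (1 + norm (snd s))^2 * norm v"
    if p: "p \<in> nbhd" for p v and s :: "('k,'q) obs"
  proof -
    note n = nbhd_coercive[OF p]
    let ?X = "1 + norm (snd s)"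
    have "norm (outer (dwres \<rho> p s v) (res p s)) \<le> C * ?X * norm v * R"
      using RC(1,2) RC(4)[OF n, of s v] RC(5)[OF n, of s v]
      by (cases "R < norm (res p s)") (auto simp: norm_outer intro!: mult_mono)
    moreover have "norm (outer (wres \<rho> p s) (snd s *v fst v)) \<le> C * (?X * norm v)"
      unfolding norm_outer using RC(1,2)
      by (intro mult_mono RC(3)[OF n] order_trans[OF norm_matrix_vector_le mult_mono] norm_fst_bound) auto
    ultimately have "norm (outer (dwres \<rho> p s v) (res p s) - outer (wres \<rho> p s) (snd s *v fst v)) \<le> (C * (R + 1) * norm v) * ?X"
      using norm_triangle_ineq4[of "outer (dwres \<rho> p s v) (res p s)" "outer (wres \<rho> p s) (snd s *v fst v)"]
      by (simp add: algebra_simps)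
    also have "\<dots> \<le> (C * (R + 1) * norm v) * ?X^2"
      using RC(1,2) by (intro mult_left_mono self_le_power) auto
    finally show ?thesis by (simp add: mult_ac)
  qed
  note D = has_derivative_integral[where M=P and U=nbhd and K="\<lambda>s. C * (R + 1) * (1 + norm (snd s))^2", OF nbhd 1 2 4 3 5 integrable_design_bound]
  show "((\<lambda>p. \<integral>s. outer (wres \<rho> p s) (res p s) \<partial>P) has_derivative
      (\<lambda>v. \<integral>s. outer (dwres \<rho> p0 s v) (res p0 s) - outer (wres \<rho> p0 s) (snd s *v fst v) \<partial>P)) (at p0)"
    by (rule D(1))
  show "integrable P (\<lambda>s. outer (dwres \<rho> p0 s v) (res p0 s) - outer (wres \<rho> p0 s) (snd s *v fst v))"
    by (rule D(2))
  show "integrable P (\<lambda>s. outer (wres \<rho> p0 s) (res p0 s))" by (rule 2)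
qed

text \<open>The part of the gradient that pairs with the direction of \<open>\<beta>\<close>.\<close>

lemma regression_functional_has_derivative:
  shows "((\<lambda>p. \<integral>s. (snd p *v wres \<rho> p s) v* snd s \<partial>P) has_derivative
      (\<lambda>v. \<integral>s. (snd p0 *v dwres \<rho> p0 s v + snd v *v wres \<rho> p0 s) v* snd s \<partial>P)) (at p0)"
    and "integrable P (\<lambda>s. (snd p0 *v dwres \<rho> p0 s v + snd v *v wres \<rho> p0 s) v* snd s)"
    and "integrable P (\<lambda>s. (snd p0 *v wres \<rho> p0 s) v* snd s)"
proof -
  have l2: "0 < l / 2" using l(1) by simp
  define a where "a = norm (snd p0) + l / 2"
  have a: "0 < a" using l(1) by (simp add: a_def add_nonneg_pos)
  obtain R C where RC: "0 < R" "0 < C"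
    "\<And>p s. coercive (l/2) (snd p) \<Longrightarrow> norm (snd p) \<le> a \<Longrightarrow> norm (wres \<rho> p (s :: ('k,'q) obs)) \<le> C"
    "\<And>p s v. coercive (l/2) (snd p) \<Longrightarrow> norm (snd p) \<le> a \<Longrightarrow> norm (dwres \<rho> p (s :: ('k,'q) obs) v) \<le> C * (1 + norm (snd s)) * norm v"
    "\<And>p s v. coercive (l/2) (snd p) \<Longrightarrow> norm (snd p) \<le> a \<Longrightarrow> R < norm (res p s) \<Longrightarrow> wres \<rho> p (s :: ('k,'q) obs) = 0 \<and> dwres \<rho> p s v = 0"
    by (rule dwres_bound[where 'k='k and 'q='q, OF \<rho> C2 l2, of a]) blast
  note nc = nbhd_coercive[folded a_def]
  note [measurable] = wres_measurable[OF \<rho>] dwres_measurable[OF \<rho> C2]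
  have 1: "(\<lambda>s. (snd p *v wres \<rho> p s) v* snd s) \<in> borel_measurable P" for p by (rule measurable_P) measurable
  have w: "norm (snd p *v wres \<rho> p s) \<le> a * C" if "p \<in> nbhd" for p s
    using a by (intro order_trans[OF norm_matrix_vector_le mult_mono] nc(2)[OF that] RC(3)[OF nc[OF that]]) auto
  have X: "norm (snd s) \<le> 1 + norm (snd s)" "1 + norm (snd s) \<le> (1 + norm (snd s))^2" for s :: "('k,'q) obs"
    by (auto intro: self_le_power)
  have 2: "integrable P (\<lambda>s. (snd p0 *v wres \<rho> p0 s) v* snd s)"
  proof (rule Bochner_Integration.integrable_bound[OF integrable_design_bound[of "a * C"] 1])
    show "AE s in P. norm ((snd p0 *v wres \<rho> p0 s) v* snd s) \<le> norm (a * C * (1 + norm (snd s))^2)"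
    proof (rule AE_I2)
      fix s :: "('k,'q) obs"
      have "norm ((snd p0 *v wres \<rho> p0 s) v* snd s) \<le> norm (snd s) * (a * C)"
        by (rule order_trans[OF norm_vector_matrix_le mult_left_mono[OF w[OF nbhd(3)]]]) simp
      also have "\<dots> \<le> (1 + norm (snd s))^2 * (a * C)"
        using order_trans[OF X, of s] a RC(2) by (intro mult_right_mono) auto
      finally show "norm ((snd p0 *v wres \<rho> p0 s) v* snd s) \<le> norm (a * C * (1 + norm (snd s))^2)"
        using a RC(2) by (simp add: mult_ac)
    qed
  qed
  have 3: "(\<lambda>s. (snd p0 *v dwres \<rho> p0 s v + snd v *v wres \<rho> p0 s) v* snd s) \<in> borel_measurable P" for v
    by (rule measurable_P) measurable
  have blv: "bounded_linear (\<lambda>x. x v* A)" for A :: "real^'q^'k"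
  proof -
    have "(*v) (transpose A) = (\<lambda>x. x v* A)" by (rule ext) simp
    then show ?thesis using matrix_vector_mul_bounded_linear[of "transpose A"] by simp
  qed
  have 4: "((\<lambda>p. (snd p *v wres \<rho> p s) v* snd s) has_derivative (\<lambda>v. (snd p *v dwres \<rho> p s v + snd v *v wres \<rho> p s) v* snd s)) (at p)"
    if "p \<in> nbhd" for p s
    by (rule bounded_linear.has_derivative[OF blv])
      (rule bounded_bilinear.FDERIV[OF bounded_bilinear_matrix_vector has_derivative_snd[OF has_derivative_ident]
        wres_has_derivative[OF \<rho> C2 l2 nc(1)[OF that]]])
  have 5: "norm ((snd p *v dwres \<rho> p s v + snd v *v wres \<rho> p s) v* snd s) \<le> (a * C + C) * (1 + norm (snd s))^2 * norm v"
    if p: "p \<in> nbhd" for p v and s :: "('k,'q) obs"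
  proof -
    let ?X = "1 + norm (snd s)"
    have "norm (snd p *v dwres \<rho> p s v) \<le> a * (C * ?X * norm v)"
      using a by (intro order_trans[OF norm_matrix_vector_le mult_mono] nc(2)[OF p] RC(4)[OF nc[OF p]]) auto
    moreover have "norm (snd v *v wres \<rho> p s) \<le> norm v * C"
      by (intro order_trans[OF norm_matrix_vector_le mult_mono] norm_snd_bound RC(3)[OF nc[OF p]]) auto
    moreover have "norm v * C \<le> C * ?X * norm v" using RC(2) by (simp add: algebra_simps)
    ultimately have "norm (snd p *v dwres \<rho> p s v + snd v *v wres \<rho> p s) \<le> (a * C + C) * ?X * norm v"
      using norm_triangle_ineq[of "snd p *v dwres \<rho> p s v" "snd v *v wres \<rho> p s"] by (simp add: algebra_simps)
    then have "norm ((snd p *v dwres \<rho> p s v + snd v *v wres \<rho> p s) v* snd s) \<le> ?X * ((a * C + C) * ?X * norm v)"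
      by (intro order_trans[OF norm_vector_matrix_le mult_mono]) auto
    then show ?thesis by (simp add: power2_eq_square mult_ac)
  qed
  note D = has_derivative_integral[where M=P and U=nbhd and K="\<lambda>s. (a * C + C) * (1 + norm (snd s))^2", OF nbhd 1 2 4 3 5 integrable_design_bound]
  show "((\<lambda>p. \<integral>s. (snd p *v wres \<rho> p s) v* snd s \<partial>P) has_derivative
      (\<lambda>v. \<integral>s. (snd p0 *v dwres \<rho> p0 s v + snd v *v wres \<rho> p0 s) v* snd s \<partial>P)) (at p0)"
    by (rule D(1))
  show "integrable P (\<lambda>s. (snd p0 *v dwres \<rho> p0 s v + snd v *v wres \<rho> p0 s) v* snd s)"
    by (rule D(2))
  show "integrable P (\<lambda>s. (snd p0 *v wres \<rho> p0 s) v* snd s)" by (rule 2)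
qed

end
end
end

section \<open>Derivatives of determinant and inverse\<close>

text \<open>Applied to its own \<open>i\<close>-th row, the matrix produces the squared length of that row.\<close>

lemma norm_matrix_le_operator:
  fixes M :: "real^'n^'m"
  assumes "\<And>x. norm (M *v x) \<le> K * norm x"
  shows "norm M \<le> real CARD('m) * K"
proof -
  have row: "norm (M $ i) \<le> K" for i
  proof (cases "M $ i = 0")
    case True
    have "0 \<le> K * norm (axis undefined 1 :: real^'n)"
      using assms[of "axis undefined 1"] norm_ge_zero order_trans by blast
    then show ?thesis using True by (simp add: norm_axis_1)
  next
    case False
    have "norm (M $ i) * norm (M $ i) = M $ i \<bullet> M $ i"
      by (simp only: power2_norm_eq_inner[symmetric] power2_eq_square)
    also have "\<dots> = (M *v (M $ i)) $ i"
      unfolding matrix_vector_mult_def inner_vec_def by simp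
    also have "\<dots> \<le> K * norm (M $ i)"
      using component_le_norm_cart[of "M *v (M $ i)" i] assms[of "M $ i"] by linarith
    finally show ?thesis using False by simp
  qed
  have "norm M \<le> (\<Sum>i\<in>UNIV. norm (M $ i))"
    unfolding norm_vec_def by (rule L2_set_le_sum) simp
  also have "\<dots> \<le> (\<Sum>i\<in>(UNIV::'m set). K)" by (intro sum_mono row)
  finally show ?thesis by simp
qed

text \<open>For \<open>y = B\<^sup>-\<^sup>1 x\<close> coercivity gives \<open>l \<parallel>y\<parallel>\<^sup>2 \<le> y \<bullet> x\<close>.\<close>

lemma coercive_inverse_bound:
  fixes B :: "real^'k^'k"
  assumes "0 < l" "coercive l B"
  shows "invertible B" "norm (matrix_inv B) \<le> real CARD('k) * (1 / l)"
proof -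
  show inv: "invertible B"
    using assms by (intro invertible_if_pos) (metis coercive_def less_le_trans mult_pos_pos zero_less_norm_iff zero_less_power)
  show "norm (matrix_inv B) \<le> real CARD('k) * (1 / l)"
  proof (rule norm_matrix_le_operator)
    fix x :: "real^'k"
    define y where "y = matrix_inv B *v x"
    have x: "B *v y = x" using inv by (simp add: y_def matrix_vector_mul_assoc matrix_inv_mult)
    have "l * (norm y)^2 \<le> y \<bullet> (B *v y)" using assms(2) by (simp add: coercive_def)
    also have "\<dots> \<le> norm y * norm x" unfolding x by (rule norm_cauchy_schwarz)
    finally have "norm y * (l * norm y) \<le> norm y * norm x" by (simp add: power2_eq_square mult_ac)
    then have "l * norm y \<le> norm x" by (cases "y = 0") auto
    then show "norm (matrix_inv B *v x) \<le> 1 / l * norm x"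
      using assms(1) by (simp add: y_def field_simps)
  qed
qed

text \<open>With \<open>a = A\<^sup>-\<^sup>1\<close>, \<open>b = B\<^sup>-\<^sup>1\<close> and \<open>H = B - A\<close> the error of the linear approximation is exactly \<open>b H a H a\<close>, and
\<open>b\<close> is bounded near \<open>A\<close> by coercivity.\<close>

lemma matrix_inv_has_derivative:
  fixes A :: "real^'k^'k"
  assumes l: "0 < l" "coercive l A"
  shows "(matrix_inv has_derivative (\<lambda>H. - (matrix_inv A ** H ** matrix_inv A))) (at A)"
proof -
  let ?a = "matrix_inv A"
  obtain C where C: "0 < C" "\<And>X Y. norm ((X::real^'k^'k) ** (Y::real^'k^'k)) \<le> norm X * norm Y * C"
    using bounded_bilinear.pos_bounded[OF bounded_bilinear_matrix_mult] by metis
  have bl: "bounded_linear (\<lambda>H. - (?a ** H ** ?a))"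
    by (intro bounded_linear_minus bounded_linear_compose[OF bounded_bilinear.bounded_linear_left[OF bounded_bilinear_matrix_mult]
      bounded_bilinear.bounded_linear_right[OF bounded_bilinear_matrix_mult]])
  define K where "K = real CARD('k) * (1 / (l / 2)) * norm ?a * norm ?a * (C * C * C)"
  have K: "0 \<le> K * C" using l C(1) by (simp add: K_def)
  have bound: "norm (matrix_inv B - ?a - - (?a ** (B - A) ** ?a)) \<le> (K * C) * (norm (B - A) * norm (B - A))"
    if B: "norm (B - A) < l / 2" for B
  proof -
    have cB: "coercive (l / 2) B" using coercive_perturb[OF l(2), of B "l / 2"] B by simp
    note iB = coercive_inverse_bound[OF _ cB]
    have invA: "invertible A" using coercive_inverse_bound[OF l] by simp
    have invB: "invertible B" using iB(1) l(1) by simp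
    define b where "b = matrix_inv B"
    define H where "H = B - A"
    have bHa: "b ** H ** ?a = ?a - b"
      unfolding H_def b_def
      by (simp add: bounded_bilinear.diff_left[OF bounded_bilinear_matrix_mult]
         bounded_bilinear.diff_right[OF bounded_bilinear_matrix_mult] matrix_inv_mult[OF invB])
        (simp add: matrix_inv_mult[OF invA] flip: matrix_mul_assoc)
    have "b ** H ** ?a ** H ** ?a = (?a - b) ** H ** ?a" by (simp add: bHa)
    also have "\<dots> = ?a ** H ** ?a - b ** H ** ?a"
      by (simp add: bounded_bilinear.diff_left[OF bounded_bilinear_matrix_mult])
    also have "\<dots> = b - ?a - - (?a ** H ** ?a)" by (simp add: bHa)
    finally have "norm (b - ?a - - (?a ** H ** ?a)) = norm (b ** H ** ?a ** H ** ?a)" by simp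
    also have "\<dots> \<le> ((((norm b * norm H * C) * norm ?a * C) * norm H * C) * norm ?a * C)"
      using C(1) by (intro order_trans[OF C(2)] mult_right_mono order_refl) auto
    also have "\<dots> = norm b * (norm ?a * norm ?a * (C * C * C) * C * (norm H * norm H))" by (simp add: mult_ac)
    also have "\<dots> \<le> real CARD('k) * (1 / (l / 2)) * (norm ?a * norm ?a * (C * C * C) * C * (norm H * norm H))"
      using iB(2) l(1) C(1) unfolding b_def by (intro mult_right_mono) auto
    finally show ?thesis unfolding K_def b_def H_def by (simp add: mult_ac)
  qed
  show ?thesis
    unfolding has_derivative_within_alt
  proof (intro conjI bl allI impI)
    fix e :: real assume e: "0 < e"
    define d where "d = min (l / 2) (e / (K * C + 1))"
    have d: "0 < d" using l e K by (simp add: d_def)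
    show "\<exists>d>0. \<forall>y\<in>UNIV. norm (y - A) < d \<longrightarrow> norm (matrix_inv y - ?a - - (?a ** (y - A) ** ?a)) \<le> e * norm (y - A)"
    proof (intro exI[of _ d] conjI d ballI impI)
      fix B assume B: "norm (B - A) < d"
      have "norm (B - A) < e / (K * C + 1)" using B by (simp add: d_def)
      then have "(K * C + 1) * norm (B - A) \<le> e" using K by (simp add: field_simps)
      then have "(K * C) * norm (B - A) \<le> e" by (simp add: distrib_right) (smt (verit) norm_ge_zero)
      then have "(K * C) * norm (B - A) * norm (B - A) \<le> e * norm (B - A)" by (rule mult_right_mono) simp
      then show "norm (matrix_inv B - ?a - - (?a ** (B - A) ** ?a)) \<le> e * norm (B - A)"
        using bound[of B] B by (simp add: d_def mult.assoc)
    qed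
  qed
qed

text \<open>In the Leibniz formula a permutation other than the identity moves at least two points, so after
differentiating one factor another off-diagonal entry of the identity matrix is left.\<close>

lemma det_has_derivative_mat1: "(det has_derivative trace) (at (mat 1 :: real^'k^'k))"
proof -
  let ?I = "mat 1 :: real^'k^'k"
  have "((\<lambda>A::real^'k^'k. \<Sum>p | p permutes UNIV. of_int (sign p) * (\<Prod>i\<in>UNIV. A $ i $ p i)) has_derivative
     (\<lambda>H. \<Sum>p | p permutes UNIV. of_int (sign p) * (\<Sum>i\<in>UNIV. H $ i $ p i * (\<Prod>j\<in>UNIV - {i}. ?I $ j $ p j)))) (at ?I)"
    by (intro has_derivative_sum has_derivative_mult_right has_derivative_prod bounded_linear.has_derivative[OF bounded_linear_vec_nth]
       bounded_linear.has_derivative[OF bounded_linear_compose[OF bounded_linear_vec_nth bounded_linear_vec_nth]] has_derivative_ident)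
  moreover have "(\<Sum>p | p permutes UNIV. of_int (sign p) * (\<Sum>i\<in>UNIV. H $ i $ p i * (\<Prod>j\<in>UNIV - {i}. ?I $ j $ p j))) = trace H" for H :: "real^'k^'k"
  proof -
    have zero: "(\<Prod>j\<in>UNIV - {i}. ?I $ j $ p j) = 0" if p: "p permutes UNIV" "p \<noteq> id" for p and i :: 'k
    proof -
      obtain j where j: "p j \<noteq> j" using p(2) by (auto simp: fun_eq_iff)
      \<comment> \<open>If \<open>i\<close> is the point that is moved, its image is moved as well.\<close>
      have "\<exists>j\<in>UNIV - {i}. p j \<noteq> j"
      proof (cases "j = i")
        case True
        have "p (p i) \<noteq> p i" using j True permutes_inj[OF p(1)] by (auto simp: inj_def)
        then show ?thesis using j True by (intro bexI[of _ "p i"]) auto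
      next
        case False
        then show ?thesis using j by (intro bexI[of _ j]) auto
      qed
      then obtain m where "m \<noteq> i" "p m \<noteq> m" by blast
      then show ?thesis by (intro prod_zero bexI[of _ m]) (auto simp: mat_def)
    qed
    have "(\<Sum>p | p permutes UNIV. of_int (sign p) * (\<Sum>i\<in>UNIV. H $ i $ p i * (\<Prod>j\<in>UNIV - {i}. ?I $ j $ p j)))
      = (\<Sum>p\<in>{id}. of_int (sign p) * (\<Sum>i\<in>UNIV. H $ i $ p i * (\<Prod>j\<in>UNIV - {i}. ?I $ j $ p j)))"
      by (rule sum.mono_neutral_right) (auto simp: zero finite_permutations permutes_id)
    also have "\<dots> = trace H" by (simp add: trace_def mat_def sign_id)
    finally show ?thesis .
  qed
  ultimately show ?thesis unfolding det_def[abs_def] by simp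
qed

lemma det_has_derivative:
  fixes A :: "real^'k^'k"
  assumes "invertible A"
  shows "(det has_derivative (\<lambda>H. det A * trace (matrix_inv A ** H))) (at A)"
proof -
  let ?a = "matrix_inv A"
  have "det A * det ?a = det (A ** ?a)" by (rule det_mul[symmetric])
  then have "det A * det ?a = 1" by (simp add: matrix_inv_mult[OF assms])
  then have eq: "det A * det (?a ** B) = det B" for B
    unfolding det_mul mult.assoc[symmetric] by simp
  have "((\<lambda>B. ?a ** B) has_derivative (\<lambda>H. ?a ** H)) (at A)"
    by (intro bounded_linear.has_derivative[OF bounded_bilinear.bounded_linear_right[OF bounded_bilinear_matrix_mult]] has_derivative_ident)
  moreover have "(det has_derivative trace) (at (?a ** A))"
    using det_has_derivative_mat1 by (simp add: matrix_inv_mult[OF assms])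
  ultimately have "((\<lambda>B. det (?a ** B)) has_derivative (\<lambda>H. trace (?a ** H))) (at A)"
    by (rule has_derivative_compose)
  then have "((\<lambda>B. det A * det (?a ** B)) has_derivative (\<lambda>H. det A * trace (?a ** H))) (at A)"
    by (rule has_derivative_mult_right)
  then show ?thesis unfolding eq .
qed

text \<open>The inverse of the normalised matrix \<open>W / |W|\<^sup>1\<^sup>/\<^sup>k\<close>. Written like this, it is differentiable off
the set of determinant one as well.\<close>

definition ninv :: "real^'k^'k \<Rightarrow> real^'k^'k" where
  "ninv W = (det W powr (1 / real CARD('k))) *\<^sub>R matrix_inv W"

lemma ninv_has_derivative:
  fixes A :: "real^'k^'k"
  assumes A: "pds A"
  shows "(ninv has_derivative (\<lambda>H. (det A powr (1 / real CARD('k))) *\<^sub>R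
     ((trace (matrix_inv A ** H) / real CARD('k)) *\<^sub>R matrix_inv A - matrix_inv A ** H ** matrix_inv A))) (at A)"
proof -
  let ?a = "matrix_inv A" and ?k = "1 / real CARD('k)"
  obtain l where l: "0 < l" "coercive l A" using pds_coercive[OF A] unfolding coercive_def by metis
  have d: "0 < det A" using A by (rule pds_det_pos)
  have dp: "((\<lambda>B. det B powr ?k) has_derivative (\<lambda>H. (?k * det A powr (?k - 1)) * (det A * trace (?a ** H)))) (at A)"
    by (rule has_derivative_compose[OF det_has_derivative[OF pds_invertible[OF A]]
       has_real_derivative_powr[OF d, unfolded has_field_derivative_def]])
  have pow: "(?k * det A powr (?k - 1)) * (det A * t) = det A powr ?k * (t / real CARD('k))" for t
  proof -
    have "det A powr (?k - 1) * det A = det A powr ?k" using d powr_mult_base[of "det A" "?k - 1"] by (simp add: mult.commute)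
    then have "det A powr ?k * (t / real CARD('k)) = (det A powr (?k - 1) * det A) * (t / real CARD('k))" by simp
    then show ?thesis by auto
  qed
  have "((\<lambda>B. det B powr ?k) has_derivative (\<lambda>H. det A powr ?k * (trace (?a ** H) / real CARD('k)))) (at A)"
    using dp unfolding pow .
  from has_derivative_scaleR[OF this matrix_inv_has_derivative[OF l]]
  have "(ninv has_derivative (\<lambda>H. det A powr ?k *\<^sub>R - (?a ** H ** ?a) + (det A powr ?k * (trace (?a ** H) / real CARD('k))) *\<^sub>R ?a)) (at A)"
    unfolding ninv_def[abs_def] .
  moreover have "(\<lambda>H. det A powr ?k *\<^sub>R - (?a ** H ** ?a) + (det A powr ?k * (trace (?a ** H) / real CARD('k))) *\<^sub>R ?a) =
    (\<lambda>H. (det A powr ?k) *\<^sub>R ((trace (?a ** H) / real CARD('k)) *\<^sub>R ?a - ?a ** H ** ?a))"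
    by (simp add: fun_eq_iff scaleR_diff_right)
  ultimately show ?thesis by simp
qed

section \<open>Integrals at the elliptical model\<close>

lemma matrix_vector_mult_minus [simp]: "(A::real^'n^'m) *v (- x) = - (A *v x)"
  by (rule bounded_bilinear.minus_right[OF bounded_bilinear_matrix_vector])

text \<open>The elliptical model in terms of its spherical noise law \<open>\<nu>\<close>, with \<open>T\<close> the root of the covariance
\<open>S\<close>. The number \<open>c\<close> is the factor that turns the norm of the noise into the argument of the loss.\<close>

locale elliptical_regression =
  second_moment_design P + rotation_invariant \<nu> + nu: prob_space \<nu>
  for P :: "('k::finite, 'q::finite) obs measure" and \<nu> :: "(real^'k) measure" +
  fixes \<beta> :: "real^'q" and S T :: "real^'k^'k" and c :: real
  assumes T: "pds T" "T ** T = S" and c: "0 < c"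
    and representation: "P = distr (\<nu> \<Otimes>\<^sub>M distr P borel snd) borel (\<lambda>(z, X). (X *v \<beta> + T *v z, X))"
begin

text \<open>The parameter at the model: there the loss is evaluated at \<open>c \<parallel>z\<parallel>\<close>.\<close>

definition p0 :: "('k, 'q) par" where "p0 = (\<beta>, c\<^sup>2 *\<^sub>R matrix_inv S)"

lemma inverse_S: "matrix_inv S = matrix_inv T ** matrix_inv T"
  using matrix_inv_matrix_mult[OF pds_invertible[OF T(1)] pds_invertible[OF T(1)]] T(2) by simp

lemma inverse_S_T: "matrix_inv S *v (T *v x) = matrix_inv T *v x" "T *v (matrix_inv S *v x) = matrix_inv T *v x"
  using matrix_inv_mult[OF pds_invertible[OF T(1)]]
  by (simp_all add: inverse_S matrix_vector_mul_assoc matrix_mul_assoc)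
    (simp add: matrix_mul_assoc[symmetric])

lemma T_sym: "(T *v x) \<bullet> y = x \<bullet> (T *v y)"
  using pds_inner_sym[OF T(1)] by simp

lemma Ti_sym: "(matrix_inv T *v x) \<bullet> y = x \<bullet> (matrix_inv T *v y)"
  using pds_inner_sym[OF pds_matrix_inv[OF T(1)]] by simp

lemma Si_sym: "(matrix_inv S *v x) \<bullet> y = x \<bullet> (matrix_inv S *v y)"
  unfolding inverse_S matrix_vector_mul_assoc[symmetric] Ti_sym ..

lemma Ti_T: "matrix_inv T *v (T *v x) = x"
  using matrix_inv_mult[OF pds_invertible[OF T(1)]] by (simp add: matrix_vector_mul_assoc)

lemma p0_coercive: obtains l where "0 < l" "coercive l (snd p0)"
proof -
  obtain l where l: "0 < l" "\<And>x. l * (norm x)^2 \<le> x \<bullet> (matrix_inv T *v x)"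
    using pds_coercive[OF pds_matrix_inv[OF T(1)]] by blast
  have "coercive (c\<^sup>2 * l\<^sup>2) (snd p0)"
    unfolding coercive_def
  proof
    fix x :: "real^'k"
    have "norm x * (l * norm x) \<le> norm x * norm (matrix_inv T *v x)"
      using order_trans[OF l(2)[of x] norm_cauchy_schwarz] by (simp add: power2_eq_square mult_ac)
    then have "l * norm x \<le> norm (matrix_inv T *v x)" by (cases "x = 0") auto
    then have "(l * norm x)^2 \<le> (norm (matrix_inv T *v x))^2" using l(1) by (intro power_mono) auto
    also have "\<dots> = x \<bullet> (matrix_inv S *v x)"
      unfolding power2_norm_eq_inner Ti_sym by (simp add: inverse_S matrix_vector_mul_assoc)
    finally have "c\<^sup>2 * (l * norm x)^2 \<le> c\<^sup>2 * (x \<bullet> (matrix_inv S *v x))" by (rule mult_left_mono) simp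
    then show "c\<^sup>2 * l\<^sup>2 * (norm x)\<^sup>2 \<le> x \<bullet> (snd p0 *v x)"
      by (simp add: p0_def power_mult_distrib scaleR_matrix_vector_assoc[symmetric])
  qed
  moreover have "0 < c\<^sup>2 * l\<^sup>2" using l(1) c by simp
  ultimately show thesis using that by blast
qed

lemma res_p0: "res p0 (X *v \<beta> + T *v z, X) = T *v z"
  by (simp add: res_def p0_def)

lemma qf_p0: "qf p0 (X *v \<beta> + T *v z, X) = (c * norm z)^2"
proof -
  have "qf p0 (X *v \<beta> + T *v z, X) = c\<^sup>2 * ((T *v z) \<bullet> (matrix_inv S *v (T *v z)))"
    unfolding qf_def res_p0 by (simp add: p0_def scaleR_matrix_vector_assoc[symmetric])
  also have "(T *v z) \<bullet> (matrix_inv S *v (T *v z)) = z \<bullet> z"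
    unfolding inverse_S_T T_sym by (metis Ti_T Ti_sym T_sym)
  finally show ?thesis by (simp add: power_mult_distrib power2_norm_eq_inner)
qed

lemma sqrt_qf_p0: "sqrt (qf p0 (X *v \<beta> + T *v z, X)) = c * norm z"
  using c by (simp add: qf_p0)

lemma abs_c_norm: "\<bar>c * norm y\<bar> = c * norm y"
  using c by (simp add: abs_mult)

text \<open>Fubini. The inner integral has to be known only where it exists, which is the case for almost every
\<open>X\<close>.\<close>

lemma integral_P:
  fixes F :: "('k, 'q) obs \<Rightarrow> real"
  assumes F: "integrable P F"
    and inner: "\<And>X. integrable \<nu> (\<lambda>z. F (X *v \<beta> + T *v z, X)) \<Longrightarrow> (LINT z|\<nu>. F (X *v \<beta> + T *v z, X)) = I X"
    and I: "I \<in> borel_measurable borel"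
  shows "(LINT s|P. F s) = (LINT s|P. I (snd s))"
proof -
  let ?PX = "distr P borel snd"
  let ?H = "\<lambda>(z, X). (X *v \<beta> + T *v z, X :: real^'q^'k)"
  have snd_P: "snd \<in> measurable P borel" by (rule measurable_P) simp
  interpret PX: prob_space ?PX by (rule prob_space_distr[OF snd_P])
  interpret pp: pair_prob_space \<nu> ?PX ..
  have "sets (\<nu> \<Otimes>\<^sub>M ?PX) = sets borel"
    using sets_pair_measure_cong[OF sets_borel sets_distr[of P borel snd]] unfolding borel_prod .
  moreover have "?H \<in> borel_measurable borel"
    unfolding split_beta
    by (intro borel_measurable_continuous_onI continuous_intros bounded_bilinear.continuous_on[OF bounded_bilinear_matrix_vector])
  ultimately have H: "?H \<in> measurable (\<nu> \<Otimes>\<^sub>M ?PX) borel" by (simp cong: measurable_cong_sets)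
  have Fm: "F \<in> borel_measurable borel"
    using F by (simp add: measurable_cong_sets[OF sets_P refl] borel_measurable_integrable[of P F, unfolded measurable_cong_sets[OF sets_P refl]])
  have int: "integrable (\<nu> \<Otimes>\<^sub>M ?PX) (\<lambda>w. F (?H w))"
    using F integrable_distr_eq[OF H Fm] representation by simp
  then have int': "integrable (\<nu> \<Otimes>\<^sub>M ?PX) (case_prod (\<lambda>z X. F (X *v \<beta> + T *v z, X)))"
    by (simp add: split_beta')
  have "(LINT s|P. F s) = (LINT s|(distr (\<nu> \<Otimes>\<^sub>M ?PX) borel ?H). F s)"
    using representation by simp
  also have "\<dots> = (LINT w|(\<nu> \<Otimes>\<^sub>M ?PX). F (?H w))" by (rule integral_distr[OF H Fm])
  also have "\<dots> = (LINT w|(\<nu> \<Otimes>\<^sub>M ?PX). case_prod (\<lambda>z X. F (X *v \<beta> + T *v z, X)) w)" by (simp add: split_beta')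
  also have "\<dots> = (LINT X|?PX. (LINT z|\<nu>. F (X *v \<beta> + T *v z, X)))"
    by (rule pp.integral_snd[OF int', symmetric])
  also have "\<dots> = (LINT X|?PX. I X)"
  proof (rule integral_cong_AE)
    have "AE X in ?PX. integrable \<nu> (\<lambda>z. F (X *v \<beta> + T *v z, X))"
      using pp.AE_integrable_snd[OF int'] .
    then show "AE X in ?PX. (LINT z|\<nu>. F (X *v \<beta> + T *v z, X)) = I X"
      by (rule AE_mp) (rule AE_I2, use inner in blast)
    show "(\<lambda>X. LINT z|\<nu>. F (X *v \<beta> + T *v z, X)) \<in> borel_measurable ?PX"
      using borel_measurable_integrable[OF pp.integrable_snd[OF int']] .
    show "I \<in> borel_measurable ?PX" using I by simp
  qed
  also have "\<dots> = (LINT s|P. I (snd s))" using snd_P I by (rule integral_distr)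
  finally show ?thesis .
qed

text \<open>By symmetry of \<open>\<nu>\<close> an integrand may be replaced by its even part. The integrand is treated as a
whole, so that the integrability of its separate terms does not arise.\<close>

lemma integral_even_part:
  fixes f g :: "real^'k \<Rightarrow> real"
  assumes f: "integrable \<nu> f" and g: "\<And>z. f z + f (- z) = 2 * g z"
  shows "(LINT z|\<nu>. f z) = (LINT z|\<nu>. g z)"
proof -
  have fm: "f \<in> borel_measurable borel" using borel_measurable_integrable[OF f] by (simp add: measurable_iff)
  have u: "uminus \<in> measurable \<nu> borel" by (simp add: measurable_iff)
  have "distr \<nu> borel uminus = \<nu>"
    using rotate[of uminus] by (simp add: orthogonal_transformation_neg orthogonal_transformation_id[unfolded id_def])
  then have f': "integrable \<nu> (\<lambda>z. f (- z))"
    using integrable_distr_eq[OF u fm] f by simp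
  have "(LINT z|\<nu>. g z) = (LINT z|\<nu>. (f z + f (- z)) / 2)" by (simp add: g)
  also have "\<dots> = (LINT z|\<nu>. f z)" using f f' integral_even[OF fm] by simp
  finally show ?thesis by simp
qed

lemma radial_cutoff_integrable:
  assumes [measurable]: "f \<in> borel_measurable borel" and cut: "\<And>s. d \<le> s \<Longrightarrow> f s = 0"
    and K: "\<And>s. 0 \<le> s \<Longrightarrow> \<bar>f s\<bar> \<le> K"
  shows "integrable \<nu> (\<lambda>z. f (c * norm z))" and "integrable \<nu> (\<lambda>z. f (c * norm z) * norm z ^ 2)"
proof -
  have K0: "0 \<le> K" using K[of 0] abs_ge_zero[of "f 0"] by linarith
  show "integrable \<nu> (\<lambda>z. f (c * norm z))"
    using c K by (intro nu.integrable_const_bound[where B=K]) (auto simp: measurable_iff)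
  show "integrable \<nu> (\<lambda>z. f (c * norm z) * norm z ^ 2)"
  proof (rule nu.integrable_const_bound[where B="K * (d / c)^2"])
    show "AE z in \<nu>. norm (f (c * norm z) * norm z ^ 2) \<le> K * (d / c)^2"
    proof (rule AE_I2)
      fix z :: "real^'k"
      show "norm (f (c * norm z) * norm z ^ 2) \<le> K * (d / c)^2"
      proof (cases "d \<le> c * norm z")
        case True then show ?thesis using cut K0 by simp
      next
        case False
        then have "norm z \<le> d / c" using c by (simp add: field_simps)
        then have "norm z ^ 2 \<le> (d / c)^2" by (rule power_mono) simp
        then show ?thesis using K0 K[of "c * norm z"] c by (auto simp: abs_mult intro!: mult_mono)
      qed
    qed
  qed (simp add: measurable_iff)
qed

text \<open>The trace is the squared Frobenius norm of \<open>T\<^sup>-\<^sup>1 M T\<^sup>-\<^sup>1\<close>. This is the positivity that makes the shape part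
of the estimating equation, and the matrix inverted in the influence function, non-singular.\<close>

lemma inverse_weighted_trace_pos:
  assumes sym: "transpose M = M" and "M \<noteq> 0"
  shows "0 < trace (matrix_inv S ** M ** matrix_inv S ** M)"
proof -
  let ?R = "matrix_inv T"
  define F where "F = ?R ** M ** ?R"
  have "transpose ?R = ?R" using pds_matrix_inv[OF T(1)] by (simp add: pds_def)
  then have tF: "transpose F = F" by (simp add: F_def matrix_transpose_mul sym matrix_mul_assoc)
  have "trace (matrix_inv S ** M ** matrix_inv S ** M) = trace (?R ** (?R ** M ** ?R ** ?R ** M))"
    by (simp add: inverse_S matrix_mul_assoc)
  also have "\<dots> = trace ((?R ** M ** ?R ** ?R ** M) ** ?R)" by (rule trace_mul_sym)
  also have "\<dots> = F \<bullet> F"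
    unfolding matrix_inner_eq_trace tF by (simp add: F_def matrix_mul_assoc)
  finally have eq: "trace (matrix_inv S ** M ** matrix_inv S ** M) = F \<bullet> F" .
  have "M = (T ** ?R) ** M ** (?R ** T)" by (simp add: matrix_inv_mult[OF pds_invertible[OF T(1)]])
  then have "M = T ** F ** T" by (simp add: F_def matrix_mul_assoc)
  then have "F \<noteq> 0"
    using assms(2) by (auto simp: bounded_bilinear.zero_left[OF bounded_bilinear_matrix_mult] bounded_bilinear.zero_right[OF bounded_bilinear_matrix_mult])
  then show ?thesis unfolding eq by simp
qed

context
  fixes \<rho> :: "real \<Rightarrow> real"
  assumes \<rho>: "loss_function \<rho>"
begin

lemma u_moment_integrable: "integrable \<nu> (\<lambda>z. u_fun \<rho> (c * norm z) * norm z ^ 2)"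
  and u_integrable: "integrable \<nu> (\<lambda>z. u_fun \<rho> (c * norm z))"
proof -
  obtain d where d: "\<And>s. d \<le> s \<Longrightarrow> u_fun \<rho> s = 0" using loss_cutoff[OF \<rho>] by metis
  obtain K where K: "\<And>s. 0 \<le> s \<Longrightarrow> \<bar>u_fun \<rho> s\<bar> \<le> K" using u_bounded[OF \<rho>] by metis
  note I = radial_cutoff_integrable[OF u_borel_measurable[OF \<rho>] d K]
  show "integrable \<nu> (\<lambda>z. u_fun \<rho> (c * norm z) * norm z ^ 2)" by (rule I(2))
  show "integrable \<nu> (\<lambda>z. u_fun \<rho> (c * norm z))" by (rule I(1))
qed

text \<open>The \<open>\<beta>\<close>-direction contributes an odd integrand, so only the direction of \<open>A\<close> is left, through a second
moment.\<close>

lemma loss_functional_derivative_at_model: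
  "(LINT s|P. u_fun \<rho> (sqrt (qf p0 s)) / 2 * dqf p0 s v) =
     (LINT z|\<nu>. u_fun \<rho> (c * norm z) * norm z ^ 2) / real CARD('k) * trace (S ** snd v) / 2"
proof -
  obtain l where l: "0 < l" "coercive l (snd p0)" by (rule p0_coercive)
  let ?I = "(LINT z|\<nu>. u_fun \<rho> (c * norm z) * norm z ^ 2) / real CARD('k) * trace (S ** snd v) / 2"
  note [measurable] = u_borel_measurable[OF \<rho>]
  have "(LINT s|P. u_fun \<rho> (sqrt (qf p0 s)) / 2 * dqf p0 s v) = (LINT s|P. (\<lambda>_. ?I) (snd s))"
  proof (rule integral_P[OF loss_functional_has_derivative(2)[OF \<rho> l]])
    fix X :: "real^'q^'k"
    assume int: "integrable \<nu> (\<lambda>z. u_fun \<rho> (sqrt (qf p0 (X *v \<beta> + T *v z, X))) / 2 * dqf p0 (X *v \<beta> + T *v z, X) v)"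
    have f: "u_fun \<rho> (sqrt (qf p0 (X *v \<beta> + T *v y, X))) / 2 * dqf p0 (X *v \<beta> + T *v y, X) v =
      u_fun \<rho> (c * norm y) / 2 * ((T *v y) \<bullet> (snd v *v (T *v y)) - (X *v fst v) \<bullet> (snd p0 *v (T *v y)) - (T *v y) \<bullet> (snd p0 *v (X *v fst v)))" for y
      by (simp add: sqrt_qf_p0 dqf_def res_p0)
    have "(LINT z|\<nu>. u_fun \<rho> (sqrt (qf p0 (X *v \<beta> + T *v z, X))) / 2 * dqf p0 (X *v \<beta> + T *v z, X) v) =
      (LINT z|\<nu>. u_fun \<rho> (c * norm z) * (z \<bullet> ((T ** snd v ** T) *v z)) / 2)"
      by (rule integral_even_part[OF int], unfold f)
        (simp add: T_sym field_simps flip: matrix_vector_mul_assoc)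
    also have "\<dots> = (LINT z|\<nu>. u_fun \<rho> (c * norm z) * norm z ^ 2) / real CARD('k) * trace (T ** snd v ** T) / 2"
      using radial_quadratic_form(2)[of "\<lambda>s. u_fun \<rho> (c * s)" "T ** snd v ** T"] u_moment_integrable by simp
    also have "trace (T ** snd v ** T) = trace (S ** snd v)"
      by (metis T(2) matrix_mul_assoc trace_mul_sym)
    finally show "(LINT z|\<nu>. u_fun \<rho> (sqrt (qf p0 (X *v \<beta> + T *v z, X))) / 2 * dqf p0 (X *v \<beta> + T *v z, X) v) = ?I" .
  qed simp
  then show ?thesis using prob_space by simp
qed

context
  assumes C2: "deriv \<rho> C1_differentiable_on UNIV"
begin

lemma tau_integrable: "integrable \<nu> (\<lambda>z. tau_fun \<rho> (c * norm z))"
  and tau_moment_integrable: "integrable \<nu> (\<lambda>z. tau_fun \<rho> (c * norm z) * norm z ^ 2)"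
proof -
  obtain d where d: "\<And>s. d \<le> s \<Longrightarrow> tau_fun \<rho> s = 0" using tau_cutoff[OF \<rho> C2] by metis
  obtain K where K: "\<And>s. 0 \<le> s \<Longrightarrow> \<bar>tau_fun \<rho> s\<bar> \<le> K" using tau_bounded[OF \<rho> C2] by metis
  note I = radial_cutoff_integrable[OF tau_borel_measurable[OF \<rho> C2] d K]
  show "integrable \<nu> (\<lambda>z. tau_fun \<rho> (c * norm z))" by (rule I(1))
  show "integrable \<nu> (\<lambda>z. tau_fun \<rho> (c * norm z) * norm z ^ 2)" by (rule I(2))
qed

text \<open>These three constants carry all that the model derivatives need to know about the noise law. Up to
factors, \<open>reg_const\<close> is the constant \<open>\<alpha>\<^sub>1\<close> of the theorem and a combination of the other two is \<open>\<gamma>\<^sub>1\<close>.\<close>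

definition scatter_const where "scatter_const = (LINT z|\<nu>. u_fun \<rho> (c * norm z) * norm z ^ 2) / real CARD('k)"
definition tau_const where
  "tau_const = (LINT z|\<nu>. tau_fun \<rho> (c * norm z) * norm z ^ 2) / (2 * c\<^sup>2 * (real CARD('k) * (real CARD('k) + 2)))"
definition reg_const where
  "reg_const = (LINT z|\<nu>. u_fun \<rho> (c * norm z)) + (LINT z|\<nu>. tau_fun \<rho> (c * norm z)) / real CARD('k)"

text \<open>A matrix is determined by its inner products with all \<open>G\<close>; each of these is a radial second moment.\<close>

lemma scatter_functional_at_model:
  "(\<integral>s. outer (wres \<rho> p0 s) (res p0 s) \<partial>P) = scatter_const *\<^sub>R S"
proof (rule vector_eq_ldot[THEN iffD1], rule allI)
  fix G :: "real^'k^'k"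
  obtain l where l: "0 < l" "coercive l (snd p0)" by (rule p0_coercive)
  note int = scatter_functional_has_derivative(3)[OF \<rho> l C2]
  note [measurable] = u_borel_measurable[OF \<rho>]
  have "G \<bullet> (\<integral>s. outer (wres \<rho> p0 s) (res p0 s) \<partial>P) = (LINT s|P. G \<bullet> outer (wres \<rho> p0 s) (res p0 s))"
    using int by simp
  also have "\<dots> = (LINT s|P. (\<lambda>_. scatter_const * trace (T ** G ** T)) (snd s))"
  proof (rule integral_P)
    show "integrable P (\<lambda>s. G \<bullet> outer (wres \<rho> p0 s) (res p0 s))" using int by simp
    fix X :: "real^'q^'k"
    have "G \<bullet> outer (wres \<rho> p0 (X *v \<beta> + T *v z, X)) (res p0 (X *v \<beta> + T *v z, X)) =
      u_fun \<rho> (c * norm z) * (z \<bullet> ((T ** G ** T) *v z))" for z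
      by (simp add: inner_outer wres_def sqrt_qf_p0 res_p0 T_sym flip: matrix_vector_mul_assoc)
    then show "(LINT z|\<nu>. G \<bullet> outer (wres \<rho> p0 (X *v \<beta> + T *v z, X)) (res p0 (X *v \<beta> + T *v z, X))) = scatter_const * trace (T ** G ** T)"
      using radial_quadratic_form(2)[of "\<lambda>s. u_fun \<rho> (c * s)" "T ** G ** T"] u_moment_integrable
      by (simp add: scatter_const_def)
  qed simp
  also have "\<dots> = G \<bullet> (scatter_const *\<^sub>R S)"
  proof -
    have "trace (T ** G ** T) = trace (S ** G)" by (metis T(2) matrix_mul_assoc trace_mul_sym)
    also have "\<dots> = S \<bullet> G"
    proof -
      have "transpose S = S" using T by (metis matrix_transpose_mul pds_def)
      then show ?thesis by (simp add: matrix_inner_eq_trace)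
    qed
    finally show ?thesis using prob_space by (simp add: inner_commute)
  qed
  finally show "G \<bullet> (\<integral>s. outer (wres \<rho> p0 s) (res p0 s) \<partial>P) = G \<bullet> (scatter_const *\<^sub>R S)" .
qed

text \<open>The \<open>\<beta>\<close>-direction is odd and drops out. The variation of the weight contributes the fourth moment,
which produces a trace product and a Frobenius product.\<close>

lemma scatter_derivative_at_model:
  fixes G :: "real^'k^'k"
  assumes sym: "transpose G = G"
  shows "G \<bullet> (\<integral>s. outer (dwres \<rho> p0 s v) (res p0 s) - outer (wres \<rho> p0 s) (snd s *v fst v) \<partial>P) =
    tau_const * (trace (S ** snd v) * trace (S ** G) + 2 * (G \<bullet> (S ** snd v ** S)))"
proof -
  obtain l where l: "0 < l" "coercive l (snd p0)" by (rule p0_coercive)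
  note int = scatter_functional_has_derivative(2)[OF \<rho> l C2]
  note [measurable] = tau_borel_measurable[OF \<rho> C2]
  define E where "E = T ** snd v ** T"
  define B where "B = T ** G ** T"
  \<comment> \<open>The value of this profile at \<open>0\<close> is immaterial, since it is multiplied by \<open>\<parallel>z\<parallel>\<^sup>4\<close>.\<close>
  define g where "g = (\<lambda>s. tau_fun \<rho> (c * s) / (2 * (c * s)^2))"
  have gm: "g \<in> borel_measurable borel" unfolding g_def by measurable
  have tS: "transpose S = S" and tT: "transpose T = T" using T by (metis matrix_transpose_mul pds_def)+
  have g4: "g (norm z) * norm z ^ 4 = tau_fun \<rho> (c * norm z) * norm z ^ 2 / (2 * c\<^sup>2)" for z :: "real^'k"
    using c tau_0[OF \<rho> C2] by (cases "z = 0") (auto simp: g_def field_simps power_mult_distrib power2_eq_square power4_eq_xxxx)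
  have gint: "integrable \<nu> (\<lambda>z. g (norm z) * norm z ^ 4)" unfolding g4 using tau_moment_integrable by simp
  have tc: "(LINT z|\<nu>. g (norm z) * norm z ^ 4) / (real CARD('k) * (real CARD('k) + 2)) = tau_const"
    unfolding g4 tau_const_def by simp
  let ?I = "tau_const * (trace E * trace B + E \<bullet> B + E \<bullet> transpose B)"
  have "G \<bullet> (\<integral>s. outer (dwres \<rho> p0 s v) (res p0 s) - outer (wres \<rho> p0 s) (snd s *v fst v) \<partial>P) =
     (LINT s|P. G \<bullet> (outer (dwres \<rho> p0 s v) (res p0 s) - outer (wres \<rho> p0 s) (snd s *v fst v)))"
    using int by simp
  also have "\<dots> = (LINT s|P. (\<lambda>_. ?I) (snd s))"
  proof (rule integral_P)
    show "integrable P (\<lambda>s. G \<bullet> (outer (dwres \<rho> p0 s v) (res p0 s) - outer (wres \<rho> p0 s) (snd s *v fst v)))"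
      using int by simp
    fix X :: "real^'q^'k"
    let ?f = "\<lambda>z. G \<bullet> (outer (dwres \<rho> p0 (X *v \<beta> + T *v z, X) v) (res p0 (X *v \<beta> + T *v z, X))
       - outer (wres \<rho> p0 (X *v \<beta> + T *v z, X)) (snd (X *v \<beta> + T *v z, X) *v fst v))"
    assume fint: "integrable \<nu> ?f"
    have "(LINT z|\<nu>. ?f z) = (LINT z|\<nu>. g (norm z) * ((z \<bullet> (E *v z)) * (z \<bullet> (B *v z))))"
    proof (rule integral_even_part[OF fint])
      fix z :: "real^'k"
      define t where "t = (\<lambda>y::real^'k. tau_fun \<rho> (c * norm y) / (2 * (c * norm y)^2))"
      have f: "?f y = t y * ((T *v y) \<bullet> (snd v *v (T *v y)) - (X *v fst v) \<bullet> (snd p0 *v (T *v y)) - (T *v y) \<bullet> (snd p0 *v (X *v fst v)))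
           * ((T *v y) \<bullet> (G *v (T *v y)))
         - u_fun \<rho> (c * norm y) * ((X *v fst v) \<bullet> (G *v (T *v y))) - u_fun \<rho> (c * norm y) * ((T *v y) \<bullet> (G *v (X *v fst v)))" for y
        by (simp add: t_def inner_diff_right inner_outer wres_def dwres_def qf_p0 res_p0 dqf_def inner_diff_left abs_c_norm)
      have tz: "t (- z) = t z" "t z = g (norm z)" by (simp_all add: t_def g_def)
      have EB: "z \<bullet> (E *v z) = (T *v z) \<bullet> (snd v *v (T *v z))" "z \<bullet> (B *v z) = (T *v z) \<bullet> (G *v (T *v z))"
        by (simp_all add: E_def B_def T_sym flip: matrix_vector_mul_assoc)
      show "?f z + ?f (- z) = 2 * (g (norm z) * ((z \<bullet> (E *v z)) * (z \<bullet> (B *v z))))"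
        unfolding f tz(1) EB tz(2)[symmetric] by (simp add: algebra_simps)
    qed
    also have "\<dots> = ?I" using radial_quadratic_form_product(2)[OF gm gint, of E B] tc by simp
    finally show "(LINT z|\<nu>. ?f z) = ?I" .
  qed simp
  also have "\<dots> = ?I" using prob_space by simp
  also have "trace E = trace (S ** snd v)" unfolding E_def by (metis T(2) matrix_mul_assoc trace_mul_sym)
  also have "trace B = trace (S ** G)" unfolding B_def by (metis T(2) matrix_mul_assoc trace_mul_sym)
  also have "transpose B = B" unfolding B_def by (simp add: matrix_transpose_mul tT sym matrix_mul_assoc)
  also have "E \<bullet> B = G \<bullet> (S ** snd v ** S)"
  proof -
    have "B \<bullet> E = trace (B ** E)" using \<open>transpose B = B\<close> by (simp add: matrix_inner_eq_trace)
    also have "\<dots> = trace (T ** (G ** T ** T ** snd v ** T))" by (simp add: B_def E_def matrix_mul_assoc)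
    also have "\<dots> = trace ((G ** T ** T ** snd v ** T) ** T)" by (rule trace_mul_sym)
    also have "\<dots> = trace (G ** (S ** snd v ** S))" unfolding T(2)[symmetric] by (simp add: matrix_mul_assoc)
    also have "\<dots> = G \<bullet> (S ** snd v ** S)" by (simp add: matrix_inner_eq_trace sym)
    finally show ?thesis by (simp add: inner_commute)
  qed
  finally show ?thesis by (simp add: algebra_simps)
qed

text \<open>The integrand is odd in the noise.\<close>

lemma regression_functional_at_model:
  "(\<integral>s. (snd p0 *v wres \<rho> p0 s) v* snd s \<partial>P) = 0"
proof (rule vector_eq_ldot[THEN iffD1], rule allI)
  fix b :: "real^'q"
  obtain l where l: "0 < l" "coercive l (snd p0)" by (rule p0_coercive)
  note int = regression_functional_has_derivative(3)[OF \<rho> l C2]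
  have "b \<bullet> (\<integral>s. (snd p0 *v wres \<rho> p0 s) v* snd s \<partial>P) = (LINT s|P. b \<bullet> ((snd p0 *v wres \<rho> p0 s) v* snd s))"
    using int by simp
  also have "\<dots> = (LINT s|P. (\<lambda>_. 0) (snd s))"
  proof (rule integral_P)
    show "integrable P (\<lambda>s. b \<bullet> ((snd p0 *v wres \<rho> p0 s) v* snd s))" using int by simp
    fix X :: "real^'q^'k"
    let ?f = "\<lambda>z. b \<bullet> ((snd p0 *v wres \<rho> p0 (X *v \<beta> + T *v z, X)) v* snd (X *v \<beta> + T *v z, X))"
    assume fint: "integrable \<nu> ?f"
    have f: "?f y = u_fun \<rho> (c * norm y) * ((snd p0 *v (T *v y)) \<bullet> (X *v b))" for y
      by (simp add: inner_commute[of b] dot_lmul_matrix wres_def qf_p0 res_p0 abs_c_norm matrix_vector_mult_scaleR)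
    have "(LINT z|\<nu>. ?f z) = (LINT z|\<nu>. 0)"
      by (rule integral_even_part[OF fint], unfold f) simp
    then show "(LINT z|\<nu>. ?f z) = 0" by simp
  qed simp
  finally show "b \<bullet> (\<integral>s. (snd p0 *v wres \<rho> p0 s) v* snd s \<partial>P) = b \<bullet> 0" by simp
qed

text \<open>The direction of \<open>A\<close> is odd and drops out, so the derivative is a multiple of
\<open>\<beta>' \<mapsto> E [X\<^sup>T S\<^sup>-\<^sup>1 X] \<beta>'\<close>; the factor combines the weight with the second moment of its variation.\<close>

lemma regression_derivative_at_model:
  "b \<bullet> (\<integral>s. (snd p0 *v dwres \<rho> p0 s v + snd v *v wres \<rho> p0 s) v* snd s \<partial>P) =
    - (c\<^sup>2 * reg_const) * (LINT s|P. (matrix_inv T *v (snd s *v fst v)) \<bullet> (matrix_inv T *v (snd s *v b)))"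
proof -
  obtain l where l: "0 < l" "coercive l (snd p0)" by (rule p0_coercive)
  note int = regression_functional_has_derivative(2)[OF \<rho> l C2]
  note [measurable] = tau_borel_measurable[OF \<rho> C2]
  define g where "g = (\<lambda>s. tau_fun \<rho> (c * s) / s^2)"
  have gm: "g \<in> borel_measurable borel" unfolding g_def by measurable
  have g2: "g (norm z) * norm z ^ 2 = tau_fun \<rho> (c * norm z)" for z :: "real^'k"
    using c tau_0[OF \<rho> C2] by (cases "z = 0") (auto simp: g_def)
  have gint: "integrable \<nu> (\<lambda>z. g (norm z) * norm z ^ 2)" unfolding g2 by (rule tau_integrable)
  let ?e = "\<lambda>X. matrix_inv T *v (X *v fst v)" and ?b = "\<lambda>X. matrix_inv T *v (X *v b)"
  let ?I = "\<lambda>X. - (c\<^sup>2 * reg_const) * (?e X \<bullet> ?b X)"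
  have "b \<bullet> (\<integral>s. (snd p0 *v dwres \<rho> p0 s v + snd v *v wres \<rho> p0 s) v* snd s \<partial>P) =
    (LINT s|P. b \<bullet> ((snd p0 *v dwres \<rho> p0 s v + snd v *v wres \<rho> p0 s) v* snd s))"
    using int by simp
  also have "\<dots> = (LINT s|P. ?I (snd s))"
  proof (rule integral_P)
    show "integrable P (\<lambda>s. b \<bullet> ((snd p0 *v dwres \<rho> p0 s v + snd v *v wres \<rho> p0 s) v* snd s))" using int by simp
    show "?I \<in> borel_measurable borel" by measurable
    fix X :: "real^'q^'k"
    let ?f = "\<lambda>z. b \<bullet> ((snd p0 *v dwres \<rho> p0 (X *v \<beta> + T *v z, X) v + snd v *v wres \<rho> p0 (X *v \<beta> + T *v z, X)) v* snd (X *v \<beta> + T *v z, X))"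
    assume fint: "integrable \<nu> ?f"
    have "(LINT z|\<nu>. ?f z) = (LINT z|\<nu>. - c\<^sup>2 * (g (norm z) * ((z \<bullet> ?e X) * (z \<bullet> ?b X)) + u_fun \<rho> (c * norm z) * (?e X \<bullet> ?b X)))"
    proof (rule integral_even_part[OF fint])
      fix z :: "real^'k"
      have A: "snd p0 *v x = c\<^sup>2 *\<^sub>R (matrix_inv S *v x)" for x
        by (simp add: p0_def scaleR_matrix_vector_assoc)
      have 1: "(matrix_inv S *v (T *v z)) \<bullet> y = z \<bullet> (matrix_inv T *v y)" for y z
        by (simp add: inverse_S_T Ti_sym)
      have 2: "(matrix_inv S *v (X *v fst v)) \<bullet> (X *v b) = ?e X \<bullet> ?b X"
        by (simp add: inverse_S Ti_sym flip: matrix_vector_mul_assoc)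
      define w where "w = snd v *v (T *v z)"
      have dq: "dqf p0 (X *v \<beta> + T *v y, X) v = (T *v y) \<bullet> (snd v *v (T *v y)) - 2 * c\<^sup>2 * (y \<bullet> ?e X)" for y
      proof -
        have "(X *v fst v) \<bullet> (matrix_inv S *v (T *v y)) = y \<bullet> ?e X"
          using 1[of y "X *v fst v"] by (simp add: inner_commute)
        moreover have "(T *v y) \<bullet> (matrix_inv S *v (X *v fst v)) = y \<bullet> ?e X"
          using 1[of y "X *v fst v"] by (simp flip: Si_sym)
        ultimately show ?thesis by (simp add: dqf_def res_p0 A)
      qed
      have fz: "?f y = tau_fun \<rho> (c * norm y) / (2 * (c * norm y)^2) * ((T *v y) \<bullet> (snd v *v (T *v y)) - 2 * c\<^sup>2 * (y \<bullet> ?e X)) * (c\<^sup>2 * (y \<bullet> ?b X))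
         - u_fun \<rho> (c * norm y) * c\<^sup>2 * (?e X \<bullet> ?b X) + u_fun \<rho> (c * norm y) * ((snd v *v (T *v y)) \<bullet> (X *v b))" for y
        by (simp add: inner_commute[of b] dot_lmul_matrix inner_add_left A dwres_def wres_def qf_p0 res_p0 dq abs_c_norm
            matrix_vector_mult_scaleR bounded_bilinear.diff_right[OF bounded_bilinear_matrix_vector] inner_diff_left 1 2)
      have half: "tau_fun \<rho> (c * norm z) / (2 * (c * norm z)^2) * (2 * c\<^sup>2) = g (norm z)"
        using c by (simp add: g_def power_mult_distrib)
      show "?f z + ?f (- z) = 2 * (- c\<^sup>2 * (g (norm z) * ((z \<bullet> ?e X) * (z \<bullet> ?b X)) + u_fun \<rho> (c * norm z) * (?e X \<bullet> ?b X)))"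
        unfolding fz half[symmetric] by (simp add: algebra_simps)
    qed
    also have "\<dots> = - c\<^sup>2 * ((LINT z|\<nu>. g (norm z) * ((z \<bullet> ?e X) * (z \<bullet> ?b X))) + (LINT z|\<nu>. u_fun \<rho> (c * norm z)) * (?e X \<bullet> ?b X))"
      using integrable_radial_product[OF gm gint] u_integrable by simp
    also have "\<dots> = ?I X"
      unfolding radial_second_moment[OF gm gint] g2 reg_const_def by (simp add: algebra_simps)
    finally show "(LINT z|\<nu>. ?f z) = ?I X" .
  qed
  also have "\<dots> = - (c\<^sup>2 * reg_const) * (LINT s|P. ?e (snd s) \<bullet> ?b (snd s))" by simp
  finally show ?thesis .
qed

end
end
end

section \<open>Stationarity under contamination\<close>

lemma local_min_along_curve:
  fixes J :: "'a::real_normed_vector \<Rightarrow> real"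
  assumes J: "(J has_derivative D) (at (\<phi> 0))"
    and \<phi>: "(\<phi> has_vector_derivative \<phi>') (at 0)"
    and le: "\<forall>\<^sub>F t in at 0. J (\<phi> 0) \<le> J (\<phi> t)"
  shows "D \<phi>' = 0"
proof -
  have "((\<lambda>t. J (\<phi> t)) has_derivative (\<lambda>t. D (t *\<^sub>R \<phi>'))) (at 0)"
    using has_derivative_compose[OF \<phi>[unfolded has_vector_derivative_def] J] .
  moreover have "D (t *\<^sub>R \<phi>') = D \<phi>' * t" for t
    using linear_scale[OF bounded_linear.linear[OF has_derivative_bounded_linear[OF J]], of t \<phi>'] by simp
  ultimately have der: "((\<lambda>t. J (\<phi> t)) has_real_derivative D \<phi>') (at 0)"
    by (simp add: has_field_derivative_def)
  obtain d where d: "0 < d" "\<And>t. t \<noteq> 0 \<Longrightarrow> dist t 0 < d \<Longrightarrow> J (\<phi> 0) \<le> J (\<phi> t)"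
    using le unfolding eventually_at by auto
  show ?thesis
  proof (rule DERIV_local_min[OF der d(1)], intro allI impI)
    fix t :: real assume "\<bar>0 - t\<bar> < d"
    then show "J (\<phi> 0) \<le> J (\<phi> t)" using d(2)[of t] by (cases "t = 0") (auto simp: dist_real_def)
  qed
qed

text \<open>The minimum is over a punctured neighbourhood; where the curve returns to its base point the inequality
is trivial.\<close>

lemma local_min_on_curve:
  fixes \<psi> :: "real \<Rightarrow> 'a::topological_space"
  assumes min: "local_min_on f D (\<psi> 0)" and \<psi>: "(\<psi> \<longlongrightarrow> \<psi> 0) (at 0)"
    and D: "\<forall>\<^sub>F t in at 0. \<psi> t \<in> D"
  shows "\<forall>\<^sub>F t in at 0. f (\<psi> 0) \<le> f (\<psi> t)"
proof -
  obtain U where U: "open U" "\<psi> 0 \<in> U" "\<And>p. p \<in> U \<Longrightarrow> p \<noteq> \<psi> 0 \<Longrightarrow> p \<in> D \<Longrightarrow> f (\<psi> 0) \<le> f p"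
    using min unfolding local_min_on_def eventually_at_topological by blast
  have "\<forall>\<^sub>F t in at 0. \<psi> t \<in> U" using \<psi> U(1,2) by (rule topological_tendstoD)
  then show ?thesis using D
  proof eventually_elim
    case (elim t)
    then show ?case using U(3)[of "\<psi> t"] by (cases "\<psi> t = \<psi> 0") auto
  qed
qed

lemma det_scaleR: "det (r *\<^sub>R (A::real^'k^'k)) = r ^ CARD('k) * det A"
proof -
  have "r *\<^sub>R A = (\<chi> i. r *s A $ i)" by (simp add: vec_eq_iff)
  then show ?thesis using det_rows_mul[of "\<lambda>_. r" "\<lambda>i. A $ i"] by simp
qed

text \<open>The passage from shape and scale to the parameter \<open>(\<beta>, C\<^sup>-\<^sup>1 / \<sigma>\<^sup>2)\<close>.\<close>

lemma mahal_eq_sqrt_qf: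
  fixes C :: "real^'k^'k" and s :: "('k::finite, 'q::finite) obs"
  assumes "0 < \<sigma>"
  shows "mahal b C s / \<sigma> = sqrt (qf (b, (1 / \<sigma>\<^sup>2) *\<^sub>R matrix_inv C) s)"
  using assms
  by (simp add: mahal_def qf_def res_def split_beta scaleR_matrix_vector_assoc[symmetric]
      real_sqrt_divide)

text \<open>The linear extension of the covariance map to all of \<open>\<real>\<^sup>l\<close>, including directions in which the matrix is
not positive definite.\<close>

definition lin_struct :: "('l::finite \<Rightarrow> real^'k^'k) \<Rightarrow> real^'l \<Rightarrow> real^'k^'k" where
  "lin_struct Ls g = (\<Sum>j\<in>UNIV. g $ j *\<^sub>R Ls j)"

lemma linear_lin_struct: "linear (lin_struct Ls)"
  by (rule linearI) (simp_all add: lin_struct_def sum.distrib scaleR_sum_right algebra_simps)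

lemma bounded_linear_lin_struct: "bounded_linear (lin_struct Ls)"
  using linear_lin_struct by (simp add: linear_conv_bounded_linear)

text \<open>For \<open>a = C\<^sup>-\<^sup>1\<close> with \<open>|C| = 1\<close> this is the derivative of \<open>ninv\<close> at \<open>C\<close> in the direction \<open>B\<close>: the velocity of the
inverse shape when the covariance is moved by \<open>B\<close> and rescaled to determinant one.\<close>

definition shape_gradient :: "real^'k^'k \<Rightarrow> real^'k^'k \<Rightarrow> real^'k^'k" where
  "shape_gradient a B = (trace (a ** B) / real CARD('k)) *\<^sub>R a - a ** B ** a"

text \<open>The derivative of the loss in \<open>p\<close>, written as the gradient components that the scatter and regression
functionals integrate.\<close>

lemma loss_derivative_split:
  assumes sym: "transpose (snd p) = snd p"
  shows "u_fun \<rho> (sqrt (qf p s)) / 2 * dqf p s (b', A') =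
    outer (wres \<rho> p s) (res p s) \<bullet> A' / 2 - b' \<bullet> ((snd p *v wres \<rho> p s) v* snd s)"
proof -
  let ?u = "u_fun \<rho> (sqrt (qf p s))" and ?r = "res p s" and ?A = "snd p" and ?x = "snd s *v b'"
  have "?r v* ?A = transpose ?A *v ?r" by simp
  then have rA: "?r v* ?A = ?A *v ?r" unfolding sym .
  have "?r \<bullet> (?A *v ?x) = (?r v* ?A) \<bullet> ?x" by (rule dot_lmul_matrix[symmetric])
  then have "?r \<bullet> (?A *v ?x) = ?x \<bullet> (?A *v ?r)" unfolding rA by (simp only: inner_commute)
  then have d: "dqf p s (b', A') = ?r \<bullet> (A' *v ?r) - 2 * (?x \<bullet> (?A *v ?r))" by (simp add: dqf_def)
  have "b' \<bullet> ((?A *v wres \<rho> p s) v* snd s) = ((?A *v wres \<rho> p s) v* snd s) \<bullet> b'"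
    by (rule inner_commute)
  also have "\<dots> = (?A *v wres \<rho> p s) \<bullet> ?x" by (rule dot_lmul_matrix)
  also have "\<dots> = ?x \<bullet> (?A *v wres \<rho> p s)" by (rule inner_commute)
  also have "\<dots> = ?u * (?x \<bullet> (?A *v ?r))" by (simp add: wres_def matrix_vector_mult_scaleR)
  finally have b: "b' \<bullet> ((?A *v wres \<rho> p s) v* snd s) = ?u * (?x \<bullet> (?A *v ?r))" .
  have "outer (wres \<rho> p s) ?r \<bullet> A' = A' \<bullet> outer (wres \<rho> p s) ?r" by (rule inner_commute)
  also have "\<dots> = ?u * (?r \<bullet> (A' *v ?r))" unfolding inner_outer by (simp add: wres_def)
  finally have o: "outer (wres \<rho> p s) ?r \<bullet> A' = ?u * (?r \<bullet> (A' *v ?r))" .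
  show ?thesis unfolding d b o by (simp add: right_diff_distrib)
qed

context second_moment_design
begin

lemma objective_contaminate:
  fixes s0 :: "('k, 'q) obs"
  assumes \<rho>: "loss_function \<rho>" and h: "0 \<le> h" "h \<le> 1" and p: "coercive l (snd p)" "0 < l"
  shows "(LINT s|contaminate P s0 h. \<rho> (sqrt (qf p s))) =
    (1 - h) * (LINT s|P. \<rho> (sqrt (qf p s))) + h * \<rho> (sqrt (qf p s0))"
proof -
  obtain c where c: "\<And>s. 0 \<le> s \<Longrightarrow> \<rho> s \<le> \<rho> c" using loss_cutoff[OF \<rho>] by metis
  note [measurable] = loss_borel_measurable[OF \<rho>]
  have nn: "0 \<le> sqrt (qf p s)" for s
    using p unfolding coercive_def qf_def
    by (meson less_imp_le mult_nonneg_nonneg order_trans real_sqrt_ge_zero zero_le_power2)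
  have m: "(\<lambda>s. \<rho> (sqrt (qf p s))) \<in> borel_measurable P" by (rule measurable_P) measurable
  have "space P = UNIV" using sets_eq_imp_space_eq[OF sets_P] by simp
  then show ?thesis
    using \<rho> c[OF nn] h m
    by (intro integral_contaminate[where B="\<rho> c"] prob_space_axioms) (auto simp: loss_function_def)
qed

text \<open>The objective is differentiable in \<open>(\<beta>, A)\<close>, so its derivative vanishes along every curve of feasible
points. Lines in \<open>\<beta>\<close> are feasible. A line \<open>\<gamma> + t g\<close> leaves the set of determinant one; dividing it by
\<open>|V (\<gamma> + t g)|\<^sup>1\<^sup>/\<^sup>k\<close> restores the constraint by linearity of \<open>V\<close> and keeps it in \<open>\<Theta>\<close> for small
\<open>t\<close> since \<open>\<gamma>\<close> is an interior point. The inverse shape along that curve is \<open>ninv (V (\<gamma> + t g))\<close>, with velocity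
\<open>shape_gradient\<close>.\<close>

lemma contaminated_stationarity:
  fixes s0 :: "('k, 'q) obs" and Ls :: "'l::finite \<Rightarrow> real^'k^'k"
  assumes \<rho>: "loss_function \<rho>" "deriv \<rho> C1_differentiable_on UNIV"
    and h: "0 \<le> h" "h \<le> 1" and \<sigma>: "0 < \<sigma>"
    and V: "\<And>\<theta>. \<theta> \<in> \<Theta> \<Longrightarrow> V \<theta> = lin_struct Ls \<theta>" "\<And>\<theta>. \<theta> \<in> \<Theta> \<Longrightarrow> pds (V \<theta>)"
    and min: "local_min_on (\<lambda>(b, g). objective \<rho> (contaminate P s0 h) \<sigma> b (V g)) (feasible V \<Theta>) (b, \<gamma>)"
    and \<gamma>: "\<gamma> \<in> interior \<Theta>"
  defines "p \<equiv> (b, (1 / \<sigma>\<^sup>2) *\<^sub>R matrix_inv (lin_struct Ls \<gamma>))"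
  shows "(1 - h) *\<^sub>R (\<integral>s. (snd p *v wres \<rho> p s) v* snd s \<partial>P) + h *\<^sub>R ((snd p *v wres \<rho> p s0) v* snd s0) = 0"
    and "(1 - h) * ((\<integral>s. outer (wres \<rho> p s) (res p s) \<partial>P) \<bullet> shape_gradient (matrix_inv (lin_struct Ls \<gamma>)) (lin_struct Ls g))
       + h * (outer (wres \<rho> p s0) (res p s0) \<bullet> shape_gradient (matrix_inv (lin_struct Ls \<gamma>)) (lin_struct Ls g)) = 0"
proof -
  let ?W = "lin_struct Ls" and ?Q = "contaminate P s0 h"
  let ?C = "?W \<gamma>"
  let ?a = "matrix_inv ?C"
  have \<gamma>\<Theta>: "\<gamma> \<in> \<Theta>" using \<gamma> interior_subset[of \<Theta>] by blast
  define F where "F = (\<lambda>(b, g). objective \<rho> ?Q \<sigma> b (V g))"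
  have minF: "local_min_on F (feasible V \<Theta>) (b, \<gamma>)" using min by (simp only: F_def)
  have pC: "pds ?C" and dC: "det ?C = 1"
    using min V \<gamma>\<Theta> by (auto simp: local_min_on_def feasible_def)
  have pa: "pds ?a" using pC by (rule pds_matrix_inv)
  obtain l where l0: "0 < l" "coercive l ?a" using pds_coercive[OF pa] unfolding coercive_def by metis
  define l' where "l' = l / \<sigma>\<^sup>2"
  have l: "0 < l'" "coercive l' (snd p)"
    using l0 \<sigma> by (auto simp: l'_def p_def coercive_def scaleR_matrix_vector_assoc[symmetric] divide_right_mono)
  have sym: "transpose (snd p) = snd p"
    using pa by (simp add: p_def pds_def transpose_def vec_eq_iff)
  \<comment> \<open>the objective in the parameter \<open>(\<beta>, A)\<close>, without the constraint that \<open>A\<close> comes from the structure\<close>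
  define J where "J = (\<lambda>p. (1 - h) * (LINT s|P. \<rho> (sqrt (qf p s))) + h * \<rho> (sqrt (qf p s0)))"
  have obj: "objective \<rho> ?Q \<sigma> b' (V \<theta>) = J (b', (1 / \<sigma>\<^sup>2) *\<^sub>R matrix_inv (?W \<theta>))" if "\<theta> \<in> \<Theta>" for b' \<theta>
  proof -
    have "pds (matrix_inv (?W \<theta>))" using V that by (metis pds_matrix_inv)
    then obtain m where m: "0 < m" "coercive m (matrix_inv (?W \<theta>))" using pds_coercive unfolding coercive_def by metis
    then have "coercive (m / \<sigma>\<^sup>2) (snd (b', (1 / \<sigma>\<^sup>2) *\<^sub>R matrix_inv (?W \<theta>)))"
      using \<sigma> by (simp add: coercive_def scaleR_matrix_vector_assoc[symmetric] divide_right_mono)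
    moreover have "0 < m / \<sigma>\<^sup>2" using m(1) \<sigma> by simp
    ultimately show ?thesis
      unfolding objective_def V(1)[OF that] mahal_eq_sqrt_qf[OF \<sigma>] J_def by (rule objective_contaminate[OF \<rho>(1) h])
  qed
  define D where "D = (\<lambda>v. (1 - h) * (LINT s|P. u_fun \<rho> (sqrt (qf p s)) / 2 * dqf p s v) + h * (u_fun \<rho> (sqrt (qf p s0)) / 2 * dqf p s0 v))"
  have der: "(J has_derivative D) (at p)"
    unfolding J_def D_def
    by (intro has_derivative_add has_derivative_mult_right loss_functional_has_derivative(1)[OF \<rho>(1) l]
        loss_qf_has_derivative[OF \<rho>(1) l])
  define M where "M = (\<integral>s. outer (wres \<rho> p s) (res p s) \<partial>P)"
  define N where "N = (\<integral>s. (snd p *v wres \<rho> p s) v* snd s \<partial>P)"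
  have Dv: "D (b', A') = ((1 - h) * (M \<bullet> A') + h * (outer (wres \<rho> p s0) (res p s0) \<bullet> A')) / 2
     - b' \<bullet> ((1 - h) *\<^sub>R N + h *\<^sub>R ((snd p *v wres \<rho> p s0) v* snd s0))" for b' A'
  proof -
    note iM = scatter_functional_has_derivative(3)[OF \<rho>(1) l \<rho>(2)] and iN = regression_functional_has_derivative(3)[OF \<rho>(1) l \<rho>(2)]
    have E: "(LINT s|P. u_fun \<rho> (sqrt (qf p s)) / 2 * dqf p s (b', A')) = M \<bullet> A' / 2 - b' \<bullet> N"
      unfolding loss_derivative_split[OF sym] M_def N_def using iM iN by simp
    have lin: "(1 - h) * (m / 2 - x) + h * (m' / 2 - x') = ((1 - h) * m + h * m') / 2 - ((1 - h) * x + h * x')"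
      for m m' x x' :: real
      by (simp add: field_simps)
    show ?thesis
      unfolding D_def unfolding E unfolding loss_derivative_split[OF sym] inner_add_right inner_scaleR_right by (rule lin)
  qed
  have beta: "D (b', 0) = 0" for b'
  proof -
    define \<phi> where "\<phi> = (\<lambda>t. (b + t *\<^sub>R b', snd p))"
    define \<psi> where "\<psi> = (\<lambda>t. (b + t *\<^sub>R b', \<gamma>))"
    have \<phi>0: "\<phi> 0 = p" by (simp add: \<phi>_def p_def)
    have "\<forall>\<^sub>F t in at 0. F (\<psi> 0) \<le> F (\<psi> t)"
    proof (rule local_min_on_curve[where f=F and \<psi>=\<psi> and D="feasible V \<Theta>"])
      show "local_min_on F (feasible V \<Theta>) (\<psi> 0)" using minF by (simp add: \<psi>_def)
      have "((\<lambda>t. b + t *\<^sub>R b') \<longlongrightarrow> b + 0 *\<^sub>R b') (at 0)" by (intro tendsto_intros)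
      then show "(\<psi> \<longlongrightarrow> \<psi> 0) (at 0)" unfolding \<psi>_def by (intro tendsto_Pair tendsto_const) simp
      show "\<forall>\<^sub>F t in at 0. \<psi> t \<in> feasible V \<Theta>"
        using min by (intro always_eventually) (auto simp: \<psi>_def local_min_on_def feasible_def)
    qed
    then have "\<forall>\<^sub>F t in at 0. J (\<phi> 0) \<le> J (\<phi> t)" by (simp add: F_def \<psi>_def \<phi>_def obj[OF \<gamma>\<Theta>] p_def)
    moreover have "(\<phi> has_vector_derivative (b', 0)) (at 0)"
      unfolding \<phi>_def by (auto intro!: derivative_eq_intros)
    ultimately show ?thesis using local_min_along_curve[of J D \<phi>] der \<phi>0 by simp
  qed
  show "(1 - h) *\<^sub>R N + h *\<^sub>R ((snd p *v wres \<rho> p s0) v* snd s0) = 0"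
  proof -
    \<comment> \<open>The derivative vanishes in all directions, in particular in its own.\<close>
    let ?y = "(1 - h) *\<^sub>R N + h *\<^sub>R ((snd p *v wres \<rho> p s0) v* snd s0)"
    have "?y \<bullet> ?y = 0" using beta[of ?y] unfolding Dv by simp
    then show ?thesis by simp
  qed
  show "(1 - h) * (M \<bullet> shape_gradient ?a (?W g)) + h * (outer (wres \<rho> p s0) (res p s0) \<bullet> shape_gradient ?a (?W g)) = 0"
  proof -
    define Wt where "Wt = (\<lambda>t. ?C + t *\<^sub>R ?W g)"
    define \<delta> where "\<delta> = (\<lambda>t. det (Wt t) powr (1 / real CARD('k)))"
    define \<theta> where "\<theta> = (\<lambda>t. (1 / \<delta> t) *\<^sub>R (\<gamma> + t *\<^sub>R g))"
    define \<psi> where "\<psi> = (\<lambda>t. (b, \<theta> t))"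
    define \<phi> where "\<phi> = (\<lambda>t. (b, (1 / \<sigma>\<^sup>2) *\<^sub>R ninv (Wt t)))"
    have W\<gamma>: "?W (\<gamma> + t *\<^sub>R g) = Wt t" for t
      by (simp add: Wt_def linear_add[OF linear_lin_struct] linear_scale[OF linear_lin_struct])
    have Wt0: "Wt 0 = ?C" and \<delta>0: "\<delta> 0 = 1" by (simp_all add: Wt_def \<delta>_def dC)
    have \<phi>0: "\<phi> 0 = p" and \<psi>0: "\<psi> 0 = (b, \<gamma>)"
      using \<delta>0 by (simp_all add: \<phi>_def p_def ninv_def Wt0 dC \<psi>_def \<theta>_def)
    have dWt: "(Wt has_vector_derivative ?W g) (at 0)"
      unfolding Wt_def by (auto intro!: derivative_eq_intros)
    have Wtc: "(Wt \<longlongrightarrow> ?C) (at 0)"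
      using has_vector_derivative_continuous[OF dWt] unfolding continuous_within Wt0 .
    have "isCont det ?C" by (rule has_derivative_continuous[OF det_has_derivative[OF pds_invertible[OF pC]]])
    then have dett: "((\<lambda>t. det (Wt t)) \<longlongrightarrow> 1) (at 0)"
      using isCont_tendsto_compose[OF _ Wtc, of det] dC by simp
    then have detpos: "\<forall>\<^sub>F t in at 0. 0 < det (Wt t)" by (rule order_tendstoD(1)) simp
    have "(\<delta> \<longlongrightarrow> 1 powr (1 / real CARD('k))) (at 0)"
      unfolding \<delta>_def by (intro tendsto_powr dett tendsto_const) simp
    then have "(\<theta> \<longlongrightarrow> (1 / 1) *\<^sub>R (\<gamma> + 0 *\<^sub>R g)) (at 0)"
      unfolding \<theta>_def by (intro tendsto_intros) auto
    then have \<theta>c: "(\<theta> \<longlongrightarrow> \<gamma>) (at 0)" by simp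
    have in\<Theta>: "\<forall>\<^sub>F t in at 0. \<theta> t \<in> \<Theta>"
      using topological_tendstoD[OF \<theta>c open_interior \<gamma>] by (rule eventually_mono) (use interior_subset[of \<Theta>] in blast)
    have feas: "\<forall>\<^sub>F t in at 0. \<psi> t \<in> feasible V \<Theta> \<and> \<theta> t \<in> \<Theta> \<and> matrix_inv (?W (\<theta> t)) = ninv (Wt t)"
      using detpos in\<Theta>
    proof eventually_elim
      case (elim t)
      have \<delta>pos: "0 < \<delta> t" using elim(1) by (simp add: \<delta>_def)
      have W\<theta>: "?W (\<theta> t) = (1 / \<delta> t) *\<^sub>R Wt t"
        unfolding \<theta>_def by (simp add: linear_scale[OF linear_lin_struct] W\<gamma>)
      have "\<delta> t ^ CARD('k) = det (Wt t)"
        using elim(1) by (simp add: \<delta>_def powr_powr flip: powr_realpow)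
      then have "det (?W (\<theta> t)) = 1"
        using elim(1) unfolding W\<theta> det_scaleR by (simp add: power_divide)
      moreover have "matrix_inv (?W (\<theta> t)) = ninv (Wt t)"
      proof -
        have "ninv (Wt t) = \<delta> t *\<^sub>R matrix_inv (Wt t)" by (simp add: ninv_def \<delta>_def)
        then show ?thesis
          unfolding W\<theta> using \<delta>pos elim(1) matrix_inv_scaleR[of "Wt t" "1 / \<delta> t"]
          by (simp add: invertible_det_nz)
      qed
      ultimately show ?case using V elim(2) by (simp add: \<psi>_def feasible_def)
    qed
    have "\<forall>\<^sub>F t in at 0. F (\<psi> 0) \<le> F (\<psi> t)"
    proof (rule local_min_on_curve[where f=F and \<psi>=\<psi> and D="feasible V \<Theta>"])
      show "local_min_on F (feasible V \<Theta>) (\<psi> 0)" using minF \<psi>0 by simp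
      show "(\<psi> \<longlongrightarrow> \<psi> 0) (at 0)" unfolding \<psi>0 unfolding \<psi>_def by (intro tendsto_Pair tendsto_const \<theta>c)
      show "\<forall>\<^sub>F t in at 0. \<psi> t \<in> feasible V \<Theta>" using feas by (rule eventually_mono) blast
    qed
    then have "\<forall>\<^sub>F t in at 0. J (\<phi> 0) \<le> J (\<phi> t)" using feas
    proof eventually_elim
      case (elim t)
      then show ?case unfolding \<psi>0 \<phi>0 by (simp add: F_def \<psi>_def \<phi>_def obj \<gamma>\<Theta> p_def)
    qed
    moreover have "(\<phi> has_vector_derivative (0, (1 / \<sigma>\<^sup>2) *\<^sub>R shape_gradient ?a (?W g))) (at 0)"
    proof -
      have "((\<lambda>t. ninv (Wt t)) has_derivative (\<lambda>t. shape_gradient ?a (t *\<^sub>R ?W g))) (at 0)"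
        using has_derivative_compose[OF dWt[unfolded has_vector_derivative_def], of ninv]
          ninv_has_derivative[OF pC] by (simp add: Wt0 dC shape_gradient_def)
      moreover have "shape_gradient ?a (t *\<^sub>R ?W g) = t *\<^sub>R shape_gradient ?a (?W g)" for t
        by (simp add: shape_gradient_def linear_scale[OF linear_trace] scaleR_diff_right
            bounded_bilinear.scaleR_left[OF bounded_bilinear_matrix_mult] bounded_bilinear.scaleR_right[OF bounded_bilinear_matrix_mult])
      ultimately have "((\<lambda>t. ninv (Wt t)) has_vector_derivative shape_gradient ?a (?W g)) (at 0)"
        by (simp add: has_vector_derivative_def)
      then have "((\<lambda>t. (1 / \<sigma>\<^sup>2) *\<^sub>R ninv (Wt t)) has_vector_derivative (1 / \<sigma>\<^sup>2) *\<^sub>R shape_gradient ?a (?W g)) (at 0)"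
        by (rule bounded_linear.has_vector_derivative[OF bounded_linear_scaleR_right])
      then show ?thesis unfolding \<phi>_def by (rule has_vector_derivative_Pair[OF has_vector_derivative_const])
    qed
    ultimately have "D (0, (1 / \<sigma>\<^sup>2) *\<^sub>R shape_gradient ?a (?W g)) = 0"
      using local_min_along_curve[of J D \<phi>] der \<phi>0 by simp
    then show ?thesis using \<sigma> unfolding Dv by (simp add: field_simps)
  qed
qed

end

section \<open>The estimating equation and its derivative\<close>

lemma symmetric_inner_trace:
  fixes a :: "real^'k^'k"
  assumes "transpose a = a"
  shows "a \<bullet> X = trace (a ** X)"
  by (simp add: matrix_inner_eq_trace assms)

lemma transpose_add: "transpose (A + B) = transpose A + transpose (B::real^'n^'m)"
  and transpose_diff: "transpose (A - B) = transpose A - transpose (B::real^'n^'m)"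
  and transpose_scaleR: "transpose (r *\<^sub>R A) = r *\<^sub>R transpose A"
  by (simp_all add: transpose_def vec_eq_iff)

lemma matrix_mult_scaleR: 
  "(r *\<^sub>R A) ** B = r *\<^sub>R (A ** (B::real^'p^'n))" "A ** (r *\<^sub>R B) = r *\<^sub>R ((A::real^'n^'m) ** B)"
  by (rule bounded_bilinear.scaleR_left[OF bounded_bilinear_matrix_mult] bounded_bilinear.scaleR_right[OF bounded_bilinear_matrix_mult])+

lemma trace_scaleR: "trace (r *\<^sub>R (A::real^'n^'n)) = r * trace A"
  using linear_scale[OF linear_trace, of r A] by simp

lemma trace_lin_struct: "trace (X ** lin_struct Ls g) = (\<Sum>j\<in>UNIV. g $ j * trace (X ** Ls j))"
proof -
  have lin: "linear (\<lambda>Y. trace (X ** Y))"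
    by (intro bounded_linear.linear bounded_linear_compose[OF bounded_linear_trace]
        bounded_bilinear.bounded_linear_right[OF bounded_bilinear_matrix_mult])
  show ?thesis unfolding lin_struct_def by (simp add: linear_sum[OF lin] linear_scale[OF lin])
qed

definition dshape_gradient :: "real^'k^'k \<Rightarrow> real^'k^'k \<Rightarrow> real^'k^'k \<Rightarrow> real^'k^'k" where
  "dshape_gradient a B X = (trace (X ** B) / real CARD('k)) *\<^sub>R a + (trace (a ** B) / real CARD('k)) *\<^sub>R X
     - (X ** B ** a + a ** B ** X)"

lemma shape_gradient_has_derivative:
  "((\<lambda>a. shape_gradient a B) has_derivative dshape_gradient a B) (at a)"
proof -
  have 1: "((\<lambda>a. a ** B) has_derivative (\<lambda>X. X ** B)) (at a)"
    by (intro bounded_linear.has_derivative[OF bounded_bilinear.bounded_linear_left[OF bounded_bilinear_matrix_mult]] has_derivative_ident)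
  have 2: "((\<lambda>a. a ** B ** a) has_derivative (\<lambda>X. a ** B ** X + X ** B ** a)) (at a)"
    by (rule bounded_bilinear.FDERIV[OF bounded_bilinear_matrix_mult 1 has_derivative_ident])
  have 3: "((\<lambda>a. trace (a ** B) / real CARD('a)) has_derivative (\<lambda>X. trace (X ** B) / real CARD('a))) (at a)"
    by (rule bounded_linear.has_derivative[OF bounded_linear_divide bounded_linear.has_derivative[OF bounded_linear_trace 1]])
  have "((\<lambda>a. shape_gradient a B) has_derivative (\<lambda>X. ((trace (a ** B) / real CARD('a)) *\<^sub>R X + (trace (X ** B) / real CARD('a)) *\<^sub>R a)
     - (a ** B ** X + X ** B ** a))) (at a)"
    unfolding shape_gradient_def by (intro has_derivative_diff has_derivative_scaleR 3 2 has_derivative_ident)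
  moreover have "(\<lambda>X. ((trace (a ** B) / real CARD('a)) *\<^sub>R X + (trace (X ** B) / real CARD('a)) *\<^sub>R a)
     - (a ** B ** X + X ** B ** a)) = dshape_gradient a B"
    by (simp add: fun_eq_iff dshape_gradient_def algebra_simps)
  ultimately show ?thesis by simp
qed

lemma transpose_shape_gradient:
  assumes "transpose a = a" "transpose B = B"
  shows "transpose (shape_gradient a B) = shape_gradient a B"
  by (simp add: shape_gradient_def transpose_diff transpose_scaleR matrix_transpose_mul assms matrix_mul_assoc)

lemma shape_gradient_inner:
  fixes a B X :: "real^'k^'k"
  assumes "transpose a = a" "transpose B = B"
  shows "shape_gradient a B \<bullet> X = trace (a ** B) / real CARD('k) * trace (a ** X) - trace (a ** B ** a ** X)"
proof -
  have "transpose (a ** B ** a) = a ** B ** a" by (simp add: matrix_transpose_mul assms matrix_mul_assoc)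
  then show ?thesis
    by (simp add: shape_gradient_def inner_diff_left symmetric_inner_trace assms(1))
qed

text \<open>Moving along the determinant-one surface changes the inverse shape in directions with zero trace
against the shape itself. Hence every multiple of the shape drops out of the shape equations: the scatter at the
model and all variations of the scale.\<close>

lemma shape_gradient_orthogonal:
  fixes a B C :: "real^'k^'k"
  assumes "transpose a = a" "transpose B = B" "a ** C = mat 1"
  shows "shape_gradient a B \<bullet> C = 0"
proof -
  have "a ** B ** a ** C = a ** B" using assms(3) by (simp flip: matrix_mul_assoc)
  then show ?thesis using assms by (simp add: shape_gradient_inner trace_I)
qed

lemma dshape_gradient_inner:
  fixes a B C D :: "real^'k^'k"
  assumes a: "transpose a = a" and C: "a ** C = mat 1" "transpose C = C"
  shows "C \<bullet> dshape_gradient a B (- (a ** D ** a)) = trace (a ** D ** a ** B) - trace (a ** B) / real CARD('k) * trace (a ** D)"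
proof -
  have C': "C ** a = mat 1" using C(1) by (simp add: matrix_left_right_inverse)
  have Ci: "C \<bullet> X = trace (C ** X)" for X using C(2) by (rule symmetric_inner_trace)
  have Ca: "C ** (a ** X) = X" for X by (simp add: matrix_mul_assoc C')
  have neg: "(- X) ** Y = - (X ** Y)" "X ** (- Y) = - (X ** Y)" for X Y :: "real^'k^'k"
    by (rule bounded_bilinear.minus_left[OF bounded_bilinear_matrix_mult] bounded_bilinear.minus_right[OF bounded_bilinear_matrix_mult])+
  have tneg: "trace (- X) = - trace X" for X :: "real^'k^'k"
    using linear_neg[OF linear_trace, of X] by simp
  have t1: "trace (D ** a ** B ** a) = trace (a ** D ** a ** B)"
    by (metis trace_mul_sym matrix_mul_assoc)
  have t2: "trace (B ** a ** D ** a) = trace (a ** D ** a ** B)"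
    using trace_mul_sym[of B "a ** D ** a"] by (simp add: matrix_mul_assoc)
  have t3: "trace (D ** a) = trace (a ** D)" by (rule trace_mul_sym)
  have "C \<bullet> dshape_gradient a B (- (a ** D ** a)) =
    (trace (- (a ** D ** a) ** B) / real CARD('k)) * trace (C ** a) + (trace (a ** B) / real CARD('k)) * trace (C ** - (a ** D ** a))
    - (trace (C ** (- (a ** D ** a) ** B ** a)) + trace (C ** (a ** B ** - (a ** D ** a))))"
    by (simp add: dshape_gradient_def inner_diff_right inner_add_right Ci neg tneg)
  also have "trace (C ** a) = real CARD('k)" by (simp add: C' trace_I)
  also have "trace (C ** - (a ** D ** a)) = - trace (a ** D)"
    by (simp add: neg tneg Ca t3 flip: matrix_mul_assoc)
  also have "trace (C ** (- (a ** D ** a) ** B ** a)) = - trace (a ** D ** a ** B)"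
    unfolding t1[symmetric] by (simp add: neg tneg Ca flip: matrix_mul_assoc)
  also have "trace (C ** (a ** B ** - (a ** D ** a))) = - trace (a ** D ** a ** B)"
    unfolding t2[symmetric] by (simp add: neg tneg Ca flip: matrix_mul_assoc)
  also have "trace (- (a ** D ** a) ** B) = - trace (a ** D ** a ** B)" by (simp add: neg tneg)
  finally show ?thesis by simp
qed

context elliptical_regression
begin

context
  fixes \<rho> :: "real \<Rightarrow> real" and Ls :: "'l::finite \<Rightarrow> real^'k^'k" and \<gamma>0 :: "real^'l" and \<kappa> \<sigma>0 :: real
  assumes \<rho>: "loss_function \<rho>" and C2: "deriv \<rho> C1_differentiable_on UNIV"
    and Ls_sym: "\<And>j. transpose (Ls j) = Ls j"
    and \<kappa>: "0 < \<kappa>" and \<sigma>0: "0 < \<sigma>0" and c2: "c\<^sup>2 = \<kappa> / \<sigma>0\<^sup>2"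
    and W\<gamma>0: "lin_struct Ls \<gamma>0 = (1 / \<kappa>) *\<^sub>R S"
    and det1: "det (lin_struct Ls \<gamma>0) = 1"
begin

abbreviation "W \<equiv> lin_struct Ls"

text \<open>The inverse of the shape matrix \<open>W \<gamma>0 = S / \<kappa>\<close>, where \<open>\<kappa>\<close> plays the role of \<open>|S|\<^sup>1\<^sup>/\<^sup>k\<close>.\<close>

definition inv0 where "inv0 = \<kappa> *\<^sub>R matrix_inv S"

text \<open>The arguments \<open>((\<beta>, \<gamma>), \<sigma>)\<close> are grouped with the unknowns first and the scale, whose derivative is
given, last.\<close>

definition par :: "((real^'q) \<times> (real^'l)) \<times> real \<Rightarrow> ('k, 'q) par" where
  "par x = (fst (fst x), (1 / (snd x)\<^sup>2) *\<^sub>R matrix_inv (W (snd (fst x))))"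

definition dpar :: "((real^'q) \<times> (real^'l)) \<times> real \<Rightarrow> ('k, 'q) par" where
  "dpar v = (fst (fst v), - ((1 / \<sigma>0\<^sup>2) *\<^sub>R (inv0 ** W (snd (fst v)) ** inv0)) - (2 * snd v / \<sigma>0 ^ 3) *\<^sub>R inv0)"

definition scat where "scat p = (\<integral>s. outer (wres \<rho> p s) (res p s) \<partial>P)"
definition regr where "regr p = (\<integral>s. (snd p *v wres \<rho> p s) v* snd s \<partial>P)"
definition dscat where "dscat v = (\<integral>s. outer (dwres \<rho> p0 s v) (res p0 s) - outer (wres \<rho> p0 s) (snd s *v fst v) \<partial>P)"
definition dregr where "dregr v = (\<integral>s. (snd p0 *v dwres \<rho> p0 s v + snd v *v wres \<rho> p0 s) v* snd s \<partial>P)"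

lemma S_inv: "invertible S" "transpose S = S" "matrix_inv S ** S = mat 1" "S ** matrix_inv S = mat 1" "transpose (matrix_inv S) = matrix_inv S"
proof -
  show i: "invertible S" using pds_invertible[OF T(1)] T(2) invertible_mult by blast
  show t: "transpose S = S" using T by (metis matrix_transpose_mul pds_def)
  show "matrix_inv S ** S = mat 1" "S ** matrix_inv S = mat 1" using matrix_inv_mult[OF i] by auto
  show "transpose (matrix_inv S) = matrix_inv S" using transpose_matrix_inv[OF i] t by simp
qed

lemma W_sym: "transpose (W g) = W g"
  unfolding lin_struct_def using Ls_sym
  by (simp add: transpose_def vec_eq_iff)

lemma inv0: "matrix_inv (W \<gamma>0) = inv0" "inv0 ** W \<gamma>0 = mat 1" "W \<gamma>0 ** inv0 = mat 1" "transpose inv0 = inv0"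
proof -
  show 1: "inv0 ** W \<gamma>0 = mat 1" "W \<gamma>0 ** inv0 = mat 1"
    using \<kappa> S_inv by (simp_all add: inv0_def W\<gamma>0 matrix_mult_scaleR)
  then show "matrix_inv (W \<gamma>0) = inv0" by (intro matrix_inv_unique)
  show "transpose inv0 = inv0" by (simp add: inv0_def transpose_scaleR S_inv)
qed

lemma par0: "par ((\<beta>, \<gamma>0), \<sigma>0) = p0"
  by (simp add: par_def p0_def inv0(1)) (simp add: inv0_def c2)

lemma W_gamma0_coercive: obtains l where "0 < l" "coercive l (W \<gamma>0)"
proof -
  have "pds S"
    unfolding T(2)[symmetric] pds_def
  proof (intro conjI allI impI)
    show "transpose (T ** T) = T ** T" using S_inv(2) T(2) by simp
    fix x :: "real^'k" assume x: "x \<noteq> 0"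
    have "T *v x \<noteq> 0" using Ti_T[of x] x by auto
    moreover have "x \<bullet> (T *v (T *v x)) = (T *v x) \<bullet> (T *v x)" by (rule T_sym[symmetric])
    ultimately show "0 < x \<bullet> (T ** T *v x)" by (simp flip: matrix_vector_mul_assoc)
  qed
  then obtain l where l: "0 < l" "\<And>x. l * (norm x)^2 \<le> x \<bullet> (S *v x)" using pds_coercive by blast
  have "coercive (l / \<kappa>) (W \<gamma>0)"
    unfolding coercive_def W\<gamma>0 using l(2) \<kappa> by (simp add: scaleR_matrix_vector_assoc[symmetric] divide_right_mono)
  then show thesis using that[of "l / \<kappa>"] l(1) \<kappa> by simp
qed

lemma inverse_shape_has_derivative:
  "((\<lambda>\<theta>. matrix_inv (W \<theta>)) has_derivative (\<lambda>g. - (inv0 ** W g ** inv0))) (at \<gamma>0)"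
proof -
  obtain l where "0 < l" "coercive l (W \<gamma>0)" by (rule W_gamma0_coercive)
  from has_derivative_compose[OF bounded_linear.has_derivative[OF bounded_linear_lin_struct has_derivative_ident] matrix_inv_has_derivative[OF this]]
  show ?thesis by (simp add: inv0(1))
qed

lemma par_has_derivative: "(par has_derivative dpar) (at ((\<beta>, \<gamma>0), \<sigma>0))"
proof -
  have 1: "((\<lambda>x::((real^'q) \<times> (real^'l)) \<times> real. 1 / (snd x)\<^sup>2) has_derivative (\<lambda>v. - 2 * snd v / \<sigma>0 ^ 3)) (at ((\<beta>, \<gamma>0), \<sigma>0))"
  proof -
    have "((\<lambda>t::real. 1 / t\<^sup>2) has_real_derivative - 2 / \<sigma>0 ^ 3) (at \<sigma>0)"
      using \<sigma>0 by (auto intro!: derivative_eq_intros simp: power2_eq_square power3_eq_cube field_simps)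
    then have q: "((\<lambda>t::real. 1 / t\<^sup>2) has_derivative (\<lambda>h. - 2 * h / \<sigma>0 ^ 3)) (at (snd ((\<beta>, \<gamma>0), \<sigma>0)))"
      unfolding has_field_derivative_def snd_conv by (rule has_derivative_eq_rhs) (simp add: fun_eq_iff)
    have "((\<lambda>x::((real^'q) \<times> (real^'l)) \<times> real. snd x) has_derivative snd) (at ((\<beta>, \<gamma>0), \<sigma>0))"
      by (rule has_derivative_snd[OF has_derivative_ident])
    from has_derivative_compose[OF this q] show ?thesis by simp
  qed
  have 2: "((\<lambda>x::((real^'q) \<times> (real^'l)) \<times> real. matrix_inv (W (snd (fst x)))) has_derivative (\<lambda>v. - (inv0 ** W (snd (fst v)) ** inv0))) (at ((\<beta>, \<gamma>0), \<sigma>0))"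
  proof -
    have "((\<lambda>x::((real^'q) \<times> (real^'l)) \<times> real. snd (fst x)) has_derivative (\<lambda>v. snd (fst v))) (at ((\<beta>, \<gamma>0), \<sigma>0))"
      by (intro has_derivative_snd has_derivative_fst has_derivative_ident)
    from has_derivative_compose[OF this] inverse_shape_has_derivative show ?thesis by simp
  qed
  have 3: "((\<lambda>x::((real^'q) \<times> (real^'l)) \<times> real. fst (fst x)) has_derivative (\<lambda>v. fst (fst v))) (at ((\<beta>, \<gamma>0), \<sigma>0))"
    by (intro has_derivative_fst has_derivative_ident)
  have "(par has_derivative (\<lambda>v. (fst (fst v), (1 / (snd ((\<beta>, \<gamma>0), \<sigma>0))\<^sup>2) *\<^sub>R - (inv0 ** W (snd (fst v)) ** inv0)
      + (- 2 * snd v / \<sigma>0 ^ 3) *\<^sub>R matrix_inv (W (snd (fst ((\<beta>, \<gamma>0), \<sigma>0))))))) (at ((\<beta>, \<gamma>0), \<sigma>0))"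
    unfolding par_def[abs_def] by (intro has_derivative_Pair 3 has_derivative_scaleR 1 2)
  moreover have "(\<lambda>v. (fst (fst v), (1 / (snd ((\<beta>, \<gamma>0), \<sigma>0))\<^sup>2) *\<^sub>R - (inv0 ** W (snd (fst v)) ** inv0)
      + (- 2 * snd v / \<sigma>0 ^ 3) *\<^sub>R matrix_inv (W (snd (fst ((\<beta>, \<gamma>0), \<sigma>0)))))) = dpar"
    by (rule ext) (simp add: dpar_def inv0(1))
  ultimately show ?thesis by simp
qed

lemma scat_has_derivative: "(scat has_derivative dscat) (at p0)"
  and regr_has_derivative: "(regr has_derivative dregr) (at p0)"
proof -
  obtain l where l: "0 < l" "coercive l (snd p0)" by (rule p0_coercive)
  show "(scat has_derivative dscat) (at p0)"
    using scatter_functional_has_derivative(1)[OF \<rho> l C2] unfolding scat_def[abs_def] dscat_def[abs_def] .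
  show "(regr has_derivative dregr) (at p0)"
    using regression_functional_has_derivative(1)[OF \<rho> l C2] unfolding regr_def[abs_def] dregr_def[abs_def] .
qed

text \<open>The estimating function \<open>\<Psi>\<close>: regression equations, shape equations in the directions \<open>L\<^sub>j\<close>, and the
determinant constraint. The shape equations alone are dependent, because \<open>shape_gradient\<close> vanishes in the direction of
the shape itself; the constraint supplies the missing equation.\<close>

definition score :: "((real^'q) \<times> (real^'l)) \<times> real \<Rightarrow> (real^'q) \<times> (real^'l) \<times> real" where
  "score x = (regr (par x),
     (\<Sum>j\<in>UNIV. (scat (par x) \<bullet> shape_gradient (matrix_inv (W (snd (fst x)))) (Ls j)) *\<^sub>R axis j 1),
     det (W (snd (fst x))) - 1)"

text \<open>The factor of the shape part of the linearised equation. At the model of the theorem it is a positive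
multiple of \<open>\<gamma>\<^sub>1\<close>.\<close>

definition info where "info = \<kappa> * (scatter_const \<rho> + 2 * c\<^sup>2 * tau_const \<rho>)"

definition dscore :: "((real^'q) \<times> (real^'l)) \<times> real \<Rightarrow> (real^'q) \<times> (real^'l) \<times> real" where
  "dscore v = (dregr (dpar v),
     (\<Sum>j\<in>UNIV. (info * (trace (inv0 ** W (snd (fst v)) ** inv0 ** Ls j)
        - trace (inv0 ** Ls j) / real CARD('k) * trace (inv0 ** W (snd (fst v))))) *\<^sub>R axis j 1),
     trace (inv0 ** W (snd (fst v))))"

lemma scat0: "scat p0 = (\<kappa> * scatter_const \<rho>) *\<^sub>R W \<gamma>0"
  using scatter_functional_at_model[OF \<rho> C2] \<kappa> unfolding scat_def by (simp add: W\<gamma>0)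

lemma score0: "score ((\<beta>, \<gamma>0), \<sigma>0) = 0"
proof -
  have "regr p0 = 0" unfolding regr_def by (rule regression_functional_at_model[OF \<rho> C2])
  moreover have "scat p0 \<bullet> shape_gradient inv0 (Ls j) = 0" for j
    using shape_gradient_orthogonal[OF inv0(4) Ls_sym[of j] inv0(2)] by (simp add: scat0 inner_commute)
  ultimately show ?thesis by (simp add: score_def par0 inv0(1) det1 zero_prod_def)
qed

text \<open>Two contributions: the scatter varies, and the direction it is paired with varies. By
\<open>shape_gradient_orthogonal\<close> the trace product and the scale variation disappear from the first, and both reduce to
the same trace form in the direction of \<open>\<gamma>\<close>.\<close>

lemma scat_term:
  "dscat (dpar v) \<bullet> shape_gradient inv0 (Ls j) + scat p0 \<bullet> dshape_gradient inv0 (Ls j) (- (inv0 ** W (snd (fst v)) ** inv0)) =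
    info * (trace (inv0 ** W (snd (fst v)) ** inv0 ** Ls j)
        - trace (inv0 ** Ls j) / real CARD('k) * trace (inv0 ** W (snd (fst v))))"
proof -
  let ?D = "W (snd (fst v))" and ?H = "shape_gradient inv0 (Ls j)" and ?C = "W \<gamma>0"
  let ?q = "trace (inv0 ** ?D ** inv0 ** Ls j) - trace (inv0 ** Ls j) / real CARD('k) * trace (inv0 ** ?D)"
  have S: "S = \<kappa> *\<^sub>R ?C" using \<kappa> by (simp add: W\<gamma>0)
  have Hsym: "transpose ?H = ?H" by (rule transpose_shape_gradient[OF inv0(4) Ls_sym])
  have HC: "?H \<bullet> ?C = 0" by (rule shape_gradient_orthogonal[OF inv0(4) Ls_sym inv0(2)])
  have tSH: "trace (S ** ?H) = 0"
  proof -
    have "trace (S ** ?H) = trace (?H ** S)" by (rule trace_mul_sym)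
    also have "\<dots> = ?H \<bullet> S" using symmetric_inner_trace[OF Hsym] by simp
    finally have "trace (S ** ?H) = ?H \<bullet> S" .
    moreover have "?H \<bullet> (\<kappa> *\<^sub>R ?C) = 0" using HC by simp
    ultimately show ?thesis unfolding S[symmetric] by simp
  qed
  have CaC: "?C ** (inv0 ** X ** inv0) ** ?C = X" for X
    by (metis inv0(2,3) matrix_mul_assoc matrix_mul_lid matrix_mul_rid)
  have CiC: "?C ** inv0 ** ?C = ?C" by (simp add: inv0(3))
  have "(\<kappa> *\<^sub>R ?C) ** X ** (\<kappa> *\<^sub>R ?C) = \<kappa>\<^sup>2 *\<^sub>R (?C ** X ** ?C)" for X
    by (simp add: matrix_mult_scaleR power2_eq_square)
  then have SXS: "S ** X ** S = \<kappa>\<^sup>2 *\<^sub>R (?C ** X ** ?C)" for X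
    unfolding S[symmetric] .
  have "S ** snd (dpar v) ** S = - ((\<kappa>\<^sup>2 / \<sigma>0\<^sup>2) *\<^sub>R ?D) - (\<kappa>\<^sup>2 * (2 * snd v / \<sigma>0 ^ 3)) *\<^sub>R ?C"
    unfolding SXS dpar_def snd_conv
    by (simp add: matrix_mult_scaleR bounded_bilinear.diff_left[OF bounded_bilinear_matrix_mult]
        bounded_bilinear.diff_right[OF bounded_bilinear_matrix_mult] bounded_bilinear.minus_left[OF bounded_bilinear_matrix_mult]
        bounded_bilinear.minus_right[OF bounded_bilinear_matrix_mult] CaC CiC scaleR_diff_right power2_eq_square)
  then have "?H \<bullet> (S ** snd (dpar v) ** S) = - (\<kappa>\<^sup>2 / \<sigma>0\<^sup>2) * (?H \<bullet> ?D)"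
    by (simp add: inner_diff_right HC)
  also have "?H \<bullet> ?D = - ?q"
  proof -
    have "trace (inv0 ** Ls j ** inv0 ** ?D) = trace (inv0 ** ?D ** inv0 ** Ls j)"
      by (metis trace_mul_sym matrix_mul_assoc)
    then show ?thesis unfolding shape_gradient_inner[OF inv0(4) Ls_sym] by simp
  qed
  finally have HS': "?H \<bullet> (S ** snd (dpar v) ** S) = - (\<kappa>\<^sup>2 / \<sigma>0\<^sup>2) * - ?q" .
  have kc: "\<kappa>\<^sup>2 / \<sigma>0\<^sup>2 = \<kappa> * c\<^sup>2" unfolding c2 by (simp add: power2_eq_square)
  have HS: "?H \<bullet> (S ** snd (dpar v) ** S) = \<kappa> * c\<^sup>2 * ?q"
    unfolding HS' kc by (rule minus_mult_minus)
  have a1: "?H \<bullet> dscat (dpar v) = 2 * tau_const \<rho> * (\<kappa> * c\<^sup>2 * ?q)"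
    unfolding dscat_def scatter_derivative_at_model[OF \<rho> C2 Hsym] tSH HS by simp
  have a2: "?C \<bullet> dshape_gradient inv0 (Ls j) (- (inv0 ** ?D ** inv0)) = ?q"
    by (rule dshape_gradient_inner[OF inv0(4,2) W_sym])
  have ring: "2 * t * (k * d * q) + k * r * q = k * (r + 2 * d * t) * q" for t k d q r :: real
    by (simp add: algebra_simps)
  show ?thesis
    unfolding inner_commute[of "dscat _"] a1 scat0 inner_scaleR_left a2 info_def by (rule ring)
qed

lemma score_has_derivative: "(score has_derivative dscore) (at ((\<beta>, \<gamma>0), \<sigma>0))"
proof -
  let ?x = "((\<beta>, \<gamma>0), \<sigma>0)"
  have 1: "((\<lambda>x. regr (par x)) has_derivative (\<lambda>v. dregr (dpar v))) (at ?x)"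
    using has_derivative_compose[OF par_has_derivative] regr_has_derivative par0 by simp
  have 2: "((\<lambda>x. scat (par x)) has_derivative (\<lambda>v. dscat (dpar v))) (at ?x)"
    using has_derivative_compose[OF par_has_derivative] scat_has_derivative par0 by simp
  have th: "((\<lambda>x::((real^'q) \<times> (real^'l)) \<times> real. snd (fst x)) has_derivative (\<lambda>v. snd (fst v))) (at ?x)"
    by (intro has_derivative_snd has_derivative_fst has_derivative_ident)
  have 3: "((\<lambda>x::((real^'q) \<times> (real^'l)) \<times> real. shape_gradient (matrix_inv (W (snd (fst x)))) (Ls j)) has_derivative
    (\<lambda>v. dshape_gradient inv0 (Ls j) (- (inv0 ** W (snd (fst v)) ** inv0)))) (at ?x)" for j
    using has_derivative_compose[OF th has_derivative_compose[of "\<lambda>\<theta>. matrix_inv (W \<theta>)" _ "snd (fst ?x)" UNIV, OF _ shape_gradient_has_derivative]]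
      inverse_shape_has_derivative by (simp add: inv0(1))
  have 4: "((\<lambda>x::((real^'q) \<times> (real^'l)) \<times> real. det (W (snd (fst x))) - 1) has_derivative (\<lambda>v. trace (inv0 ** W (snd (fst v))))) (at ?x)"
  proof -
    have "invertible (W \<gamma>0)" using det1 by (simp add: invertible_det_nz)
    from has_derivative_compose[OF bounded_linear.has_derivative[OF bounded_linear_lin_struct th], of det]
      det_has_derivative[OF this]
    have "((\<lambda>x::((real^'q) \<times> (real^'l)) \<times> real. det (W (snd (fst x)))) has_derivative (\<lambda>v. trace (inv0 ** W (snd (fst v))))) (at ?x)"
      by (simp add: det1 inv0(1))
    then show ?thesis using has_derivative_diff[OF _ has_derivative_const[of 1]] by fastforce
  qed
  have 5: "((\<lambda>x. scat (par x) \<bullet> shape_gradient (matrix_inv (W (snd (fst x)))) (Ls j)) has_derivative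
    (\<lambda>v. info * (trace (inv0 ** W (snd (fst v)) ** inv0 ** Ls j)
        - trace (inv0 ** Ls j) / real CARD('k) * trace (inv0 ** W (snd (fst v)))))) (at ?x)" for j
  proof -
    have "((\<lambda>x. scat (par x) \<bullet> shape_gradient (matrix_inv (W (snd (fst x)))) (Ls j)) has_derivative
      (\<lambda>v. scat (par ?x) \<bullet> dshape_gradient inv0 (Ls j) (- (inv0 ** W (snd (fst v)) ** inv0))
        + dscat (dpar v) \<bullet> shape_gradient (matrix_inv (W (snd (fst ?x)))) (Ls j))) (at ?x)"
      by (rule has_derivative_inner[OF 2 3])
    then show ?thesis unfolding scat_term[symmetric] par0 fst_conv snd_conv inv0(1) by (simp add: add.commute)
  qed
  show ?thesis
    unfolding score_def[abs_def] dscore_def[abs_def]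
    by (intro has_derivative_Pair 1 4 has_derivative_sum has_derivative_scaleR_left 5)
qed

lemma regr_form:
  "b \<bullet> dregr v = - (c\<^sup>2 * reg_const \<rho>) * (LINT s|P. (matrix_inv T *v (snd s *v fst v)) \<bullet> (matrix_inv T *v (snd s *v b)))"
  unfolding dregr_def by (rule regression_derivative_at_model[OF \<rho> C2])

text \<open>The regression equations decouple from shape and scale to first order.\<close>

lemma regr_cong: "fst v = fst w \<Longrightarrow> dregr v = dregr w"
  by (rule vector_eq_ldot[THEN iffD1]) (simp add: regr_form)

context
  assumes rank: "AE s in P. rank (snd s) = CARD('q)" and reg: "reg_const \<rho> \<noteq> 0"
begin

text \<open>Pairing with \<open>b\<close> itself gives a nonzero multiple of \<open>E \<parallel>T\<^sup>-\<^sup>1 X b\<parallel>\<^sup>2\<close>. If it vanishes then \<open>X b = 0\<close> almost surely,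
and \<open>X\<close> is injective almost surely.\<close>

lemma dregr_injective:
  assumes "dregr (b, A) = 0"
  shows "b = 0"
proof (rule ccontr)
  assume b: "b \<noteq> 0"
  let ?f = "\<lambda>s. (matrix_inv T *v (snd s *v b)) \<bullet> (matrix_inv T *v (snd s *v b))"
  have "(LINT s|P. ?f s) = 0"
    using regr_form[of b "(b, A)"] assms c reg by simp
  moreover have int: "integrable P ?f"
  proof (rule Bochner_Integration.integrable_bound[OF integrable_design_bound[of "(norm (matrix_inv T) * norm b)^2"]])
    show "?f \<in> borel_measurable P" by (rule measurable_P) measurable
    show "AE s in P. norm (?f s) \<le> norm ((norm (matrix_inv T) * norm b)^2 * (1 + norm (snd s))^2)"
    proof (rule AE_I2)
      fix s :: "('k, 'q) obs"
      have "norm (matrix_inv T *v (snd s *v b)) \<le> norm (matrix_inv T) * (norm (snd s) * norm b)"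
        by (rule order_trans[OF norm_matrix_vector_le mult_left_mono[OF norm_matrix_vector_le]]) simp
      also have "\<dots> \<le> norm (matrix_inv T) * ((1 + norm (snd s)) * norm b)"
        by (intro mult_left_mono mult_right_mono) auto
      finally have "(norm (matrix_inv T *v (snd s *v b)))^2 \<le> (norm (matrix_inv T) * ((1 + norm (snd s)) * norm b))^2"
        by (rule power_mono) simp
      then show "norm (?f s) \<le> norm ((norm (matrix_inv T) * norm b)^2 * (1 + norm (snd s))^2)"
        by (simp add: power2_norm_eq_inner[symmetric] power_mult_distrib mult_ac)
    qed
  qed
  ultimately have "AE s in P. ?f s = 0"
    using integral_nonneg_eq_0_iff_AE[OF int] by simp
  then have "AE s in P. False"
    using rank
  proof eventually_elim
    case (elim s)
    have "T *v (matrix_inv T *v y) = y" for y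
      using matrix_inv_mult(1)[OF pds_invertible[OF T(1)]] by (simp add: matrix_vector_mul_assoc)
    moreover have "matrix_inv T *v (snd s *v b) = 0" using elim(1) by simp
    ultimately have "snd s *v b = 0" by (metis matrix_vector_mult_0_right)
    moreover have "inj ((*v) (snd s))" using elim(2) by (simp add: full_rank_injective)
    ultimately show ?case using b by (metis injD matrix_vector_mult_0_right)
  qed
  then show False by simp
qed

text \<open>An injective endomorphism is onto. This supplies the \<open>\<beta>'\<close> that solves the linearised regression equations,
uniformly in the direction of \<open>A\<close> because of \<open>regr_cong\<close>.\<close>

lemma dregr_surjective: "\<exists>b. \<forall>A. dregr (b, A) = y"
proof -
  have lin: "linear dregr" using regr_has_derivative by (rule has_derivative_linear)
  have l: "linear (\<lambda>b. dregr (b, 0))"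
  proof (rule linearI)
    show "dregr (b + b', 0) = dregr (b, 0) + dregr (b', 0)" for b b'
      using linear_add[OF lin, of "(b, 0)" "(b', 0)"] by simp
    show "dregr (r *\<^sub>R b, 0) = r *\<^sub>R dregr (b, 0)" for r b
      using linear_scale[OF lin, of r "(b, 0)"] by simp
  qed
  have "inj (\<lambda>b. dregr (b, 0))"
    unfolding linear_injective_0[OF l] using dregr_injective by blast
  then have "surj (\<lambda>b. dregr (b, 0))" using linear_injective_imp_surjective[OF l] by blast
  then obtain b where b: "y = dregr (b, 0)" by (rule surjE)
  show ?thesis
  proof (intro exI allI)
    fix A
    show "dregr (b, A) = y" unfolding b by (rule regr_cong) simp
  qed
qed

text \<open>The constraint gives \<open>trace (C\<^sup>-\<^sup>1 W g) = 0\<close>. The shape equations then say that \<open>trace (C\<^sup>-\<^sup>1 (W g) C\<^sup>-\<^sup>1 L\<^sub>j)\<close> vanishes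
for each \<open>j\<close>; combining them with the coefficients of \<open>g\<close> makes the weighted norm of \<open>W g\<close> vanish
(\<open>inverse_weighted_trace_pos\<close>).\<close>

lemma dscore_injective:
  assumes info: "info \<noteq> 0" and W_inj: "\<And>g. W g = 0 \<Longrightarrow> g = 0" and "dscore (v, 0) = 0"
  shows "v = 0"
proof -
  obtain b g where v: "v = (b, g)" by fastforce
  let ?y = "\<Sum>j\<in>UNIV. (info * (trace (inv0 ** W g ** inv0 ** Ls j)
        - trace (inv0 ** Ls j) / real CARD('k) * trace (inv0 ** W g))) *\<^sub>R axis j (1::real) :: real^'l"
  have "(dregr (dpar (v, 0)), ?y, trace (inv0 ** W g)) = (0, 0, 0)"
    using assms(3) by (simp only: dscore_def v zero_prod_def fst_conv snd_conv)
  then have 1: "dregr (dpar (v, 0)) = 0" and 2: "?y = 0" and 3: "trace (inv0 ** W g) = 0"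
    by blast+
  have "b = 0"
    by (rule dregr_injective[of b "snd (dpar (v, 0))"]) (use 1 in \<open>simp add: v dpar_def\<close>)
  have "trace (inv0 ** W g ** inv0 ** Ls j) = 0" for j
  proof -
    have "?y $ j = (0 :: real^'l) $ j" unfolding 2 ..
    then show ?thesis using info by (simp add: 3 axis_def if_distrib cong: if_cong)
  qed
  then have t0: "trace (inv0 ** W g ** inv0 ** W g) = 0"
    by (simp add: trace_lin_struct)
  have "trace (inv0 ** W g ** inv0 ** W g) = \<kappa>\<^sup>2 * trace (matrix_inv S ** W g ** matrix_inv S ** W g)"
    by (simp add: inv0_def matrix_mult_scaleR trace_scaleR power2_eq_square)
  then have "W g = 0" using t0 \<kappa> inverse_weighted_trace_pos[OF W_sym[of g]] by fastforce
  with \<open>b = 0\<close> show ?thesis using W_inj by (simp add: v zero_prod_def)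
qed

end
end
end

section \<open>Scale and shape along the contamination path\<close>

text \<open>With \<open>vec_columns_mult\<close>, the dictionary between the vectorised formulas of the theorem and the trace forms
of the proof: \<open>L\<close> is the matrix of \<open>\<gamma> \<mapsto> vec (V \<gamma>)\<close>.\<close>

lemma inner_vec_mat: "vec_mat A \<bullet> vec_mat B = A \<bullet> (B::real^'n^'m)"
proof -
  have "vec_mat A \<bullet> vec_mat B = (\<Sum>p\<in>UNIV \<times> UNIV. A $ snd p $ fst p * B $ snd p $ fst p)"
    by (simp add: inner_vec_def vec_mat_def)
  also have "\<dots> = (\<Sum>i\<in>UNIV. \<Sum>j\<in>UNIV. A $ j $ i * B $ j $ i)"
    by (simp add: sum.cartesian_product' del: UNIV_Times_UNIV)
  also have "\<dots> = A \<bullet> B"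
    unfolding inner_vec_def by (subst sum.swap) simp
  finally show ?thesis .
qed

lemma vec_columns_mult: "vec_columns Ls *v g = vec_mat (lin_struct Ls g)"
  by (simp add: vec_columns_def vec_mat_def lin_struct_def matrix_vector_mult_def vec_eq_iff mult.commute)

context elliptical_regression
begin

text \<open>The scale equation at weight \<open>h\<close> reads \<open>(1 - h) J + h \<rho> = b0\<close>. Its right derivative at \<open>0\<close> gives
\<open>DJ = b0 - \<rho>\<close>, where \<open>DJ\<close> is the derivative of the objective in the direction of the path. At the model \<open>DJ\<close>
sees only \<open>trace (S A')\<close>, to which the initial shape does not contribute; this leaves a multiple of \<open>\<sigma>'\<close>.\<close>

lemma scale_influence_path:
  fixes Ls :: "'l::finite \<Rightarrow> real^'k^'k" and s0 :: "('k, 'q) obs"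
  assumes \<rho>: "loss_function \<rho>" and S: "pds S" "lin_struct Ls \<theta>s = S"
    and c2: "c\<^sup>2 = det S powr (1 / real CARD('k)) / \<sigma>0\<^sup>2" and \<sigma>0: "0 < \<sigma>0"
    and b: "(bp has_vector_derivative b') (at 0 within {0<..})" "bp 0 = \<beta>"
    and t: "(tp has_vector_derivative t') (at 0 within {0<..})" "tp 0 = \<theta>s"
    and sg: "(sp has_vector_derivative \<sigma>') (at 0 within {0<..})" "sp 0 = \<sigma>0"
  defines "pp \<equiv> \<lambda>h. (bp h, (1 / (sp h)\<^sup>2) *\<^sub>R ninv (lin_struct Ls (tp h)))"
  assumes eq: "\<forall>\<^sub>F h in at_right 0. (1 - h) * (LINT s|P. \<rho> (sqrt (qf (pp h) s))) + h * \<rho> (sqrt (qf (pp h) s0)) = b0"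
    and b0: "(LINT s|P. \<rho> (sqrt (qf p0 s))) = b0"
  shows "\<sigma>' * (c\<^sup>2 * (LINT z|\<nu>. u_fun \<rho> (c * norm z) * norm z ^ 2)) = \<sigma>0 * (\<rho> (sqrt (qf p0 s0)) - b0)"
proof -
  let ?W = "lin_struct Ls" and ?\<kappa> = "det S powr (1 / real CARD('k))" and ?Si = "matrix_inv S"
  define J where "J = (\<lambda>p. LINT s|P. \<rho> (sqrt (qf p s)))"
  define DJ where "DJ = (\<lambda>v. LINT s|P. u_fun \<rho> (sqrt (qf p0 s)) / 2 * dqf p0 s v)"
  obtain l where l: "0 < l" "coercive l (snd p0)" by (rule p0_coercive)
  have dJ: "(J has_derivative DJ) (at p0)"
    unfolding J_def DJ_def by (rule loss_functional_has_derivative(1)[OF \<rho> l])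
  have pp0: "pp 0 = p0" by (simp add: pp_def p0_def b(2) t(2) sg(2) S(2) ninv_def c2)
  have Sinv: "?Si ** S = mat 1" "S ** ?Si = mat 1" using matrix_inv_mult[OF pds_invertible[OF S(1)]] by auto
  define N' where "N' = ?\<kappa> *\<^sub>R shape_gradient ?Si (?W t')"
  have dN: "((\<lambda>h. ninv (?W (tp h))) has_vector_derivative N') (at 0 within {0<..})"
  proof -
    have "((\<lambda>h. ?W (tp h)) has_vector_derivative ?W t') (at 0 within {0<..})"
      by (rule bounded_linear.has_vector_derivative[OF bounded_linear_lin_struct t(1)])
    then have "((\<lambda>h. ninv (?W (tp h))) has_derivative (\<lambda>h. ?\<kappa> *\<^sub>R shape_gradient ?Si (h *\<^sub>R ?W t'))) (at 0 within {0<..})"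
      using has_derivative_compose[of "\<lambda>h. ?W (tp h)" _ 0 "{0<..}" ninv] ninv_has_derivative[OF S(1)]
      unfolding has_vector_derivative_def shape_gradient_def by (simp add: t(2) S(2))
    moreover have "?\<kappa> *\<^sub>R shape_gradient ?Si (h *\<^sub>R ?W t') = h *\<^sub>R N'" for h
      by (simp add: N'_def shape_gradient_def trace_scaleR matrix_mult_scaleR scaleR_diff_right mult_ac)
    ultimately show ?thesis by (simp add: has_vector_derivative_def)
  qed
  have ds: "((\<lambda>h. 1 / (sp h)\<^sup>2) has_real_derivative - 2 * \<sigma>' / \<sigma>0 ^ 3) (at 0 within {0<..})"
  proof -
    have s: "(sp has_real_derivative \<sigma>') (at 0 within {0<..})"
      using sg(1) by (simp add: has_real_derivative_iff_has_vector_derivative)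
    show ?thesis
      using \<sigma>0 sg(2) by (auto intro!: derivative_eq_intros s simp: power2_eq_square power3_eq_cube field_simps)
  qed
  \<comment> \<open>the velocity of \<open>A = ninv (W \<theta>) / \<sigma>\<^sup>2\<close> by the product rule\<close>
  define A' where "A' = (1 / \<sigma>0\<^sup>2) *\<^sub>R N' + (- 2 * \<sigma>' / \<sigma>0 ^ 3) *\<^sub>R (?\<kappa> *\<^sub>R ?Si)"
  have "((\<lambda>h. (1 / (sp h)\<^sup>2) *\<^sub>R ninv (?W (tp h))) has_vector_derivative A') (at 0 within {0<..})"
    using has_vector_derivative_scaleR[OF ds dN] by (simp add: A'_def sg(2) t(2) S(2) ninv_def)
  then have dp: "(pp has_vector_derivative (b', A')) (at 0 within {0<..})"
    unfolding pp_def by (rule has_vector_derivative_Pair[OF b(1)])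
  have trN: "trace (S ** shape_gradient ?Si (?W t')) = 0"
  proof -
    have "S ** shape_gradient ?Si (?W t') = (trace (?Si ** ?W t') / real CARD('k)) *\<^sub>R mat 1 - ?W t' ** ?Si"
      by (simp add: shape_gradient_def bounded_bilinear.diff_right[OF bounded_bilinear_matrix_mult] matrix_mult_scaleR
          Sinv matrix_mul_assoc)
    then show ?thesis
      by (simp add: linear_diff[OF linear_trace] trace_scaleR trace_I trace_mul_sym[of "?W t'"])
  qed
  have trA: "trace (S ** A') = - 2 * \<sigma>' / \<sigma>0 * (c\<^sup>2 * real CARD('k))"
  proof -
    have "trace (S ** A') = (1 / \<sigma>0\<^sup>2) * (?\<kappa> * trace (S ** shape_gradient ?Si (?W t'))) + (- 2 * \<sigma>' / \<sigma>0 ^ 3) * (?\<kappa> * trace (S ** ?Si))"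
      unfolding A'_def N'_def
      by (simp add: bounded_bilinear.add_right[OF bounded_bilinear_matrix_mult] matrix_mult_scaleR linear_add[OF linear_trace] trace_scaleR
          bounded_bilinear.diff_right[OF bounded_bilinear_matrix_mult] linear_diff[OF linear_trace])
    also have "\<dots> = (- 2 * \<sigma>' / \<sigma>0 ^ 3) * (?\<kappa> * real CARD('k))" by (simp add: trN Sinv trace_I)
    also have "\<dots> = - 2 * \<sigma>' / \<sigma>0 * (c\<^sup>2 * real CARD('k))"
      unfolding c2 using \<sigma>0 by (simp add: power2_eq_square power3_eq_cube)
    finally show ?thesis .
  qed
  have DJp: "DJ (b', A') = - \<sigma>' / \<sigma>0 * (c\<^sup>2 * (LINT z|\<nu>. u_fun \<rho> (c * norm z) * norm z ^ 2))"
    unfolding DJ_def loss_functional_derivative_at_model[OF \<rho>] snd_conv trA by simp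
  have "((\<lambda>h. J (pp h)) has_vector_derivative DJ (b', A')) (at 0 within {0<..})"
  proof -
    have "((\<lambda>h. J (pp h)) has_derivative (\<lambda>h. DJ (h *\<^sub>R (b', A')))) (at 0 within {0<..})"
      by (rule has_derivative_compose[OF dp[unfolded has_vector_derivative_def]]) (simp add: pp0 dJ)
    then show ?thesis
      unfolding has_vector_derivative_def linear_scale[OF has_derivative_linear[OF dJ]] .
  qed
  then have q1: "((\<lambda>h. (J (pp h) - J (pp 0)) /\<^sub>R h) \<longlongrightarrow> DJ (b', A')) (at_right 0)"
    unfolding right_derivative_iff_quotient .
  have ppc: "(pp \<longlongrightarrow> p0) (at_right 0)"
    using has_vector_derivative_continuous[OF dp] by (simp add: continuous_within pp0)
  have Jc: "((\<lambda>h. J (pp h)) \<longlongrightarrow> J p0) (at_right 0)"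
    using isCont_tendsto_compose[OF has_derivative_continuous[OF dJ] ppc] .
  have \<phi>c: "((\<lambda>h. \<rho> (sqrt (qf (pp h) s0))) \<longlongrightarrow> \<rho> (sqrt (qf p0 s0))) (at_right 0)"
    using isCont_tendsto_compose[OF has_derivative_continuous[OF loss_qf_has_derivative[OF \<rho> l]] ppc] .
  have "((\<lambda>h. J (pp h) - \<rho> (sqrt (qf (pp h) s0))) \<longlongrightarrow> J p0 - \<rho> (sqrt (qf p0 s0))) (at_right 0)"
    by (intro tendsto_diff Jc \<phi>c)
  moreover have "\<forall>\<^sub>F h in at_right 0. J (pp h) - \<rho> (sqrt (qf (pp h) s0)) = (J (pp h) - J (pp 0)) /\<^sub>R h"
    using eq eventually_at_right_less[of 0]
  proof eventually_elim
    case (elim h)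
    have "J (pp h) - J (pp 0) = h * (J (pp h) - \<rho> (sqrt (qf (pp h) s0)))"
      using elim(1) b0 by (simp add: J_def pp0 algebra_simps)
    then show ?case using elim(2) by simp
  qed
  ultimately have "((\<lambda>h. (J (pp h) - J (pp 0)) /\<^sub>R h) \<longlongrightarrow> J p0 - \<rho> (sqrt (qf p0 s0))) (at_right 0)"
    by (rule Lim_transform_eventually)
  from tendsto_unique[OF trivial_limit_at_right_real q1 this]
  have "DJ (b', A') = b0 - \<rho> (sqrt (qf p0 s0))" using b0 by (simp add: J_def)
  then show ?thesis unfolding DJp using \<sigma>0 by (simp add: field_simps)
qed

text \<open>The estimating equations at weight \<open>h\<close> are put in the form required by \<open>z_estimator_path\<close>. Its candidate
derivative consists of the given \<open>\<gamma>'\<close> and of the \<open>\<beta>'\<close> that solves the regression part.\<close>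

lemma shape_influence_path:
  fixes Ls :: "'l::finite \<Rightarrow> real^'k^'k" and s0 :: "('k, 'q) obs"
    and \<gamma>p :: "real \<Rightarrow> real^'l"
  assumes A: "loss_function \<rho>" "deriv \<rho> C1_differentiable_on UNIV" "\<And>j. transpose (Ls j) = Ls j"
     "0 < \<kappa>" "0 < \<sigma>0" "c\<^sup>2 = \<kappa> / \<sigma>0\<^sup>2" "lin_struct Ls \<gamma>0 = (1 / \<kappa>) *\<^sub>R S" "det (lin_struct Ls \<gamma>0) = 1"
    and R: "AE s in P. rank (snd s) = CARD('q)" "reg_const \<rho> \<noteq> 0"
    and info: "info \<rho> \<kappa> \<noteq> 0" and W_inj: "\<And>g. lin_struct Ls g = 0 \<Longrightarrow> g = 0"
    and b: "(bp \<longlongrightarrow> \<beta>) (at_right 0)" "bp 0 = \<beta>"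
    and g: "(\<gamma>p \<longlongrightarrow> \<gamma>0) (at_right 0)" "\<gamma>p 0 = \<gamma>0"
    and sg: "(sp has_vector_derivative \<sigma>') (at 0 within {0<..})" "sp 0 = \<sigma>0"
  defines "pp \<equiv> \<lambda>h. (bp h, (1 / (sp h)\<^sup>2) *\<^sub>R matrix_inv (lin_struct Ls (\<gamma>p h)))"
  assumes eq1: "\<forall>\<^sub>F h in at_right 0. (1 - h) *\<^sub>R (\<integral>s. (snd (pp h) *v wres \<rho> (pp h) s) v* snd s \<partial>P)
       + h *\<^sub>R ((snd (pp h) *v wres \<rho> (pp h) s0) v* snd s0) = 0"
    and eq2: "\<forall>\<^sub>F h in at_right 0. \<forall>j.
       (1 - h) * ((\<integral>s. outer (wres \<rho> (pp h) s) (res (pp h) s) \<partial>P) \<bullet> shape_gradient (matrix_inv (lin_struct Ls (\<gamma>p h))) (Ls j))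
       + h * (outer (wres \<rho> (pp h) s0) (res (pp h) s0) \<bullet> shape_gradient (matrix_inv (lin_struct Ls (\<gamma>p h))) (Ls j)) = 0"
    and eq3: "\<forall>\<^sub>F h in at_right 0. det (lin_struct Ls (\<gamma>p h)) = 1"
    and tr0: "trace (inv0 \<kappa> ** lin_struct Ls \<gamma>') = 0"
    and sol: "\<And>j. info \<rho> \<kappa> * trace (inv0 \<kappa> ** lin_struct Ls \<gamma>' ** inv0 \<kappa> ** Ls j)
       + outer (wres \<rho> p0 s0) (res p0 s0) \<bullet> shape_gradient (inv0 \<kappa>) (Ls j) = 0"
  shows "(\<gamma>p has_vector_derivative \<gamma>') (at 0 within {0<..})"
proof -
  obtain l where l: "0 < l" "coercive l (snd p0)" by (rule p0_coercive)
  let ?W = "lin_struct Ls" and ?a = "inv0 \<kappa>"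
  define x where "x = (\<lambda>h. (bp h, \<gamma>p h))"
  define n where "n = (\<lambda>p. (snd p *v wres \<rho> p s0) v* snd s0)"
  \<comment> \<open>The contribution of the point mass. The constraint is not contaminated, hence the final \<open>0\<close>.\<close>
  define \<psi> where "\<psi> = (\<lambda>h. (n (pp h),
     (\<Sum>j\<in>UNIV. (outer (wres \<rho> (pp h) s0) (res (pp h) s0) \<bullet> shape_gradient (matrix_inv (?W (\<gamma>p h))) (Ls j)) *\<^sub>R axis j (1::real)) :: real^'l, 0::real))"
  define \<psi>0 where "\<psi>0 = (n p0,
     (\<Sum>j\<in>UNIV. (outer (wres \<rho> p0 s0) (res p0 s0) \<bullet> shape_gradient ?a (Ls j)) *\<^sub>R axis j (1::real)) :: real^'l, 0::real)"
  have par: "par Ls (x h, sp h) = pp h" for h by (simp add: par_def[OF A] x_def pp_def)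
  have x0: "(x 0, sp 0) = ((\<beta>, \<gamma>0), \<sigma>0)" by (simp add: x_def b g sg)
  have xc: "(x \<longlongrightarrow> x 0) (at_right 0)" unfolding x_def b(2) g(2) by (intro tendsto_Pair b g)
  have sc: "(sp \<longlongrightarrow> sp 0) (at_right 0)"
    using has_vector_derivative_continuous[OF sg(1)] by (simp add: continuous_within)
  have ppc: "(pp \<longlongrightarrow> p0) (at_right 0)"
  proof -
    have "((\<lambda>h. (x h, sp h)) \<longlongrightarrow> ((\<beta>, \<gamma>0), \<sigma>0)) (at_right 0)" using tendsto_Pair[OF xc sc] by (simp add: x0)
    from isCont_tendsto_compose[OF has_derivative_continuous[OF par_has_derivative[OF A]] this]
    show ?thesis by (simp add: par par0[OF A])
  qed
  have ac: "((\<lambda>h. matrix_inv (?W (\<gamma>p h))) \<longlongrightarrow> ?a) (at_right 0)"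
    using isCont_tendsto_compose[OF has_derivative_continuous[OF inverse_shape_has_derivative[OF A]] g(1)]
    by (simp add: inv0(1)[OF A])
  have wc: "((\<lambda>h. wres \<rho> (pp h) s0) \<longlongrightarrow> wres \<rho> p0 s0) (at_right 0)"
    by (rule isCont_tendsto_compose[OF has_derivative_continuous[OF wres_has_derivative[OF A(1,2) l]] ppc])
  have rc: "((\<lambda>h. res (pp h) s0) \<longlongrightarrow> res p0 s0) (at_right 0)"
    by (rule isCont_tendsto_compose[OF has_derivative_continuous[OF res_has_derivative] ppc])
  have sgc: "((\<lambda>h. shape_gradient (matrix_inv (?W (\<gamma>p h))) (Ls j)) \<longlongrightarrow> shape_gradient ?a (Ls j)) (at_right 0)" for j
    by (rule isCont_tendsto_compose[OF has_derivative_continuous[OF shape_gradient_has_derivative] ac])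
  have blv: "bounded_linear (\<lambda>x. x v* snd s0)"
  proof -
    have "(*v) (transpose (snd s0)) = (\<lambda>x. x v* snd s0)" by (rule ext) simp
    then show ?thesis using matrix_vector_mul_bounded_linear[of "transpose (snd s0)"] by simp
  qed
  have nc: "((\<lambda>h. n (pp h)) \<longlongrightarrow> n p0) (at_right 0)"
    unfolding n_def
    by (intro bounded_linear.tendsto[OF blv] bounded_bilinear.tendsto[OF bounded_bilinear_matrix_vector] wc tendsto_snd ppc)
  have \<psi>c: "(\<psi> \<longlongrightarrow> \<psi>0) (at_right 0)"
    unfolding \<psi>_def \<psi>0_def
    by (intro tendsto_Pair nc tendsto_const tendsto_sum tendsto_scaleR tendsto_inner sgc
        bounded_bilinear.tendsto[OF bounded_bilinear_outer] wc rc)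
  have eq: "\<forall>\<^sub>F h in at_right 0. (1 - h) *\<^sub>R score \<rho> Ls (x h, sp h) + h *\<^sub>R \<psi> h = 0"
    using eq1 eq2 eq3
  proof eventually_elim
    case (elim h)
    have sx: "snd (x h) = \<gamma>p h" by (simp add: x_def)
    have sc: "score \<rho> Ls (x h, sp h) = (regr \<rho> (pp h),
        \<Sum>j\<in>UNIV. (scat \<rho> (pp h) \<bullet> shape_gradient (matrix_inv (?W (\<gamma>p h))) (Ls j)) *\<^sub>R axis j 1,
        det (?W (\<gamma>p h)) - 1)"
      unfolding score_def[OF A] par fst_conv sx ..
    have sums: "(1 - h) *\<^sub>R (\<Sum>j\<in>UNIV. (scat \<rho> (pp h) \<bullet> shape_gradient (matrix_inv (?W (\<gamma>p h))) (Ls j)) *\<^sub>R axis j (1::real))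
      + h *\<^sub>R (\<Sum>j\<in>UNIV. (outer (wres \<rho> (pp h) s0) (res (pp h) s0) \<bullet> shape_gradient (matrix_inv (?W (\<gamma>p h))) (Ls j)) *\<^sub>R axis j (1::real))
      = (\<Sum>j\<in>UNIV. 0 *\<^sub>R axis j (1::real) :: real^'l)"
      unfolding scaleR_sum_right sum.distrib[symmetric] scaleR_scaleR scaleR_left_distrib[symmetric]
      using elim(2) by (intro sum.cong refl) (simp add: scat_def[OF A])
    have rg: "(1 - h) *\<^sub>R regr \<rho> (pp h) + h *\<^sub>R n (pp h) = 0"
      using elim(1) by (simp add: regr_def[OF A] n_def)
    show ?case
      unfolding sc \<psi>_def scaleR_Pair add_Pair rg sums elim(3) by (simp add: zero_prod_def)
  qed
  obtain b' where b': "\<And>A'. dregr \<rho> (b', A') = - n p0"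
    using dregr_surjective[OF A R, of "- n p0"] by blast
  have sol': "dscore \<rho> Ls \<kappa> \<sigma>0 ((b', \<gamma>'), \<sigma>') + \<psi>0 = 0"
  proof -
    have "dregr \<rho> (dpar Ls \<kappa> \<sigma>0 ((b', \<gamma>'), \<sigma>')) + n p0 = 0"
      by (simp add: dpar_def[OF A] b')
    moreover have "(\<Sum>j\<in>UNIV. (info \<rho> \<kappa> * (trace (?a ** ?W \<gamma>' ** ?a ** Ls j)
        - trace (?a ** Ls j) / real CARD('k) * trace (?a ** ?W \<gamma>'))) *\<^sub>R axis j (1::real))
      + (\<Sum>j\<in>UNIV. (outer (wres \<rho> p0 s0) (res p0 s0) \<bullet> shape_gradient ?a (Ls j)) *\<^sub>R axis j (1::real))
      = (\<Sum>j\<in>UNIV. 0 *\<^sub>R axis j (1::real) :: real^'l)"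
      unfolding sum.distrib[symmetric] scaleR_left_distrib[symmetric] tr0
      using sol by (intro sum.cong refl) simp
    ultimately show ?thesis by (simp add: dscore_def[OF A] \<psi>0_def zero_prod_def tr0)
  qed
  have "(x has_vector_derivative (b', \<gamma>')) (at 0 within {0<..})"
  proof (rule z_estimator_path[where \<Psi>="score \<rho> Ls" and \<Psi>'="dscore \<rho> Ls \<kappa> \<sigma>0" and x=x and t=sp, OF _ _ xc sg(1) eq \<psi>c _ sol'])
    show "(score \<rho> Ls has_derivative dscore \<rho> Ls \<kappa> \<sigma>0) (at (x 0, sp 0))"
      unfolding x0 by (rule score_has_derivative[OF A])
    show "score \<rho> Ls (x 0, sp 0) = 0" unfolding x0 by (rule score0[OF A])
    show "v = 0" if "dscore \<rho> Ls \<kappa> \<sigma>0 (v, 0) = 0" for v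
      by (rule dscore_injective[OF A R info W_inj that])
  qed
  from bounded_linear.has_vector_derivative[OF bounded_linear_snd this] show ?thesis by (simp add: x_def)
qed

end

section \<open>The influence function of the covariance parameter\<close>

theorem corollary4:
  fixes P :: "((real^'k) \<times> (real^'q^'k)) measure"
    and \<Theta> :: "(real^'l) set"
    and V :: "real^'l \<Rightarrow> real^'k^'k"
    and Ls :: "'l \<Rightarrow> real^'k^'k"
    and \<rho>0 \<rho>1 m :: "real \<Rightarrow> real"
    and b0 :: real
    and \<beta>s :: "real^'q" and \<theta>s :: "real^'l"
    and y0 :: "real^'k" and X0 :: "real^'q^'k"
    and \<beta>0 \<beta>1 :: "((real^'k) \<times> (real^'q^'k)) measure \<Rightarrow> real^'q"
    and \<theta>0 \<gamma> \<theta>1 :: "((real^'k) \<times> (real^'q^'k)) measure \<Rightarrow> real^'l"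
    and \<sigma> :: "((real^'k) \<times> (real^'q^'k)) measure \<Rightarrow> real"
    and S :: "real^'k^'k" and L :: "real^'l^('k \<times> 'k)"
    and z0 :: "real^'k" and c \<alpha>1 \<gamma>1 :: real
  assumes P: "prob_space P" "sets P = sets borel"
    and V_pds: "\<And>\<theta>. \<theta> \<in> \<Theta> \<Longrightarrow> pds (V \<theta>)"
    and V_inj: "inj_on V \<Theta>"
    and V_C2: "C2_on V \<Theta>"
    and Ls_sym: "\<And>j. transpose (Ls j) = Ls j"
    and V_lin: "\<And>\<theta>. \<theta> \<in> \<Theta> \<Longrightarrow> V \<theta> = (\<Sum>j\<in>UNIV. \<theta> $ j *\<^sub>R Ls j)"
    and L_def: "L = vec_columns Ls"
    and L_rank: "rank L = CARD('l)"
    and \<theta>s_in: "\<theta>s \<in> \<Theta>"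
    and S_def: "S = V \<theta>s"
    and m_nonneg: "\<And>t. 0 \<le> t \<Longrightarrow> 0 \<le> m t"
    and y_given_X: "cond_density P (\<lambda>X. ell_density m (X *v \<beta>s) S)"
    and X_moment: "integrable P (\<lambda>(y, X). (norm X)\<^sup>2)"
    and X_rank: "AE s in P. rank (snd s) = CARD('q)"
    and \<rho>0: "loss_function \<rho>0"
    and \<rho>1: "loss_function \<rho>1" "deriv \<rho>1 C1_differentiable_on UNIV"
    and b0: "0 < b0" "ereal b0 < (SUP s. ereal (\<rho>0 s))"
    and init_P: "\<beta>0 P = \<beta>s" "\<theta>0 P = \<theta>s"
    and init_Ph: "\<forall>\<^sub>F h in at_right 0. \<theta>0 (contaminate P (y0, X0) h) \<in> \<Theta>"
    and init_IF: "\<exists>d. has_influence (y0, X0) (\<lambda>Q. (\<beta>0 Q, \<theta>0 Q)) P d"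
    and scale_P: "solves_scale \<rho>0 b0 V P (\<beta>0 P) (\<theta>0 P) (\<sigma> P)"
    and scale_Ph: "\<forall>\<^sub>F h in at_right 0. let Q = contaminate P (y0, X0) h in
                     solves_scale \<rho>0 b0 V Q (\<beta>0 Q) (\<theta>0 Q) (\<sigma> Q)"
    and scale_IF: "\<exists>d. has_influence (y0, X0) \<sigma> P d"
    and min_P: "local_min_on (\<lambda>(b, g). objective \<rho>1 P (\<sigma> P) b (V g)) (feasible V \<Theta>) (\<beta>1 P, \<gamma> P)"
    and min_Ph: "\<forall>\<^sub>F h in at_right 0. let Q = contaminate P (y0, X0) h in
                   local_min_on (\<lambda>(b, g). objective \<rho>1 Q (\<sigma> Q) b (V g)) (feasible V \<Theta>) (\<beta>1 Q, \<gamma> Q)"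
    and xi_P: "\<beta>1 P = \<beta>s" "V (\<gamma> P) = (1 / det S powr (1 / real CARD('k))) *\<^sub>R S"
    and \<gamma>_interior: "\<gamma> P \<in> interior \<Theta>"
    and conv: "((\<lambda>h. let Q = contaminate P (y0, X0) h in ((\<beta>1 Q, \<gamma> Q), \<sigma> Q))
                  \<longlongrightarrow> ((\<beta>1 P, \<gamma> P), \<sigma> P)) (at_right 0)"
    and c_def: "c = det S powr (1 / (2 * real CARD('k))) / \<sigma> P"
    and z0_def: "z0 = matrix_inv (matrix_sqrt S) *v (y0 - X0 *v \<beta>s)"
    and \<alpha>1_def: "\<alpha>1 = std_expectation m (\<lambda>z::real^'k.
                   (1 - 1 / real CARD('k)) * u_fun \<rho>1 (c * norm z)
                   + 1 / real CARD('k) * deriv (deriv \<rho>1) (c * norm z))"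
    and \<gamma>1_def: "\<gamma>1 = std_expectation m (\<lambda>z::real^'k.
                   deriv (deriv \<rho>1) (c * norm z) * (c * norm z)\<^sup>2
                   + (real CARD('k) + 1) * deriv \<rho>1 (c * norm z) * (c * norm z))
                 / (real CARD('k) + 2)"
    and \<alpha>1: "\<alpha>1 \<noteq> 0"
    and \<gamma>1: "0 < \<gamma>1"
    and \<rho>0_pos: "0 < std_expectation m (\<lambda>z::real^'k. deriv \<rho>0 (c * norm z) * (c * norm z))"
    and \<theta>1_P: "\<theta>1 P \<in> \<Theta>" "V (\<theta>1 P) = (\<sigma> P)\<^sup>2 *\<^sub>R V (\<gamma> P)"
    and \<theta>1_Ph: "\<forall>\<^sub>F h in at_right 0. let Q = contaminate P (y0, X0) h in
                   \<theta>1 Q \<in> \<Theta> \<and> V (\<theta>1 Q) = (\<sigma> Q)\<^sup>2 *\<^sub>R V (\<gamma> Q)"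
  shows "has_influence (y0, X0) \<theta>1 P
    ((real CARD('k) * u_fun \<rho>1 (c * norm z0) / \<gamma>1) *\<^sub>R
       (matrix_inv (transpose L ** kronecker (matrix_inv S) (matrix_inv S) ** L) *v
         (transpose L *v
           (kronecker (matrix_inv (matrix_sqrt S)) (matrix_inv (matrix_sqrt S)) *v
             vec_mat (outer z0 z0))))
     - (1 / c\<^sup>2 *
         (v_fun \<rho>1 (c * norm z0) / \<gamma>1
          - 2 * (\<rho>0 (c * norm z0) - b0)
            / std_expectation m (\<lambda>z::real^'k. deriv \<rho>0 (c * norm z) * (c * norm z)))) *\<^sub>R \<theta>s)"
proof -
  define T where "T = matrix_sqrt S"
  define \<nu> where "\<nu> = ell_measure m (0::real^'k) (mat 1)"
  define \<sigma>0 where "\<sigma>0 = \<sigma> P"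
  define \<kappa> where "\<kappa> = det S powr (1 / real CARD('k))"
  define s0 where "s0 = (y0, X0)"
  define Q where "Q = contaminate P s0"
  let ?W = "lin_struct Ls" and ?k = "real CARD('k)"
  let ?Si = "matrix_inv S" and ?Ti = "matrix_inv T"
  have Q0: "Q 0 = P" by (simp add: Q_def contaminate_0)
  have VW: "V \<theta> = ?W \<theta>" if "\<theta> \<in> \<Theta>" for \<theta> using V_lin[OF that] by (simp add: lin_struct_def)
  have pS: "pds S" and WS: "?W \<theta>s = S" using V_pds[OF \<theta>s_in] VW[OF \<theta>s_in] S_def by auto
  have T: "pds T" "T ** T = S" unfolding T_def by (rule matrix_sqrt[OF pS])+
  note rep = elliptical_representation[OF P pS y_given_X]
  have \<sigma>0: "0 < \<sigma>0" using scale_P by (simp add: solves_scale_def \<sigma>0_def)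
  have dS: "0 < det S" using pS by (rule pds_det_pos)
  have \<kappa>: "0 < \<kappa>" using dS by (simp add: \<kappa>_def)
  have cpos: "0 < c" using dS \<sigma>0 by (simp add: c_def \<sigma>0_def)
  have c2: "c\<^sup>2 = \<kappa> / \<sigma>0\<^sup>2"
  proof -
    have "(det S powr (1 / (2 * ?k)))\<^sup>2 = \<kappa>"
      unfolding \<kappa>_def power2_eq_square powr_add[symmetric] by (simp add: field_simps)
    then show ?thesis by (simp add: c_def \<sigma>0_def power_divide)
  qed
  have moment: "integrable P (\<lambda>s. (norm (snd s))\<^sup>2)"
    using X_moment by (simp add: split_beta')
  have sets_nu: "sets \<nu> = sets borel" by (simp add: \<nu>_def ell_measure_def)
  interpret ER: elliptical_regression P \<nu> \<beta>s S T c
  proof (intro elliptical_regression.intro second_moment_design.intro second_moment_design_axioms.intro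
      rotation_invariant.intro elliptical_regression_axioms.intro)
    show "distr \<nu> borel f = \<nu>" if "orthogonal_transformation f" for f
      unfolding \<nu>_def by (rule ell_measure_std_rotation[OF that rep(2)])
    show "prob_space \<nu>" unfolding \<nu>_def by (rule rep(1))
    show "P = distr (\<nu> \<Otimes>\<^sub>M distr P borel snd) borel (\<lambda>(z, X). (X *v \<beta>s + T *v z, X))"
      using rep(3) by (simp add: \<nu>_def T_def)
  qed (fact P moment sets_nu T cpos)+
  have std: "std_expectation m g = (LINT z|\<nu>. g z)" for g :: "real^'k \<Rightarrow> real"
    by (simp add: std_expectation_def \<nu>_def)
  \<comment> \<open>Full rank of \<open>L\<close> in the form in which it is used: the linear structure determines its parameter.\<close>
  have W_inj: "g = 0" if "?W g = 0" for g
  proof -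
    have "inj ((*v) L)" using L_rank by (simp add: full_rank_injective)
    moreover have "L *v g = 0" unfolding L_def vec_columns_mult that by (simp add: vec_mat_def vec_eq_iff)
    then have "L *v g = L *v 0" by simp
    ultimately show ?thesis by (rule injD)
  qed
  have lossu: "deriv \<rho>1 (c * s) * (c * s) = u_fun \<rho>1 (c * s) * (c * s)\<^sup>2" for s
    by (simp add: loss_deriv_eq_u[OF \<rho>1(1)] power2_eq_square)
  \<comment> \<open>Identification of the constants of the model derivatives with those of the statement, using \<open>\<rho>'' = u + \<tau>\<close>.\<close>
  have reg: "ER.reg_const \<rho>1 = \<alpha>1"
  proof -
    have "\<alpha>1 = (LINT z|\<nu>. u_fun \<rho>1 (c * norm z) + tau_fun \<rho>1 (c * norm z) / ?k)"
      unfolding \<alpha>1_def std by (rule Bochner_Integration.integral_cong) (auto simp: tau_fun_def field_simps)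
    also have "\<dots> = ER.reg_const \<rho>1"
      using ER.u_integrable[OF \<rho>1(1)] ER.tau_integrable[OF \<rho>1] by (simp add: ER.reg_const_def[OF \<rho>1])
    finally show ?thesis ..
  qed
  define \<gamma>0 where "\<gamma>0 = \<gamma> P"
  have \<gamma>0in: "\<gamma>0 \<in> \<Theta>" using \<gamma>_interior interior_subset[of \<Theta>] by (auto simp: \<gamma>0_def)
  have W\<gamma>0: "?W \<gamma>0 = (1 / \<kappa>) *\<^sub>R S" using xi_P(2) VW[OF \<gamma>0in] by (simp add: \<gamma>0_def \<kappa>_def)
  have \<gamma>0: "\<gamma>0 = (1 / \<kappa>) *\<^sub>R \<theta>s"
  proof -
    have "?W (\<gamma>0 - (1 / \<kappa>) *\<^sub>R \<theta>s) = 0"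
      by (simp add: linear_diff[OF linear_lin_struct] linear_scale[OF linear_lin_struct] W\<gamma>0 WS)
    then show ?thesis using W_inj by fastforce
  qed
  have det0: "det (?W \<gamma>0) = 1"
    using min_P VW[OF \<gamma>0in] by (simp add: local_min_on_def feasible_def \<gamma>0_def)
  note A = \<rho>1 Ls_sym \<kappa> \<sigma>0 c2 W\<gamma>0 det0
  have info: "ER.info \<rho>1 \<kappa> = \<sigma>0\<^sup>2 * \<gamma>1 / ?k"
  proof -
    let ?u = "LINT z|\<nu>. u_fun \<rho>1 (c * norm z) * norm z ^ 2" and ?t = "LINT z|\<nu>. tau_fun \<rho>1 (c * norm z) * norm z ^ 2"
    have "\<gamma>1 = (LINT z|\<nu>. c\<^sup>2 * (tau_fun \<rho>1 (c * norm z) * norm z ^ 2) + (?k + 2) * c\<^sup>2 * (u_fun \<rho>1 (c * norm z) * norm z ^ 2)) / (?k + 2)"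
      unfolding \<gamma>1_def std
      by (rule arg_cong[where f="\<lambda>x. x / (?k + 2)"], rule Bochner_Integration.integral_cong)
        (auto simp: tau_fun_def loss_deriv_eq_u[OF \<rho>1(1)] power2_eq_square algebra_simps)
    also have "\<dots> = (c\<^sup>2 * ?t + (?k + 2) * c\<^sup>2 * ?u) / (?k + 2)"
      using ER.u_moment_integrable[OF \<rho>1(1)] ER.tau_moment_integrable[OF \<rho>1] by simp
    finally have \<gamma>1': "\<gamma>1 = c\<^sup>2 * (?t / (?k + 2) + ?u)"
      by (simp add: add_divide_distrib distrib_left)
    have "ER.info \<rho>1 \<kappa> = \<kappa> * (?u / ?k + ?t / (?k * (?k + 2)))"
      using cpos by (simp add: ER.info_def[OF A] ER.scatter_const_def[OF \<rho>1] ER.tau_const_def[OF \<rho>1])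
    also have "\<dots> = \<kappa> / (c\<^sup>2 * ?k) * \<gamma>1"
    proof -
      have "\<kappa> / (c\<^sup>2 * ?k) * (c\<^sup>2 * (?t / (?k + 2) + ?u)) = \<kappa> / ?k * (?t / (?k + 2) + ?u)"
        using cpos by simp
      also have "\<dots> = \<kappa> * (?u / ?k + ?t / (?k * (?k + 2)))"
        by (simp only: distrib_left times_divide_times_eq times_divide_eq_left times_divide_eq_right divide_divide_eq_left add.commute)
      finally show ?thesis unfolding \<gamma>1' by simp
    qed
    also have "\<kappa> / (c\<^sup>2 * ?k) = \<sigma>0\<^sup>2 / ?k" unfolding c2 using \<kappa> \<sigma>0 by simp
    finally show ?thesis by simp
  qed
  have info_nz: "ER.info \<rho>1 \<kappa> \<noteq> 0" using info \<gamma>1 \<sigma>0 by simp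
  have Tz0: "T *v z0 = y0 - X0 *v \<beta>s"
    unfolding z0_def T_def[symmetric] using matrix_inv_mult[OF pds_invertible[OF T(1)]]
    by (simp add: matrix_vector_mul_assoc)
  have s0: "s0 = (X0 *v \<beta>s + T *v z0, X0)" by (simp add: s0_def Tz0)
  have q0: "sqrt (qf ER.p0 s0) = c * norm z0" unfolding s0 by (rule ER.sqrt_qf_p0)
  obtain \<sigma>' where \<sigma>': "((\<lambda>h. \<sigma> (Q h)) has_vector_derivative \<sigma>') (at 0 within {0<..})"
    using scale_IF unfolding has_influence_iff Q_def s0_def by blast
  obtain d where d: "((\<lambda>h. (\<beta>0 (Q h), \<theta>0 (Q h))) has_vector_derivative d) (at 0 within {0<..})"
    using init_IF unfolding has_influence_iff Q_def s0_def by blast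
  have b0': "((\<lambda>h. \<beta>0 (Q h)) has_vector_derivative fst d) (at 0 within {0<..})"
    using bounded_linear.has_vector_derivative[OF bounded_linear_fst d] by simp
  have t0': "((\<lambda>h. \<theta>0 (Q h)) has_vector_derivative snd d) (at 0 within {0<..})"
    using bounded_linear.has_vector_derivative[OF bounded_linear_snd d] by simp
  have small: "\<forall>\<^sub>F h in at_right 0. 0 < h \<and> h < (1::real)" by (rule eventually_at_rightI[of 0 1]) auto
  have scQ: "\<forall>\<^sub>F h in at_right 0. solves_scale \<rho>0 b0 V (Q h) (\<beta>0 (Q h)) (\<theta>0 (Q h)) (\<sigma> (Q h))"
    using scale_Ph by (simp add: Q_def s0_def Let_def)
  \<comment> \<open>The scale equation in the parameter \<open>(\<beta>, A)\<close>, with the contaminated integral evaluated.\<close>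
  have scale_eq: "(1 - h) * (LINT s|P. \<rho>0 (sqrt (qf (b, (1 / sg\<^sup>2) *\<^sub>R ninv (?W t)) s)))
      + h * \<rho>0 (sqrt (qf (b, (1 / sg\<^sup>2) *\<^sub>R ninv (?W t)) s0)) = b0 \<and> 0 < sg"
    if sc: "solves_scale \<rho>0 b0 V (Q h) b t sg" and t: "t \<in> \<Theta>" and h: "0 \<le> h" "h \<le> 1" for h b t sg
  proof -
    have sg: "0 < sg" and int: "(LINT s|Q h. \<rho>0 (mahal b (shape V t) s / sg)) = b0"
      using sc by (auto simp: solves_scale_def)
    have pW: "pds (?W t)" using V_pds[OF t] VW[OF t] by simp
    have "matrix_inv (shape V t) = ninv (?W t)"
      unfolding shape_def VW[OF t] ninv_def using pds_det_pos[OF pW]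
      by (subst matrix_inv_scaleR[OF pds_invertible[OF pW]]) auto
    then have m: "mahal b (shape V t) s / sg = sqrt (qf (b, (1 / sg\<^sup>2) *\<^sub>R ninv (?W t)) s)" for s :: "('k, 'q) obs"
      by (simp add: mahal_eq_sqrt_qf[OF sg])
    obtain l where l: "0 < l" "\<And>x. l * (norm x)^2 \<le> x \<bullet> (matrix_inv (?W t) *v x)"
      using pds_coercive[OF pds_matrix_inv[OF pW]] by blast
    let ?l = "(1 / sg\<^sup>2) * (det (?W t) powr (1 / ?k) * l)"
    have "coercive ?l (snd (b, (1 / sg\<^sup>2) *\<^sub>R ninv (?W t)))"
      unfolding coercive_def
    proof
      fix x :: "real^'k"
      have "(1 / sg\<^sup>2 * det (?W t) powr (1 / ?k)) * (l * (norm x)^2) \<le> (1 / sg\<^sup>2 * det (?W t) powr (1 / ?k)) * (x \<bullet> (matrix_inv (?W t) *v x))"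
        using l(2)[of x] by (intro mult_left_mono) auto
      then show "?l * (norm x)^2 \<le> x \<bullet> (snd (b, (1 / sg\<^sup>2) *\<^sub>R ninv (?W t)) *v x)"
        by (simp add: ninv_def scaleR_matrix_vector_assoc[symmetric] mult_ac)
    qed
    moreover have "0 < ?l" using l(1) sg pds_det_pos[OF pW] by simp
    ultimately have "(LINT s|contaminate P s0 h. \<rho>0 (sqrt (qf (b, (1 / sg\<^sup>2) *\<^sub>R ninv (?W t)) s))) =
       (1 - h) * (LINT s|P. \<rho>0 (sqrt (qf (b, (1 / sg\<^sup>2) *\<^sub>R ninv (?W t)) s)))
      + h * \<rho>0 (sqrt (qf (b, (1 / sg\<^sup>2) *\<^sub>R ninv (?W t)) s0))"
      by (rule ER.objective_contaminate[OF \<rho>0 h])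
    then show ?thesis using int sg unfolding m Q_def by simp
  qed
  have J0: "(LINT s|P. \<rho>0 (sqrt (qf ER.p0 s))) = b0"
    using scale_eq[of 0 \<beta>s \<theta>s \<sigma>0] scale_P init_P \<theta>s_in
    by (simp add: Q0 \<sigma>0_def[symmetric] WS ninv_def ER.p0_def c2 \<kappa>_def[symmetric])
  have E0: "std_expectation m (\<lambda>z::real^'k. deriv \<rho>0 (c * norm z) * (c * norm z)) = c\<^sup>2 * (LINT z|\<nu>. u_fun \<rho>0 (c * norm z) * norm z ^ 2)"
    unfolding std Bochner_Integration.integral_mult_right_zero[symmetric]
    by (rule Bochner_Integration.integral_cong) (auto simp: loss_deriv_eq_u[OF \<rho>0] power2_eq_square)
  define E where "E = std_expectation m (\<lambda>z::real^'k. deriv \<rho>0 (c * norm z) * (c * norm z))"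
  have "\<sigma>' * E = \<sigma>0 * (\<rho>0 (c * norm z0) - b0)"
  proof -
    have eq: "\<forall>\<^sub>F h in at_right 0. (1 - h) * (LINT s|P. \<rho>0 (sqrt (qf (\<beta>0 (Q h), (1 / (\<sigma> (Q h))\<^sup>2) *\<^sub>R ninv (?W (\<theta>0 (Q h)))) s)))
      + h * \<rho>0 (sqrt (qf (\<beta>0 (Q h), (1 / (\<sigma> (Q h))\<^sup>2) *\<^sub>R ninv (?W (\<theta>0 (Q h)))) s0)) = b0"
      using scQ init_Ph small
    proof eventually_elim
      case (elim h)
      then show ?case using scale_eq[OF elim(1)] by (simp add: Q_def s0_def)
    qed
    show ?thesis
      unfolding E_def E0 q0[symmetric]
      by (rule ER.scale_influence_path[OF \<rho>0 pS WS c2[unfolded \<kappa>_def] \<sigma>0 b0' _ t0' _ \<sigma>' _ eq J0])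
        (simp_all add: Q0 init_P \<sigma>0_def)
  qed
  then have \<sigma>'_eq: "\<sigma>' = \<sigma>0 * ((\<rho>0 (c * norm z0) - b0) / E)"
    using \<rho>0_pos by (simp add: E_def field_simps)

  \<comment> \<open>The linearised shape equations are the system \<open>K \<gamma>' = (k u\<^sub>1 w - u\<^sub>1 \<parallel>z\<^sub>0\<parallel>\<^sup>2 K \<theta>\<^sup>*) / (\<gamma>\<^sub>1 \<sigma>\<^sub>0\<^sup>2)\<close>,
  whose solution is \<open>\<gamma>'\<close> below; \<open>K \<theta>\<^sup>*\<close> represents \<open>h \<mapsto> trace (S\<^sup>-\<^sup>1 W h)\<close>, and \<open>v\<^sub>1 = c\<^sup>2 u\<^sub>1 \<parallel>z\<^sub>0\<parallel>\<^sup>2\<close>.\<close>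
  define K where "K = transpose L ** kronecker ?Si ?Si ** L"
  define w where "w = transpose L *v (kronecker ?Ti ?Ti *v vec_mat (outer z0 z0))"
  define u1 where "u1 = u_fun \<rho>1 (c * norm z0)"
  define v1 where "v1 = v_fun \<rho>1 (c * norm z0)"
  define e where "e = ?Ti *v z0"
  define \<gamma>' where "\<gamma>' = (1 / \<sigma>0\<^sup>2) *\<^sub>R ((?k * u1 / \<gamma>1) *\<^sub>R (matrix_inv K *v w) - (v1 / (\<gamma>1 * c\<^sup>2)) *\<^sub>R \<theta>s)"
  have v1: "v1 = c\<^sup>2 * (u1 * (norm z0)\<^sup>2)"
    unfolding v1_def u1_def v_fun_def by (simp add: loss_deriv_eq_u[OF \<rho>1(1)] power2_eq_square)
  have W_sym: "transpose (?W g) = ?W g" for g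
    unfolding lin_struct_def using Ls_sym by (simp add: transpose_def vec_eq_iff)
  have Ti_t: "transpose ?Ti = ?Ti" using pds_matrix_inv[OF T(1)] by (simp add: pds_def)
  have Si_t: "transpose ?Si = ?Si" using pds_matrix_inv[OF pS] by (simp add: pds_def)
  have SiS: "?Si ** S = mat 1" "S ** ?Si = mat 1" using matrix_inv_mult[OF pds_invertible[OF pS]] by auto
  \<comment> \<open>The Kronecker expressions as forms on the parameter space: \<open>K\<close> is the weighted trace form, and \<open>w\<close> the
  evaluation of the structure at \<open>e = S\<^sup>-\<^sup>1 (y\<^sub>0 - X\<^sub>0 \<beta>\<^sup>*)\<close>.\<close>
  have Kform: "h \<bullet> (K *v g) = trace (?Si ** ?W g ** ?Si ** ?W h)" for g h
  proof -
    have "K *v g = (kronecker ?Si ?Si *v vec_mat (?W g)) v* L"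
      by (simp add: K_def L_def vec_columns_mult flip: matrix_vector_mul_assoc)
    then have "h \<bullet> (K *v g) = (vec_mat (?Si ** ?W g ** ?Si) v* L) \<bullet> h"
      by (simp add: kronecker_vec_mat Si_t inner_commute)
    also have "\<dots> = vec_mat (?Si ** ?W g ** ?Si) \<bullet> vec_mat (?W h)"
      unfolding dot_lmul_matrix L_def vec_columns_mult ..
    also have "\<dots> = trace (?Si ** ?W g ** ?Si ** ?W h)"
    proof -
      have "transpose (?Si ** ?W g ** ?Si) = ?Si ** ?W g ** ?Si"
        by (simp add: matrix_transpose_mul Si_t W_sym matrix_mul_assoc)
      then show ?thesis by (simp add: inner_vec_mat symmetric_inner_trace)
    qed
    finally show ?thesis .
  qed
  have wform: "h \<bullet> w = e \<bullet> (?W h *v e)" for h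
  proof -
    have "?Ti ** outer z0 z0 ** ?Ti = outer e e"
    proof (rule matrix_eq[THEN iffD2, rule_format])
      fix x :: "real^'k"
      have o: "outer a b *v y = (b \<bullet> y) *\<^sub>R a" for a b y :: "real^'k"
        by (simp add: outer_def matrix_vector_mult_def vec_eq_iff inner_vec_def sum_distrib_left mult_ac)
      have "z0 \<bullet> (?Ti *v x) = e \<bullet> x" unfolding e_def by (simp add: ER.Ti_sym)
      then show "(?Ti ** outer z0 z0 ** ?Ti) *v x = outer e e *v x"
        by (simp add: o matrix_vector_mult_scaleR e_def flip: matrix_vector_mul_assoc)
    qed
    then have "h \<bullet> w = (vec_mat (outer e e) v* L) \<bullet> h"
      by (simp add: w_def kronecker_vec_mat Ti_t inner_commute)
    also have "\<dots> = vec_mat (outer e e) \<bullet> vec_mat (?W h)"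
      unfolding dot_lmul_matrix L_def vec_columns_mult ..
    also have "\<dots> = e \<bullet> (?W h *v e)"
      unfolding inner_vec_mat inner_commute[of "outer e e"] inner_outer ..
    finally show ?thesis .
  qed
  have Kpos: "0 < g \<bullet> (K *v g)" if "g \<noteq> 0" for g
    unfolding Kform by (rule ER.inverse_weighted_trace_pos[OF W_sym]) (use that W_inj in blast)
  have Kw: "K *v (matrix_inv K *v w) = w"
    using matrix_inv_mult[OF invertible_if_pos[OF Kpos]] by (simp add: matrix_vector_mul_assoc)
  have K\<gamma>': "h \<bullet> (K *v \<gamma>') = (1 / \<sigma>0\<^sup>2) * (?k * u1 / \<gamma>1 * (e \<bullet> (?W h *v e)) - u1 * (norm z0)\<^sup>2 / \<gamma>1 * trace (?Si ** ?W h))" for h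
  proof -
    have 1: "h \<bullet> (K *v \<theta>s) = trace (?Si ** ?W h)" unfolding Kform WS SiS by simp
    have 2: "v1 / (\<gamma>1 * c\<^sup>2) = u1 * (norm z0)\<^sup>2 / \<gamma>1" using cpos \<gamma>1 by (simp add: v1 field_simps)
    show ?thesis
      unfolding \<gamma>'_def matrix_vector_mult_scaleR bounded_bilinear.diff_right[OF bounded_bilinear_matrix_vector] Kw
        inner_scaleR_right inner_diff_right wform 1 2 ..
  qed
  have ee: "e \<bullet> (S *v e) = (norm z0)\<^sup>2"
  proof -
    have "T *v e = z0" unfolding e_def using matrix_inv_mult[OF pds_invertible[OF T(1)]] by (simp add: matrix_vector_mul_assoc)
    then have "e \<bullet> (T *v (T *v e)) = z0 \<bullet> z0" by (simp flip: ER.T_sym)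
    then show ?thesis by (simp add: matrix_vector_mul_assoc T(2) power2_norm_eq_inner)
  qed
  have inv0: "ER.inv0 \<kappa> = \<kappa> *\<^sub>R ?Si" by (rule ER.inv0_def[OF A])
  \<comment> \<open>The derivative of the determinant constraint: pairing with \<open>\<theta>\<^sup>*\<close>, the two terms of \<open>K \<gamma>'\<close> cancel because
  \<open>e \<bullet> S e = \<parallel>z\<^sub>0\<parallel>\<^sup>2\<close> and \<open>trace I = k\<close>.\<close>
  have tr0: "trace (ER.inv0 \<kappa> ** ?W \<gamma>') = 0"
  proof -
    have "trace (?Si ** ?W \<gamma>') = trace (?Si ** ?W \<gamma>' ** ?Si ** ?W \<theta>s)"
      unfolding WS by (simp add: SiS flip: matrix_mul_assoc)
    also have "\<dots> = \<theta>s \<bullet> (K *v \<gamma>')" by (simp only: Kform)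
    also have "\<dots> = 0" unfolding K\<gamma>' WS ee SiS trace_I by simp
    finally show ?thesis by (simp add: inv0 matrix_mult_scaleR trace_scaleR)
  qed
  have W_axis: "?W (axis j 1) = Ls j" for j
    by (simp add: lin_struct_def axis_def if_distrib[of "\<lambda>x. x *\<^sub>R _"] cong: if_cong)
  have sol: "ER.info \<rho>1 \<kappa> * trace (ER.inv0 \<kappa> ** ?W \<gamma>' ** ER.inv0 \<kappa> ** Ls j)
       + outer (wres \<rho>1 ER.p0 s0) (res ER.p0 s0) \<bullet> shape_gradient (ER.inv0 \<kappa>) (Ls j) = 0" for j
  proof -
    have 1: "trace (ER.inv0 \<kappa> ** ?W \<gamma>' ** ER.inv0 \<kappa> ** Ls j) = \<kappa>\<^sup>2 * (axis j 1 \<bullet> (K *v \<gamma>'))"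
      unfolding Kform W_axis inv0 by (simp add: matrix_mult_scaleR trace_scaleR power2_eq_square)
    have r: "res ER.p0 s0 = T *v z0" "wres \<rho>1 ER.p0 s0 = u1 *\<^sub>R (T *v z0)"
      using q0 by (simp_all add: s0 ER.res_p0 wres_def u1_def)
    have a: "ER.inv0 \<kappa> *v (T *v z0) = \<kappa> *\<^sub>R e"
      by (simp add: inv0 scaleR_matrix_vector_assoc[symmetric] ER.inverse_S_T e_def)
    have sym: "x \<bullet> (ER.inv0 \<kappa> *v y) = (ER.inv0 \<kappa> *v x) \<bullet> y" for x y
      by (simp add: inv0 scaleR_matrix_vector_assoc[symmetric] ER.Si_sym)
    have Tz: "(T *v z0) \<bullet> e = (norm z0)\<^sup>2"
      unfolding e_def by (metis ER.T_sym ER.Ti_T ER.Ti_sym power2_norm_eq_inner)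
    have "outer (wres \<rho>1 ER.p0 s0) (res ER.p0 s0) \<bullet> shape_gradient (ER.inv0 \<kappa>) (Ls j)
      = u1 * ((T *v z0) \<bullet> (shape_gradient (ER.inv0 \<kappa>) (Ls j) *v (T *v z0)))"
      unfolding r inner_commute[of "outer _ _"] inner_outer by simp
    also have "(T *v z0) \<bullet> (shape_gradient (ER.inv0 \<kappa>) (Ls j) *v (T *v z0)) =
      \<kappa>\<^sup>2 * (trace (?Si ** Ls j) / ?k * (norm z0)\<^sup>2 - e \<bullet> (Ls j *v e))"
      by (simp add: shape_gradient_def matrix_vector_mult_diff_rdistrib inner_diff_right scaleR_matrix_vector_assoc[symmetric]
          a Tz sym matrix_vector_mult_scaleR flip: matrix_vector_mul_assoc)
        (simp add: inv0 matrix_mult_scaleR trace_scaleR power2_eq_square algebra_simps)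
    finally have o: "outer (wres \<rho>1 ER.p0 s0) (res ER.p0 s0) \<bullet> shape_gradient (ER.inv0 \<kappa>) (Ls j)
      = u1 * (\<kappa>\<^sup>2 * (trace (?Si ** Ls j) / ?k * (norm z0)\<^sup>2 - e \<bullet> (Ls j *v e)))" .
    show ?thesis
      unfolding 1 K\<gamma>' W_axis info o using \<gamma>1 \<sigma>0 by (simp add: field_simps)
  qed

  \<comment> \<open>The local minima along the path satisfy the estimating equations as soon as \<open>\<gamma>\<close> is near its limit, an interior
  point of \<open>\<Theta>\<close>.\<close>
  have convQ: "((\<lambda>h. ((\<beta>1 (Q h), \<gamma> (Q h)), \<sigma> (Q h))) \<longlongrightarrow> ((\<beta>1 P, \<gamma> P), \<sigma> P)) (at_right 0)"
    using conv by (simp add: Q_def s0_def Let_def)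
  have cb: "((\<lambda>h. \<beta>1 (Q h)) \<longlongrightarrow> \<beta>s) (at_right 0)" using tendsto_fst[OF tendsto_fst[OF convQ]] by (simp add: xi_P)
  have cg: "((\<lambda>h. \<gamma> (Q h)) \<longlongrightarrow> \<gamma>0) (at_right 0)" using tendsto_snd[OF tendsto_fst[OF convQ]] by (simp add: \<gamma>0_def)
  have gint: "\<forall>\<^sub>F h in at_right 0. \<gamma> (Q h) \<in> interior \<Theta>"
    using topological_tendstoD[OF cg open_interior] \<gamma>_interior by (simp add: \<gamma>0_def)
  have minQ: "\<forall>\<^sub>F h in at_right 0. local_min_on (\<lambda>(b, g). objective \<rho>1 (Q h) (\<sigma> (Q h)) b (V g)) (feasible V \<Theta>) (\<beta>1 (Q h), \<gamma> (Q h))"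
    using min_Ph by (simp add: Q_def s0_def Let_def)
  define pp where "pp = (\<lambda>h. (\<beta>1 (Q h), (1 / (\<sigma> (Q h))\<^sup>2) *\<^sub>R matrix_inv (?W (\<gamma> (Q h)))))"
  have stat: "\<forall>\<^sub>F h in at_right 0.
     (1 - h) *\<^sub>R (\<integral>s. (snd (pp h) *v wres \<rho>1 (pp h) s) v* snd s \<partial>P) + h *\<^sub>R ((snd (pp h) *v wres \<rho>1 (pp h) s0) v* snd s0) = 0
     \<and> (\<forall>j. (1 - h) * ((\<integral>s. outer (wres \<rho>1 (pp h) s) (res (pp h) s) \<partial>P) \<bullet> shape_gradient (matrix_inv (?W (\<gamma> (Q h)))) (Ls j))
       + h * (outer (wres \<rho>1 (pp h) s0) (res (pp h) s0) \<bullet> shape_gradient (matrix_inv (?W (\<gamma> (Q h)))) (Ls j)) = 0)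
     \<and> det (?W (\<gamma> (Q h))) = 1"
    using minQ gint scQ small
  proof eventually_elim
    case (elim h)
    have h: "0 \<le> h" "h \<le> 1" using elim(4) by auto
    have sg: "0 < \<sigma> (Q h)" using elim(3) by (simp add: solves_scale_def)
    have m: "local_min_on (\<lambda>(b, g). objective \<rho>1 (contaminate P s0 h) (\<sigma> (Q h)) b (V g)) (feasible V \<Theta>) (\<beta>1 (Q h), \<gamma> (Q h))"
      using elim(1) unfolding Q_def .
    note st = ER.contaminated_stationarity[OF \<rho>1 h sg VW V_pds m elim(2), folded pp_def]
    have "\<gamma> (Q h) \<in> \<Theta>" using elim(2) interior_subset[of \<Theta>] by blast
    then have "det (?W (\<gamma> (Q h))) = 1" using elim(1) VW by (simp add: local_min_on_def feasible_def)
    moreover have "(1 - h) * ((\<integral>s. outer (wres \<rho>1 (pp h) s) (res (pp h) s) \<partial>P) \<bullet> shape_gradient (matrix_inv (?W (\<gamma> (Q h)))) (Ls j))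
       + h * (outer (wres \<rho>1 (pp h) s0) (res (pp h) s0) \<bullet> shape_gradient (matrix_inv (?W (\<gamma> (Q h)))) (Ls j)) = 0" for j
      using st(2)[of "axis j 1"] unfolding W_axis pp_def .
    ultimately show ?case using st(1) unfolding pp_def by blast
  qed
  have stat1: "\<forall>\<^sub>F h in at_right 0. (1 - h) *\<^sub>R (\<integral>s. (snd (pp h) *v wres \<rho>1 (pp h) s) v* snd s \<partial>P)
       + h *\<^sub>R ((snd (pp h) *v wres \<rho>1 (pp h) s0) v* snd s0) = 0"
    using stat by eventually_elim blast
  have stat2: "\<forall>\<^sub>F h in at_right 0. \<forall>j.
       (1 - h) * ((\<integral>s. outer (wres \<rho>1 (pp h) s) (res (pp h) s) \<partial>P) \<bullet> shape_gradient (matrix_inv (?W (\<gamma> (Q h)))) (Ls j))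
       + h * (outer (wres \<rho>1 (pp h) s0) (res (pp h) s0) \<bullet> shape_gradient (matrix_inv (?W (\<gamma> (Q h)))) (Ls j)) = 0"
    using stat by eventually_elim blast
  have stat3: "\<forall>\<^sub>F h in at_right 0. det (?W (\<gamma> (Q h))) = 1"
    using stat by eventually_elim blast
  have g': "((\<lambda>h. \<gamma> (Q h)) has_vector_derivative \<gamma>') (at 0 within {0<..})"
  proof (rule ER.shape_influence_path[OF A X_rank _ info_nz W_inj cb _ cg _ \<sigma>' _
      stat1[unfolded pp_def] stat2[unfolded pp_def] stat3 tr0 sol])
    show "ER.reg_const \<rho>1 \<noteq> 0" using reg \<alpha>1 by simp
    show "\<beta>1 (Q 0) = \<beta>s" "\<gamma> (Q 0) = \<gamma>0" "\<sigma> (Q 0) = \<sigma>0" by (simp_all add: Q0 xi_P \<gamma>0_def \<sigma>0_def)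
  qed

  have \<theta>1_eq: "\<theta>1 R = (\<sigma> R)\<^sup>2 *\<^sub>R \<gamma> R" if "\<theta>1 R \<in> \<Theta>" "V (\<theta>1 R) = (\<sigma> R)\<^sup>2 *\<^sub>R V (\<gamma> R)" "\<gamma> R \<in> \<Theta>" for R
  proof -
    have "?W (\<theta>1 R - (\<sigma> R)\<^sup>2 *\<^sub>R \<gamma> R) = 0"
      using that VW by (simp add: linear_diff[OF linear_lin_struct] linear_scale[OF linear_lin_struct])
    then show ?thesis using W_inj by fastforce
  qed
  have prod: "((\<lambda>h. (\<sigma> (Q h))\<^sup>2 *\<^sub>R \<gamma> (Q h)) has_vector_derivative (\<sigma>0\<^sup>2 *\<^sub>R \<gamma>' + (2 * \<sigma>0 * \<sigma>') *\<^sub>R \<gamma>0)) (at 0 within {0<..})"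
  proof -
    have "((\<lambda>h. \<sigma> (Q h)) has_real_derivative \<sigma>') (at 0 within {0<..})"
      using \<sigma>' by (simp add: has_real_derivative_iff_has_vector_derivative)
    from DERIV_power[OF this, of 2]
    have "((\<lambda>h. (\<sigma> (Q h))\<^sup>2) has_real_derivative 2 * \<sigma>0 * \<sigma>') (at 0 within {0<..})"
      by (simp add: Q0 \<sigma>0_def mult_ac)
    from has_vector_derivative_scaleR[OF this g'] show ?thesis by (simp add: Q0 \<sigma>0_def \<gamma>0_def)
  qed
  have final: "\<sigma>0\<^sup>2 *\<^sub>R \<gamma>' + (2 * \<sigma>0 * \<sigma>') *\<^sub>R \<gamma>0 =
    (?k * u1 / \<gamma>1) *\<^sub>R (matrix_inv K *v w) - (1 / c\<^sup>2 * (v1 / \<gamma>1 - 2 * (\<rho>0 (c * norm z0) - b0) / E)) *\<^sub>R \<theta>s"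
  proof -
    have 1: "\<sigma>0\<^sup>2 *\<^sub>R \<gamma>' = (?k * u1 / \<gamma>1) *\<^sub>R (matrix_inv K *v w) - (v1 / (\<gamma>1 * c\<^sup>2)) *\<^sub>R \<theta>s"
      using \<sigma>0 by (simp add: \<gamma>'_def)
    have "2 * \<sigma>0 * \<sigma>' * (1 / \<kappa>) = 2 * ((\<rho>0 (c * norm z0) - b0) / E) * (\<sigma>0\<^sup>2 / \<kappa>)"
      by (simp add: \<sigma>'_eq power2_eq_square)
    also have "\<sigma>0\<^sup>2 / \<kappa> = 1 / c\<^sup>2" using c2 by simp
    finally have 2: "(2 * \<sigma>0 * \<sigma>') *\<^sub>R \<gamma>0 = (2 * ((\<rho>0 (c * norm z0) - b0) / E) * (1 / c\<^sup>2)) *\<^sub>R \<theta>s"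
      by (simp add: \<gamma>0)
    have 3: "1 / c\<^sup>2 * (v1 / \<gamma>1 - 2 * (\<rho>0 (c * norm z0) - b0) / E) = v1 / (\<gamma>1 * c\<^sup>2) - 2 * ((\<rho>0 (c * norm z0) - b0) / E) * (1 / c\<^sup>2)"
      by (simp add: right_diff_distrib mult.commute)
    show ?thesis unfolding 1 2 3 scaleR_diff_left by simp
  qed
  have ev: "\<forall>\<^sub>F h in at_right 0. (\<sigma> (Q h))\<^sup>2 *\<^sub>R \<gamma> (Q h) = \<theta>1 (Q h)"
  proof -
    have "\<forall>\<^sub>F h in at_right 0. \<theta>1 (Q h) \<in> \<Theta> \<and> V (\<theta>1 (Q h)) = (\<sigma> (Q h))\<^sup>2 *\<^sub>R V (\<gamma> (Q h))"
      using \<theta>1_Ph by (simp add: Q_def s0_def Let_def)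
    then show ?thesis using gint
    proof eventually_elim
      case (elim h)
      have "\<gamma> (Q h) \<in> \<Theta>" using elim(2) interior_subset[of \<Theta>] by blast
      then show ?case using \<theta>1_eq[of "Q h"] elim(1) by simp
    qed
  qed
  have ev0: "(\<sigma> (Q 0))\<^sup>2 *\<^sub>R \<gamma> (Q 0) = \<theta>1 (Q 0)"
    unfolding Q0 using \<theta>1_eq[of P] \<theta>1_P \<gamma>0in by (simp add: \<gamma>0_def)
  have "((\<lambda>h. \<theta>1 (Q h)) has_vector_derivative (\<sigma>0\<^sup>2 *\<^sub>R \<gamma>' + (2 * \<sigma>0 * \<sigma>') *\<^sub>R \<gamma>0)) (at 0 within {0<..})"
    using prod unfolding right_derivative_iff_quotient ev0
    by (rule Lim_transform_eventually) (use ev in \<open>auto elim: eventually_mono\<close>)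
  then show ?thesis
    unfolding has_influence_iff final K_def w_def u1_def v1_def E_def T_def Q_def s0_def .
qed

end
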